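(* Let $\Omega\subset\mathbb R^2$ be either an ellipse (the image $A\mathbb D+v$ of the closed-interior unit disk under any nondegenerate linear map $A$ and translation $v$, not necessarily axis-aligned) or a rectangle with sides parallel to the coordinate axes. Then the spectrum of $P=\partial_{x_2}^2\Delta_\Omega^{-1}$ on $H^{-1}(\Omega)$ is pure point, the eigenvalues are dense in $[0,1]$, and the eigenvalues are exactly the numbers $\lambda^2$, $\lambda\in(0,1)$, for which the rotation number $\mathbf r(\lambda)$ of the chess billiard map is rational.
   Context: $\Delta_\Omega$ is the Dirichlet Laplacian; $H^{-1}(\Omega)$ has inner product $\langle u,w\rangle=\langle\nabla\Delta_\Omega^{-1}u,\nabla\Delta_\Omega^{-1}w\rangle_{L^2}$. For $\lambda\in(0,1)$ let $\ell^\pm(x)=\pm x_1/\lambda+x_2/\sqrt{1-\lambda^2}$. For such $\Omega$, each level line of $\ell^+$ (resp. $\ell^-$) meets $\partial\Omega$ in two points (or one), and $\gamma^\pm:\partial\Omega\to\partial\Omega$ maps a boundary point to the other boundary point on the same level set of $\ell^\pm$ (fixing points where there is only one); the chess billiard map is $b=\gamma^+\circ\gamma^-$, an orientation preserving circle homeomorphism. Its rotation number is $\mathbf r(\lambda)=\lim_{k\to\infty}(\mathbf b^k(x_0)-x_0)/k\in\mathbb R/\mathbb Z$, where $\mathbf b$ is a lift of $b$ to $\mathbb R$ via a positively oriented parametrization $\mathbb R/\mathbb Z\to\partial\Omega$. *)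

theory Defs
  imports "HOL-Complex_Analysis.Complex_Analysis"
begin

definition is_ellipse :: "(real^2) set \<Rightarrow> bool" where
  "is_ellipse \<Omega> \<longleftrightarrow> (\<exists>(A::real^2^2) v. det A \<noteq> 0 \<and> \<Omega> = (\<lambda>x. A *v x + v) ` cball 0 1)"

definition is_axis_rectangle :: "(real^2) set \<Rightarrow> bool" where
  "is_axis_rectangle \<Omega> \<longleftrightarrow> (\<exists>a b c d::real. a < b \<and> c < d \<and>
      \<Omega> = {x. a \<le> x$1 \<and> x$1 \<le> b \<and> c \<le> x$2 \<and> x$2 \<le> d})"

section \<open>The space H^1_0 (elements represented by pairs (u, weak gradient of u))\<close>

definition test_fun :: "(real^2) set \<Rightarrow> (real^2 \<Rightarrow> real) \<Rightarrow> (real^2 \<Rightarrow> real^2) \<Rightarrow> bool" where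
  "test_fun U \<phi> d\<phi> \<longleftrightarrow>
     (\<forall>x. (\<phi> has_derivative (\<lambda>h. d\<phi> x \<bullet> h)) (at x)) \<and> continuous_on UNIV d\<phi> \<and>
     compact (closure {x. \<phi> x \<noteq> 0}) \<and> closure {x. \<phi> x \<noteq> 0} \<subseteq> U"

text \<open>(u, g) is an element of H^1_0(U): the H^1-limit of compactly supported C^1 functions
  in U; g is then the weak gradient of u.\<close>
definition H10 :: "(real^2) set \<Rightarrow> (real^2 \<Rightarrow> real) \<Rightarrow> (real^2 \<Rightarrow> real^2) \<Rightarrow> bool" where
  "H10 U u g \<longleftrightarrow>
     u \<in> borel_measurable lborel \<and> g \<in> borel_measurable lborel \<and>
     integrable lborel (\<lambda>x. (u x)\<^sup>2) \<and> integrable lborel (\<lambda>x. (norm (g x))\<^sup>2) \<and>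
     (\<exists>\<phi> d\<phi>. (\<forall>n. test_fun U (\<phi> n) (d\<phi> n)) \<and>
        (\<lambda>n. \<integral>x. (\<phi> n x - u x)\<^sup>2 + (norm (d\<phi> n x - g x))\<^sup>2 \<partial>lborel) \<longlonglongrightarrow> 0)"

text \<open>Inner product of H^1_0 (equal to the H^{-1} inner product of \<Delta>u, \<Delta>w) and the
  form of the operator: for v = \<Delta>^{-1}u, w = \<Delta>^{-1}u', the pairing
  <P u, u'>_{H^{-1}} equals int d_2 v d_2 w.\<close>
definition ip_H10 :: "(real^2 \<Rightarrow> real^2) \<Rightarrow> (real^2 \<Rightarrow> real^2) \<Rightarrow> real" where
  "ip_H10 g h = (\<integral>x. g x \<bullet> h x \<partial>lborel)"

definition form_P :: "(real^2 \<Rightarrow> real^2) \<Rightarrow> (real^2 \<Rightarrow> real^2) \<Rightarrow> real" where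
  "form_P g h = (\<integral>x. g x $ 2 * h x $ 2 \<partial>lborel)"

text \<open>u = \<Delta> v is an eigenvector of P with eigenvalue \<mu> iff v \<noteq> 0 in H^1_0 and
  d_2^2 v = \<mu> \<Delta> v weakly.\<close>
definition P_eigvec :: "(real^2) set \<Rightarrow> real \<Rightarrow> (real^2 \<Rightarrow> real) \<Rightarrow> (real^2 \<Rightarrow> real^2) \<Rightarrow> bool" where
  "P_eigvec \<Omega> \<mu> v g \<longleftrightarrow> H10 (interior \<Omega>) v g \<and> \<not> (AE x in lborel. g x = 0) \<and>
     (\<forall>w h. H10 (interior \<Omega>) w h \<longrightarrow> form_P g h = \<mu> * ip_H10 g h)"

definition P_eigenvalues :: "(real^2) set \<Rightarrow> real set" where
  "P_eigenvalues \<Omega> = {\<mu>. \<exists>v g. P_eigvec \<Omega> \<mu> v g}"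

text \<open>\<mu> lies in the resolvent set iff P - \<mu> is bijective (bounded inverse then follows).\<close>
definition P_spectrum :: "(real^2) set \<Rightarrow> real set" where
  "P_spectrum \<Omega> = {\<mu>. \<not> (\<mu> \<notin> P_eigenvalues \<Omega> \<and>
      (\<forall>f fg. H10 (interior \<Omega>) f fg \<longrightarrow>
         (\<exists>v g. H10 (interior \<Omega>) v g \<and>
            (\<forall>w h. H10 (interior \<Omega>) w h \<longrightarrow>
               form_P g h - \<mu> * ip_H10 g h = ip_H10 fg h))))}"

definition P_pure_point :: "(real^2) set \<Rightarrow> bool" where
  "P_pure_point \<Omega> \<longleftrightarrow>
     (\<forall>v g. H10 (interior \<Omega>) v g \<longrightarrow> (\<forall>\<epsilon>>0. \<exists>n (c::nat \<Rightarrow> real) (m::nat \<Rightarrow> real) e de.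
        (\<forall>i<n. P_eigvec \<Omega> (m i) (e i) (de i)) \<and>
        ip_H10 (\<lambda>x. g x - (\<Sum>i<n. c i *\<^sub>R de i x)) (\<lambda>x. g x - (\<Sum>i<n. c i *\<^sub>R de i x)) < \<epsilon>))"

definition ell_plus :: "real \<Rightarrow> real^2 \<Rightarrow> real" where
  "ell_plus l x = x$1 / l + x$2 / sqrt (1 - l\<^sup>2)"

definition ell_minus :: "real \<Rightarrow> real^2 \<Rightarrow> real" where
  "ell_minus l x = - x$1 / l + x$2 / sqrt (1 - l\<^sup>2)"

definition gamma_map :: "(real^2) set \<Rightarrow> (real^2 \<Rightarrow> real) \<Rightarrow> real^2 \<Rightarrow> real^2" where
  "gamma_map \<Omega> ls x =
     (if \<exists>y\<in>frontier \<Omega>. y \<noteq> x \<and> ls y = ls x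
      then (THE y. y \<in> frontier \<Omega> \<and> y \<noteq> x \<and> ls y = ls x) else x)"

definition chess_map :: "(real^2) set \<Rightarrow> real \<Rightarrow> real^2 \<Rightarrow> real^2" where
  "chess_map \<Omega> l = gamma_map \<Omega> (ell_plus l) \<circ> gamma_map \<Omega> (ell_minus l)"

definition pos_param :: "(real^2) set \<Rightarrow> (real \<Rightarrow> real^2) \<Rightarrow> bool" where
  "pos_param \<Omega> p \<longleftrightarrow> continuous_on UNIV p \<and> (\<forall>t. p (t + 1) = p t) \<and>
     inj_on p {0..<1} \<and> p ` {0..1} = frontier \<Omega> \<and>
     (\<forall>z\<in>interior \<Omega>. winding_number (\<lambda>t. Complex (p t $ 1) (p t $ 2)) (Complex (z$1) (z$2)) = 1)"

definition is_lift :: "(real \<Rightarrow> real^2) \<Rightarrow> (real^2 \<Rightarrow> real^2) \<Rightarrow> (real \<Rightarrow> real) \<Rightarrow> bool" where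
  "is_lift p b L \<longleftrightarrow> continuous_on UNIV L \<and> (\<forall>t. p (L t) = b (p t))"

text \<open>Rotation number in R/Z, represented by its representative in [0,1).\<close>
definition rotation_number :: "(real^2) set \<Rightarrow> real \<Rightarrow> real" where
  "rotation_number \<Omega> l = frac (SOME r. \<exists>p L x0. pos_param \<Omega> p \<and> is_lift p (chess_map \<Omega> l) L \<and>
       (\<lambda>k. ((L ^^ k) x0 - x0) / real k) \<longlonglongrightarrow> r)"

end

theory Submission
  imports Defs "HOL-Library.Function_Algebras"
begin

text \<open>
  A function \<open>f(\<ell>\<^sup>+) + h(\<ell>\<^sup>-)\<close> that vanishes on the boundary is an eigenfunction for \<open>\<lambda>\<^sup>2\<close>. On a
  rectangle such functions are products of sines; on an ellipse, the affine image of the unit disk, they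
  are differences \<open>T\<^sub>n(\<xi>) \<plusminus> T\<^sub>n(\<eta>)\<close> of Chebyshev polynomials in the two characteristic coordinates,
  normalised to map the disk onto \<open>[-1,1]\<close>, and they vanish on the boundary iff the angle between the
  characteristic directions is a multiple of \<open>\<pi>/n\<close>. In both cases a boundary parametrization conjugates
  the chess billiard map to a rotation, whose angle is rational exactly for the same \<open>\<lambda>\<close>. The
  eigenfunctions span a dense subspace: test functions are approximated in \<open>C\<^sup>1\<close> by polynomials
  times a defining function of the domain; on the disk a dimension count shows that the Chebyshev
  eigenfunctions span all polynomials divisible by \<open>1 - |x|\<^sup>2\<close>. Since eigenvectors with different eigenvalues
  are orthogonal, there are no further eigenvalues.
\<close>

text \<open>The eigenvalues are dense in \<open>[0,1]\<close>, so no compactness argument yields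
  completeness; explicit families must be shown to span. The energy sees gradients only, so it
  suffices to approximate gradients of test functions uniformly. Membership in \<open>H10\<close>
  needs no traces: a C1 function bounded by a multiple of a defining function is cut off near the
  boundary. The natural parameter is the slope \<open>t = sqrt (1 - l\<^sup>2) / l\<close> of the
  characteristics, with eigenvalue \<open>1 / (1 + t\<^sup>2)\<close>. For an ellipse the angle
  between the characteristics in disk coordinates increases strictly with \<open>t\<close> and runs
  through all of (0, pi). Exactly \<open>n - 1\<close> multiples of \<open>pi / n\<close> lie in (0,
  pi), as many as there are monomials of degree \<open>n - 2\<close>; this makes the dimension count
  come out. The rotation number is defined by a choice among parametrizations and lifts. Every
  admissible choice gives a limit \<open>r\<close> with \<open>d * r = \<psi> / (2 * pi) + N\<close>
  for integers \<open>d \<noteq> 0\<close> and \<open>N\<close>, where \<psi> is the angle of the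
  conjugate rotation; this already decides rationality.\<close>

no_notation fps_nth (infixl "$" 75)

section \<open>Test functions and integration by parts along a direction\<close>

lemma test_fun_gradient_support:
  assumes "test_fun U \<phi> d\<phi>"
  shows "{x. d\<phi> x \<noteq> 0} \<subseteq> closure {x. \<phi> x \<noteq> 0}"
proof
  fix x assume x: "x \<in> {x. d\<phi> x \<noteq> 0}"
  show "x \<in> closure {x. \<phi> x \<noteq> 0}"
  proof (rule ccontr)
    assume n: "x \<notin> closure {x. \<phi> x \<noteq> 0}"
    have "((\<lambda>x. 0) has_derivative (\<lambda>h. d\<phi> x \<bullet> h)) (at x)"
    proof (rule has_derivative_transform_within_open)
      show "(\<phi> has_derivative (\<lambda>h. d\<phi> x \<bullet> h)) (at x)" using assms by (auto simp: test_fun_def)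
      show "open (- closure {x. \<phi> x \<noteq> 0})" by auto
      show "x \<in> - closure {x. \<phi> x \<noteq> 0}" using n by auto
      show "\<And>y. y \<in> - closure {x. \<phi> x \<noteq> 0} \<Longrightarrow> \<phi> y = 0"
        using closure_subset[of "{x. \<phi> x \<noteq> 0}"] by blast
    qed
    moreover have "((\<lambda>x. 0::real) has_derivative (\<lambda>h. 0)) (at x)" by simp
    ultimately have "(\<lambda>h. d\<phi> x \<bullet> h) = (\<lambda>h. 0)" by (rule has_derivative_unique)
    then have "d\<phi> x \<bullet> d\<phi> x = 0" by meson
    with x show False by simp
  qed
qed

lemma integrable_compact_support:
  fixes f :: "'a::euclidean_space \<Rightarrow> 'b::{banach, second_countable_topology}"
  assumes "compact K" "continuous_on UNIV f" "\<And>x. x \<notin> K \<Longrightarrow> f x = 0"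
  shows "integrable lborel f"
proof -
  have "integrable lborel (\<lambda>x. indicator K x *\<^sub>R f x)"
    by (rule borel_integrable_compact) (use assms in \<open>auto intro: continuous_on_subset\<close>)
  moreover have "(\<lambda>x. indicator K x *\<^sub>R f x) = f" using assms(3) by (auto simp: indicator_def)
  ultimately show ?thesis by simp
qed

lemma continuous_compact_support_bounded:
  fixes f :: "'a::euclidean_space \<Rightarrow> 'b::real_normed_vector"
  assumes "compact K" "continuous_on UNIV f" "\<And>x. x \<notin> K \<Longrightarrow> f x = 0"
  obtains B where "B > 0" "\<And>x. norm (f x) \<le> B"
proof -
  have "bounded (f ` K)" using assms by (meson compact_continuous_image compact_imp_bounded continuous_on_subset subset_UNIV)
  then obtain B where "B > 0" "\<And>x. x \<in> K \<Longrightarrow> norm (f x) \<le> B" by (auto simp: bounded_pos)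
  then show ?thesis using that[of B] assms(3) by (metis less_eq_real_def norm_zero)
qed

text \<open>The difference quotients of \<open>\<phi>\<close> in direction \<open>w\<close>, weighted by \<open>k\<close>, integrate to zero
  by translation invariance.\<close>
lemma integral_weighted_directional_derivative_eq_0:
  assumes t: "test_fun U \<phi> d\<phi>" and k: "continuous_on UNIV k" and inv: "\<And>x t. k (x + t *\<^sub>R w) = (k x :: real)"
  shows "(\<integral>x. k x * (d\<phi> x \<bullet> w) \<partial>lborel) = 0"
proof -
  define K where "K = closure {x. \<phi> x \<noteq> 0}"
  have d: "\<And>x. (\<phi> has_derivative (\<lambda>h. d\<phi> x \<bullet> h)) (at x)" and cd: "continuous_on UNIV d\<phi>"
    and K: "compact K" using t by (auto simp: test_fun_def K_def)
  have c\<phi>: "continuous_on UNIV \<phi>" using d by (meson continuous_at_imp_continuous_on has_derivative_continuous)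
  have z: "\<phi> x = 0" if "x \<notin> K" for x using that closure_subset[of "{x. \<phi> x \<noteq> 0}"] unfolding K_def by blast
  have dz: "d\<phi> x = 0" if "x \<notin> K" for x using that test_fun_gradient_support[OF t] unfolding K_def by blast
  obtain M where M: "M > 0" "\<And>x. norm (d\<phi> x) \<le> M" using continuous_compact_support_bounded[OF K cd dz] by blast
  obtain R where R: "\<And>x. x \<in> K \<Longrightarrow> norm x \<le> R" using compact_imp_bounded[OF K] by (auto simp: bounded_iff)
  \<comment> \<open>The radius leaves room for a translation by at most \<open>norm w\<close>:
    outside \<open>B\<close> both \<open>x\<close> and \<open>x + t n *\<^sub>R w\<close> miss the
    support, so a multiple of the indicator of \<open>B\<close> dominates all quotients.\<close>
  define B where "B = cball (0::real^2) (R + norm w)"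
  have cB: "compact B" by (simp add: B_def)
  have "bounded (k ` B)" using cB k by (meson compact_continuous_image compact_imp_bounded continuous_on_subset subset_UNIV)
  then obtain C where C: "C > 0" "\<And>x. x \<in> B \<Longrightarrow> norm (k x) \<le> C" by (auto simp: bounded_pos)
  define t where "t n = 1 / real (Suc n)" for n
  have t0: "t n > 0" "t n \<le> 1" for n by (auto simp: t_def)
  define F where "F n x = k x * ((\<phi> (x + t n *\<^sub>R w) - \<phi> x) / t n)" for n x
  have on: "onorm (\<lambda>h. d\<phi> x \<bullet> h) \<le> M" for x
    by (rule onorm_le) (metis Cauchy_Schwarz_ineq2 M(2) mult_right_mono norm_ge_zero order_trans real_norm_def)
  have lip: "\<bar>\<phi> y - \<phi> x\<bar> \<le> M * norm (y - x)" for x y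
    using differentiable_bound[OF convex_UNIV, of \<phi> "\<lambda>x h. d\<phi> x \<bullet> h" M y x] d on by auto
  have ik: "integrable lborel (\<lambda>x. k x * \<phi> x)"
    by (rule integrable_compact_support[OF K]) (use k c\<phi> z in \<open>auto intro!: continuous_intros\<close>)
  have cs: "continuous_on UNIV (\<lambda>x. \<phi> (x + s *\<^sub>R w))" for s
    by (rule continuous_on_compose2[OF c\<phi>]) (auto intro!: continuous_intros)
  \<comment> \<open>As \<open>k\<close> is constant along \<open>w\<close>, the weight can be
    translated together with \<phi>.\<close>
  have tr: "integrable lborel (\<lambda>x. k x * \<phi> (x + s *\<^sub>R w)) \<and> (\<integral>x. k x * \<phi> (x + s *\<^sub>R w) \<partial>lborel) = (\<integral>x. k x * \<phi> x \<partial>lborel)" for s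
  proof -
    have e: "(\<lambda>x. k x * \<phi> (x + s *\<^sub>R w)) = (\<lambda>x. (\<lambda>x. k x * \<phi> x) (s *\<^sub>R w + x))"
      using inv[of _ s] by (auto simp: add.commute)
    have m: "(\<lambda>x. k x * \<phi> x) \<in> borel_measurable borel"
      by (rule borel_measurable_continuous_onI) (intro continuous_intros k c\<phi>)
    have "(\<integral>x. (\<lambda>x. k x * \<phi> x) (s *\<^sub>R w + x) \<partial>lborel) = (\<integral>x. (\<lambda>x. k x * \<phi> x) x \<partial>distr lborel borel ((+) (s *\<^sub>R w)))"
      by (rule integral_distr[symmetric]) (use m in auto)
    moreover have "integrable lborel (\<lambda>x. (\<lambda>x. k x * \<phi> x) (s *\<^sub>R w + x))"
      using integrable_distr_eq[of "(+) (s *\<^sub>R w)" lborel borel "\<lambda>x. k x * \<phi> x"] m ik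
      by (simp add: lborel_distr_plus)
    ultimately show ?thesis unfolding e by (simp add: lborel_distr_plus)
  qed
  have F0: "(\<integral>x. F n x \<partial>lborel) = 0" for n
  proof -
    have "F n = (\<lambda>x. (k x * \<phi> (x + t n *\<^sub>R w) - k x * \<phi> x) / t n)" by (auto simp: F_def algebra_simps)
    then show ?thesis using tr[of "t n"] ik by simp
  qed
  have "(\<lambda>n. \<integral>x. F n x \<partial>lborel) \<longlonglongrightarrow> (\<integral>x. k x * (d\<phi> x \<bullet> w) \<partial>lborel)"
  proof (rule integral_dominated_convergence)
    show "(\<lambda>x. k x * (d\<phi> x \<bullet> w)) \<in> borel_measurable lborel"
      using k cd by (auto intro!: borel_measurable_continuous_onI continuous_intros)
    show "F n \<in> borel_measurable lborel" for n
      unfolding F_def using k c\<phi> cs t0[of n] by (auto intro!: borel_measurable_continuous_onI continuous_intros)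
    show "integrable lborel (\<lambda>x. indicator B x *\<^sub>R (C * (M * norm w)))"
      by (rule borel_integrable_compact[OF cB]) auto
    show "AE x in lborel. (\<lambda>n. F n x) \<longlonglongrightarrow> k x * (d\<phi> x \<bullet> w)"
    proof (rule AE_I2)
      fix x
      have "((\<lambda>s. \<phi> (x + s *\<^sub>R w)) has_derivative (\<lambda>s. d\<phi> (x + 0 *\<^sub>R w) \<bullet> (s *\<^sub>R w))) (at 0)"
        by (rule has_derivative_compose[where g=\<phi> and g'="\<lambda>h. d\<phi> (x + 0 *\<^sub>R w) \<bullet> h"]) (use d in \<open>auto intro!: derivative_eq_intros\<close>)
      then have "((\<lambda>s. \<phi> (x + s *\<^sub>R w)) has_real_derivative (d\<phi> x \<bullet> w)) (at 0)"
        by (simp add: has_field_derivative_def mult.commute[of _ "d\<phi> x \<bullet> w"] mult_commute_abs)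
      then have l: "((\<lambda>h. (\<phi> (x + h *\<^sub>R w) - \<phi> x) / h) \<longlongrightarrow> d\<phi> x \<bullet> w) (at 0)"
        by (simp add: DERIV_def)
      have "filterlim t (at 0) sequentially"
        unfolding filterlim_at
      proof
        show "\<forall>\<^sub>F x in sequentially. t x \<in> UNIV \<and> t x \<noteq> 0" using t0 by (simp add: less_imp_neq[symmetric])
        show "t \<longlonglongrightarrow> 0" unfolding t_def by (rule LIMSEQ_Suc[OF lim_1_over_n])
      qed
      from tendsto_mult[OF tendsto_const filterlim_compose[OF l this]]
      show "(\<lambda>n. F n x) \<longlonglongrightarrow> k x * (d\<phi> x \<bullet> w)" unfolding F_def by auto
    qed
    show "AE x in lborel. norm (F n x) \<le> indicator B x *\<^sub>R (C * (M * norm w))" for n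
    proof (rule AE_I2)
      fix x
      have ns: "norm (t n *\<^sub>R w) \<le> norm w" using t0[of n] by (simp add: mult_left_le_one_le)
      show "norm (F n x) \<le> indicator B x *\<^sub>R (C * (M * norm w))"
      proof (cases "x \<in> B")
        case True
        have "\<bar>(\<phi> (x + t n *\<^sub>R w) - \<phi> x) / t n\<bar> \<le> M * norm w"
          using lip[of "x + t n *\<^sub>R w" x] t0[of n] by (simp add: field_simps abs_mult)
        then show ?thesis using True C(2)[OF True] C(1) unfolding F_def
          by (simp only: real_norm_def abs_mult indicator_simps scaleR_one) (intro mult_mono, auto)
      next
        case False
        then have g: "norm x > R + norm w" by (simp add: B_def)
        then have "x \<notin> K" using R by (smt (verit) norm_ge_zero)
        moreover have "norm (x + t n *\<^sub>R w) > R" using g ns by (smt (verit) norm_diff_ineq)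
        then have "x + t n *\<^sub>R w \<notin> K" using R by force
        ultimately show ?thesis using z False by (simp add: F_def)
      qed
    qed
  qed
  then show ?thesis using F0 by (simp add: LIMSEQ_const_iff)
qed

section \<open>The energy inner product and complete families of eigenvectors\<close>

text \<open>The Bochner integral of a non-integrable function is 0 by convention, so
  \<open>ip_H10\<close> is bilinear only on square-integrable fields; this predicate carries that
  side condition.\<close>

definition L2_field :: "(real^2 \<Rightarrow> real^2) \<Rightarrow> bool" where
  "L2_field g \<longleftrightarrow> g \<in> borel_measurable lborel \<and> integrable lborel (\<lambda>x. (norm (g x))\<^sup>2)"

lemma norm_add_sq_le: "(norm (a + b))\<^sup>2 \<le> 2 * (norm a)\<^sup>2 + 2 * (norm (b::'a::real_inner))\<^sup>2"
proof -
  have "(norm (a + b))\<^sup>2 + (norm (a - b))\<^sup>2 = 2 * (norm a)\<^sup>2 + 2 * (norm b)\<^sup>2"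
    by (simp add: power2_norm_eq_inner algebra_simps inner_commute)
  then show ?thesis by (smt (verit) zero_le_power2)
qed

lemma abs_inner_le_sq: "\<bar>a \<bullet> b\<bar> \<le> (norm a)\<^sup>2 + (norm (b::'a::real_inner))\<^sup>2"
proof -
  have "\<bar>a \<bullet> b\<bar> \<le> norm a * norm b" by (rule Cauchy_Schwarz_ineq2)
  moreover have "2 * (norm a * norm b) \<le> (norm a)\<^sup>2 + (norm b)\<^sup>2"
    using sum_squares_bound[of "norm a" "norm b"] by (simp add: mult.assoc)
  moreover have "0 \<le> norm a * norm b" by simp
  ultimately show ?thesis by linarith
qed

lemma L2_field_dominated:
  assumes "g \<in> borel_measurable lborel" "integrable lborel f" "\<And>x. (norm (g x))\<^sup>2 \<le> f x"
  shows "L2_field g"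
  unfolding L2_field_def
proof
  show "integrable lborel (\<lambda>x. (norm (g x))\<^sup>2)"
  proof (rule Bochner_Integration.integrable_bound[OF assms(2)])
    show "AE x in lborel. norm ((norm (g x))\<^sup>2) \<le> norm (f x)"
    proof (rule AE_I2)
      fix x show "norm ((norm (g x))\<^sup>2) \<le> norm (f x)" using assms(3)[of x] by simp
    qed
  qed (use assms(1) in simp)
qed (fact assms(1))

lemma L2_field_add: "L2_field g \<Longrightarrow> L2_field h \<Longrightarrow> L2_field (\<lambda>x. g x + h x)"
  by (rule L2_field_dominated[where f="\<lambda>x. 2 * (norm (g x))\<^sup>2 + 2 * (norm (h x))\<^sup>2"])
    (auto simp: L2_field_def norm_add_sq_le)

lemma L2_field_scaleR: "L2_field g \<Longrightarrow> L2_field (\<lambda>x. c *\<^sub>R g x)"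
  by (auto simp: L2_field_def power_mult_distrib)

lemma L2_field_zero: "L2_field (\<lambda>x. 0)"
  by (auto simp: L2_field_def)

lemma L2_field_diff: "L2_field g \<Longrightarrow> L2_field h \<Longrightarrow> L2_field (\<lambda>x. g x - h x)"
  using L2_field_add[of g "\<lambda>x. (-1) *\<^sub>R h x"] L2_field_scaleR[of h "-1"] by simp

lemma L2_field_sum: "finite I \<Longrightarrow> (\<And>i. i \<in> I \<Longrightarrow> L2_field (g i)) \<Longrightarrow> L2_field (\<lambda>x. \<Sum>i\<in>I. c i *\<^sub>R g i x)"
  by (induction I rule: finite_induct) (auto simp: L2_field_zero intro!: L2_field_add L2_field_scaleR)

lemma L2_field_inner_integrable:
  assumes "L2_field g" "L2_field h"
  shows "integrable lborel (\<lambda>x. g x \<bullet> h x)"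
proof (rule Bochner_Integration.integrable_bound)
  show "integrable lborel (\<lambda>x. (norm (g x))\<^sup>2 + (norm (h x))\<^sup>2)" using assms by (auto simp: L2_field_def)
  show "AE x in lborel. norm (g x \<bullet> h x) \<le> norm ((norm (g x))\<^sup>2 + (norm (h x))\<^sup>2)"
    by (rule AE_I2) (use abs_inner_le_sq in auto)
qed (use assms in \<open>auto simp: L2_field_def\<close>)

lemma ip_H10_commute: "ip_H10 g h = ip_H10 h g"
  by (simp add: ip_H10_def inner_commute)

lemma form_P_commute: "form_P g h = form_P h g"
  by (simp add: form_P_def mult.commute)

lemma ip_H10_self: "ip_H10 g g = (\<integral>x. (norm (g x))\<^sup>2 \<partial>lborel)"
  by (simp add: ip_H10_def power2_norm_eq_inner)

lemma ip_H10_nonneg: "ip_H10 g g \<ge> 0"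
  by (simp add: ip_H10_self)

lemma ip_H10_add_right: "L2_field g \<Longrightarrow> L2_field h \<Longrightarrow> L2_field k \<Longrightarrow> ip_H10 g (\<lambda>x. h x + k x) = ip_H10 g h + ip_H10 g k"
  unfolding ip_H10_def by (simp add: inner_add_right L2_field_inner_integrable)

lemma ip_H10_scaleR_right: "ip_H10 g (\<lambda>x. c *\<^sub>R h x) = c * ip_H10 g h"
  unfolding ip_H10_def by simp

lemma ip_H10_diff_right: "L2_field g \<Longrightarrow> L2_field h \<Longrightarrow> L2_field k \<Longrightarrow> ip_H10 g (\<lambda>x. h x - k x) = ip_H10 g h - ip_H10 g k"
  unfolding ip_H10_def by (simp add: inner_diff_right L2_field_inner_integrable)

lemma ip_H10_sum_right:
  assumes "finite I" "L2_field g" "\<And>i. i \<in> I \<Longrightarrow> L2_field (h i)"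
  shows "ip_H10 g (\<lambda>x. \<Sum>i\<in>I. c i *\<^sub>R h i x) = (\<Sum>i\<in>I. c i * ip_H10 g (h i))"
  using assms(1,3)
proof (induction I rule: finite_induct)
  case empty then show ?case by (simp add: ip_H10_def)
next
  case (insert i I)
  then show ?case
    using ip_H10_add_right[OF assms(2), of "\<lambda>x. c i *\<^sub>R h i x" "\<lambda>x. \<Sum>i\<in>I. c i *\<^sub>R h i x"]
    by (simp add: L2_field_scaleR L2_field_sum ip_H10_scaleR_right)
qed

lemma ip_H10_diff_self:
  assumes "L2_field g" "L2_field h"
  shows "ip_H10 (\<lambda>x. g x - h x) (\<lambda>x. g x - h x) = ip_H10 g g - 2 * ip_H10 g h + ip_H10 h h"
proof -
  have "(g x - h x) \<bullet> (g x - h x) = g x \<bullet> g x - 2 * (g x \<bullet> h x) + h x \<bullet> h x" for x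
    by (simp add: inner_diff_left inner_diff_right inner_commute)
  then show ?thesis unfolding ip_H10_def using assms by (simp add: L2_field_inner_integrable)
qed

text \<open>The form is only semidefinite on functions, so the inequality is read off from the
  nonnegative quadratic polynomial in \<open>t\<close> given by the energy of
  \<open>g - t h\<close>.\<close>

lemma ip_H10_cauchy_schwarz:
  assumes "L2_field g" "L2_field h"
  shows "(ip_H10 g h)\<^sup>2 \<le> ip_H10 g g * ip_H10 h h"
proof -
  define a b c where "a = ip_H10 g g" and "b = ip_H10 g h" and "c = ip_H10 h h"
  have q: "0 \<le> a - 2 * t * b + t\<^sup>2 * c" for t
  proof -
    have "ip_H10 (\<lambda>x. t *\<^sub>R h x) (\<lambda>x. t *\<^sub>R h x) = t\<^sup>2 * c" by (simp add: ip_H10_def c_def power2_eq_square mult.assoc)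
    then show ?thesis
      using ip_H10_nonneg[of "\<lambda>x. g x - t *\<^sub>R h x"] ip_H10_diff_self[OF assms(1) L2_field_scaleR[OF assms(2), of t]]
      by (simp add: ip_H10_scaleR_right a_def b_def mult.assoc)
  qed
  have c0: "c \<ge> 0" by (simp add: c_def ip_H10_nonneg)
  have "b\<^sup>2 \<le> a * c"
  proof (cases "c = 0")
    case True
    have "b = 0"
    proof (rule ccontr)
      assume "b \<noteq> 0"
      \<comment> \<open>For \<open>c = 0\<close> the quadratic is affine in \<open>t\<close>; this
        \<open>t\<close> gives it the value -1.\<close>
      with q[of "(a + 1) / (2 * b)"] True show False by (simp add: field_simps)
    qed
    then show ?thesis using True by simp
  next
    case False
    then have "c > 0" using c0 by simp
    with q[of "b / c"] show ?thesis by (simp add: field_simps power2_eq_square)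
  qed
  then show ?thesis by (simp add: a_def b_def c_def)
qed

lemma ip_H10_add_self_le:
  assumes "L2_field g" "L2_field h"
  shows "ip_H10 (\<lambda>x. g x + h x) (\<lambda>x. g x + h x) \<le> 2 * ip_H10 g g + 2 * ip_H10 h h"
proof -
  have i: "integrable lborel (\<lambda>x. (norm (g x))\<^sup>2)" "integrable lborel (\<lambda>x. (norm (h x))\<^sup>2)"
     "integrable lborel (\<lambda>x. (norm (g x + h x))\<^sup>2)"
    using assms L2_field_add[OF assms] by (auto simp: L2_field_def)
  have "(\<integral>x. (norm (g x + h x))\<^sup>2 \<partial>lborel) \<le> (\<integral>x. 2 * (norm (g x))\<^sup>2 + 2 * (norm (h x))\<^sup>2 \<partial>lborel)"
    by (rule integral_mono) (use i norm_add_sq_le in auto)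
  also have "\<dots> = 2 * (\<integral>x. (norm (g x))\<^sup>2 \<partial>lborel) + 2 * (\<integral>x. (norm (h x))\<^sup>2 \<partial>lborel)"
    using i by simp
  finally show ?thesis by (simp add: ip_H10_self)
qed

lemma ip_H10_eq_0_iff:
  assumes "L2_field g"
  shows "ip_H10 g g = 0 \<longleftrightarrow> (AE x in lborel. g x = 0)"
  unfolding ip_H10_self using assms
  by (subst integral_nonneg_eq_0_iff_AE) (auto simp: L2_field_def)

lemma test_fun_L2:
  assumes "test_fun U \<phi> d\<phi>"
  shows "L2_field d\<phi>" "\<phi> \<in> borel_measurable lborel" "integrable lborel (\<lambda>x. (\<phi> x)\<^sup>2)"
proof -
  define K where "K = closure {x. \<phi> x \<noteq> 0}"
  have d: "\<And>x. (\<phi> has_derivative (\<lambda>h. d\<phi> x \<bullet> h)) (at x)" and cd: "continuous_on UNIV d\<phi>"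
    and K: "compact K" using assms by (auto simp: test_fun_def K_def)
  have c\<phi>: "continuous_on UNIV \<phi>" using d by (meson continuous_at_imp_continuous_on has_derivative_continuous)
  have z: "\<phi> x = 0" if "x \<notin> K" for x using that closure_subset[of "{x. \<phi> x \<noteq> 0}"] unfolding K_def by blast
  have dz: "d\<phi> x = 0" if "x \<notin> K" for x using that test_fun_gradient_support[OF assms] unfolding K_def by blast
  show "\<phi> \<in> borel_measurable lborel" using c\<phi> by (auto intro: borel_measurable_continuous_onI)
  show "integrable lborel (\<lambda>x. (\<phi> x)\<^sup>2)"
    by (rule integrable_compact_support[OF K]) (use c\<phi> z in \<open>auto intro!: continuous_intros\<close>)
  have "integrable lborel (\<lambda>x. (norm (d\<phi> x))\<^sup>2)"
    by (rule integrable_compact_support[OF K]) (use cd dz in \<open>auto intro!: continuous_intros\<close>)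
  then show "L2_field d\<phi>" using cd by (auto simp: L2_field_def intro: borel_measurable_continuous_onI)
qed

lemma H10_L2: "H10 U u g \<Longrightarrow> L2_field g"
  by (auto simp: H10_def L2_field_def)

lemma H10_approx_test_fun:
  assumes "H10 U u g" "\<epsilon> > 0"
  obtains \<phi> d\<phi> where "test_fun U \<phi> d\<phi>" "ip_H10 (\<lambda>x. g x - d\<phi> x) (\<lambda>x. g x - d\<phi> x) < \<epsilon>"
proof -
  obtain \<phi> d\<phi> where t: "\<And>n. test_fun U (\<phi> n) (d\<phi> n)"
    and l: "(\<lambda>n. \<integral>x. (\<phi> n x - u x)\<^sup>2 + (norm (d\<phi> n x - g x))\<^sup>2 \<partial>lborel) \<longlonglongrightarrow> 0"
    using assms(1) by (auto simp: H10_def)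
  obtain n where n: "(\<integral>x. (\<phi> n x - u x)\<^sup>2 + (norm (d\<phi> n x - g x))\<^sup>2 \<partial>lborel) < \<epsilon>"
    using order_tendstoD(2)[OF l assms(2)] by (auto simp: eventually_sequentially)
  have i1: "integrable lborel (\<lambda>x. (norm (d\<phi> n x - g x))\<^sup>2)"
    using L2_field_diff[OF test_fun_L2(1)[OF t] H10_L2[OF assms(1)]] by (auto simp: L2_field_def)
  \<comment> \<open>Without integrability of both summands the integral of the sum would be 0 by
    convention and could not bound the gradient part.\<close>
  have i2: "integrable lborel (\<lambda>x. (\<phi> n x - u x)\<^sup>2)"
  proof (rule Bochner_Integration.integrable_bound)
    show "integrable lborel (\<lambda>x. 2 * (\<phi> n x)\<^sup>2 + 2 * (u x)\<^sup>2)"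
      using test_fun_L2(3)[OF t[of n]] assms(1) by (auto simp: H10_def)
    show "(\<lambda>x. (\<phi> n x - u x)\<^sup>2) \<in> borel_measurable lborel"
      using test_fun_L2(2)[OF t[of n]] assms(1) by (auto simp: H10_def)
    show "AE x in lborel. norm ((\<phi> n x - u x)\<^sup>2) \<le> norm (2 * (\<phi> n x)\<^sup>2 + 2 * (u x)\<^sup>2)"
    proof (rule AE_I2)
      fix x show "norm ((\<phi> n x - u x)\<^sup>2) \<le> norm (2 * (\<phi> n x)\<^sup>2 + 2 * (u x)\<^sup>2)"
        using norm_add_sq_le[of "\<phi> n x" "- u x"] by simp
    qed
  qed
  have "(\<integral>x. (norm (d\<phi> n x - g x))\<^sup>2 \<partial>lborel) \<le> (\<integral>x. (\<phi> n x - u x)\<^sup>2 + (norm (d\<phi> n x - g x))\<^sup>2 \<partial>lborel)"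
    by (rule integral_mono) (use i1 i2 in auto)
  with n have "ip_H10 (\<lambda>x. g x - d\<phi> n x) (\<lambda>x. g x - d\<phi> n x) < \<epsilon>"
    by (simp add: ip_H10_self norm_minus_commute)
  with t show ?thesis using that by blast
qed

text \<open>Pairing with a single square-integrable field makes Cauchy-Schwarz available for the
  weak eigenvalue equation.\<close>

lemma form_P_minus_ip_H10:
  assumes "L2_field g" "L2_field h"
  shows "L2_field (\<lambda>x. axis 2 (g x $ 2) - \<mu> *\<^sub>R g x)"
    and "form_P g h - \<mu> * ip_H10 g h = ip_H10 (\<lambda>x. axis 2 (g x $ 2) - \<mu> *\<^sub>R g x) h"
proof -
  have a: "L2_field (\<lambda>x. axis 2 (g x $ 2))"
  proof (rule L2_field_dominated)
    show "integrable lborel (\<lambda>x. (norm (g x))\<^sup>2)" using assms by (auto simp: L2_field_def)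
    show "(norm (axis 2 (g x $ 2) :: real^2))\<^sup>2 \<le> (norm (g x))\<^sup>2" for x
      using component_le_norm_cart[of "g x" 2] by (simp add: power2_norm_eq_inner[of "axis _ _"] inner_axis_axis flip: power2_eq_square abs_le_square_iff)
    have "(\<lambda>y::real^2. axis 2 (y $ 2) :: real^2) \<in> borel_measurable borel"
      by (intro borel_measurable_continuous_onI linear_continuous_on linear_conv_bounded_linear[THEN iffD1] linearI)
         (auto simp: vec_eq_iff axis_def)
    then show "(\<lambda>x. axis 2 (g x $ 2) :: real^2) \<in> borel_measurable lborel"
      using assms measurable_compose[of g lborel borel "\<lambda>y::real^2. axis 2 (y $ 2) :: real^2" borel] by (auto simp: L2_field_def)
  qed
  show "L2_field (\<lambda>x. axis 2 (g x $ 2) - \<mu> *\<^sub>R g x)"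
    by (intro L2_field_diff a L2_field_scaleR assms)
  have "ip_H10 (\<lambda>x. axis 2 (g x $ 2)) h = form_P g h"
    by (simp add: ip_H10_def form_P_def inner_axis')
  then show "form_P g h - \<mu> * ip_H10 g h = ip_H10 (\<lambda>x. axis 2 (g x $ 2) - \<mu> *\<^sub>R g x) h"
    using ip_H10_diff_right[OF assms(2) a L2_field_scaleR[OF assms(1), of \<mu>]]
    unfolding ip_H10_scaleR_right by (metis ip_H10_commute)
qed

text \<open>The defect of the equation is a bounded linear functional of \<open>h\<close> that
  vanishes on gradients of test functions, and these approximate \<open>h\<close> in energy.\<close>

lemma weak_equation_from_test_fun:
  assumes g: "L2_field g" and t: "\<And>\<phi> d\<phi>. test_fun U \<phi> d\<phi> \<Longrightarrow> form_P g d\<phi> = \<mu> * ip_H10 g d\<phi>"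
    and h: "H10 U w h"
  shows "form_P g h = \<mu> * ip_H10 g h"
proof -
  define G where "G = (\<lambda>x. axis 2 (g x $ 2) - \<mu> *\<^sub>R g x)"
  note L = H10_L2[OF h]
  have G: "L2_field G" unfolding G_def by (rule form_P_minus_ip_H10[OF g g])
  define c where "c = ip_H10 G h"
  have "c\<^sup>2 \<le> 0 + e" if "e > 0" for e
  proof -
    \<comment> \<open>The summand 1 keeps the denominator positive when \<open>G\<close> vanishes
      almost everywhere.\<close>
    define \<epsilon> where "\<epsilon> = e / (ip_H10 G G + 1)"
    have p: "ip_H10 G G + 1 > 0" using ip_H10_nonneg[of G] by linarith
    then have \<epsilon>: "\<epsilon> > 0" using that by (simp add: \<epsilon>_def)
    obtain \<phi> d\<phi> where td: "test_fun U \<phi> d\<phi>" and le: "ip_H10 (\<lambda>x. h x - d\<phi> x) (\<lambda>x. h x - d\<phi> x) < \<epsilon>"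
      using H10_approx_test_fun[OF h \<epsilon>] by blast
    have "ip_H10 G d\<phi> = 0"
      using form_P_minus_ip_H10(2)[OF g test_fun_L2(1)[OF td], of \<mu>] t[OF td] by (simp add: G_def)
    then have "c = ip_H10 G (\<lambda>x. h x - d\<phi> x)"
      using ip_H10_diff_right[OF G L test_fun_L2(1)[OF td]] by (simp add: c_def)
    then have "c\<^sup>2 \<le> ip_H10 G G * ip_H10 (\<lambda>x. h x - d\<phi> x) (\<lambda>x. h x - d\<phi> x)"
      using ip_H10_cauchy_schwarz[OF G L2_field_diff[OF L test_fun_L2(1)[OF td]]] by simp
    also have "\<dots> \<le> (ip_H10 G G + 1) * \<epsilon>"
      using le ip_H10_nonneg[of G] ip_H10_nonneg[of "\<lambda>x. h x - d\<phi> x"] by (intro mult_mono) auto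
    also have "\<dots> = e" using p by (simp add: \<epsilon>_def)
    finally show ?thesis by simp
  qed
  then have "c\<^sup>2 \<le> 0" by (rule field_le_epsilon)
  then have "c = 0" by simp
  then show ?thesis using form_P_minus_ip_H10(2)[OF g L, of \<mu>] by (simp add: c_def G_def)
qed

text \<open>Each weak equation may be tested with the other eigenvector, and both forms are
  symmetric.\<close>

lemma eigvec_orthogonal:
  assumes "P_eigvec \<Omega> \<mu> v g" "P_eigvec \<Omega> \<nu> w h" "\<mu> \<noteq> \<nu>"
  shows "ip_H10 g h = 0"
proof -
  have "form_P g h = \<mu> * ip_H10 g h" "form_P h g = \<nu> * ip_H10 h g" using assms unfolding P_eigvec_def by blast+
  then show ?thesis using assms(3) form_P_commute[of g h] ip_H10_commute[of g h] by (metis mult_right_cancel)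
qed

lemma P_eigvec_L2: "P_eigvec \<Omega> \<mu> v g \<Longrightarrow> L2_field g"
  by (auto simp: P_eigvec_def H10_L2)

text \<open>An eigenvector for any other value is orthogonal to all members of the family;
  subtracting a combination of them cannot lower its energy, which contradicts density. Hence
  density also determines the set of eigenvalues.\<close>

theorem complete_eigenvector_family:
  assumes E: "\<And>i. i \<in> I \<Longrightarrow> P_eigvec \<Omega> (m i) (e i) (de i)"
    and dense: "\<And>\<phi> d\<phi> \<epsilon>. test_fun (interior \<Omega>) \<phi> d\<phi> \<Longrightarrow> \<epsilon> > 0 \<Longrightarrow>
      \<exists>F c. finite F \<and> F \<subseteq> I \<and> ip_H10 (\<lambda>x. d\<phi> x - (\<Sum>i\<in>F. c i *\<^sub>R de i x)) (\<lambda>x. d\<phi> x - (\<Sum>i\<in>F. c i *\<^sub>R de i x)) < \<epsilon>"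
  shows "P_pure_point \<Omega>" and "P_eigenvalues \<Omega> = m ` I"
proof -
  have appr: "\<exists>F c. finite F \<and> F \<subseteq> I \<and> ip_H10 (\<lambda>x. g x - (\<Sum>i\<in>F. c i *\<^sub>R de i x)) (\<lambda>x. g x - (\<Sum>i\<in>F. c i *\<^sub>R de i x)) < \<epsilon>"
    if h: "H10 (interior \<Omega>) v g" and p: "\<epsilon> > 0" for v g \<epsilon>
  proof -
    \<comment> \<open>A quarter suffices for each of the two errors because the energy of a sum is
      at most twice the sum of the energies.\<close>
    obtain \<phi> d\<phi> where td: "test_fun (interior \<Omega>) \<phi> d\<phi>"
      and l1: "ip_H10 (\<lambda>x. g x - d\<phi> x) (\<lambda>x. g x - d\<phi> x) < \<epsilon> / 4"
      using H10_approx_test_fun[OF h, of "\<epsilon>/4"] p by auto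
    obtain F c where F: "finite F" "F \<subseteq> I"
      and l2: "ip_H10 (\<lambda>x. d\<phi> x - (\<Sum>i\<in>F. c i *\<^sub>R de i x)) (\<lambda>x. d\<phi> x - (\<Sum>i\<in>F. c i *\<^sub>R de i x)) < \<epsilon> / 4"
      using dense[OF td, of "\<epsilon>/4"] p by auto
    have s: "L2_field (\<lambda>x. \<Sum>i\<in>F. c i *\<^sub>R de i x)" using F by (intro L2_field_sum) (auto intro: P_eigvec_L2[OF E])
    have "ip_H10 (\<lambda>x. (g x - d\<phi> x) + (d\<phi> x - (\<Sum>i\<in>F. c i *\<^sub>R de i x))) (\<lambda>x. (g x - d\<phi> x) + (d\<phi> x - (\<Sum>i\<in>F. c i *\<^sub>R de i x))) < \<epsilon>"
      using ip_H10_add_self_le[OF L2_field_diff[OF H10_L2[OF h] test_fun_L2(1)[OF td]] L2_field_diff[OF test_fun_L2(1)[OF td] s]] l1 l2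
      by linarith
    then have "ip_H10 (\<lambda>x. g x - (\<Sum>i\<in>F. c i *\<^sub>R de i x)) (\<lambda>x. g x - (\<Sum>i\<in>F. c i *\<^sub>R de i x)) < \<epsilon>"
      by simp
    with F show ?thesis by blast
  qed
  show "P_pure_point \<Omega>"
    unfolding P_pure_point_def
  proof (intro allI impI)
    fix v g and \<epsilon> :: real assume h: "H10 (interior \<Omega>) v g" and p: "\<epsilon> > 0"
    obtain F c where F: "finite F" "F \<subseteq> I"
      and l: "ip_H10 (\<lambda>x. g x - (\<Sum>i\<in>F. c i *\<^sub>R de i x)) (\<lambda>x. g x - (\<Sum>i\<in>F. c i *\<^sub>R de i x)) < \<epsilon>"
      using appr[OF h p] by blast
    obtain f where f: "bij_betw f {0..<card F} F" using ex_bij_betw_nat_finite[OF F(1)] by blast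
    have s: "(\<Sum>i\<in>F. c i *\<^sub>R de i x) = (\<Sum>i<card F. c (f i) *\<^sub>R de (f i) x)" for x
      using sum.reindex_bij_betw[OF f, of "\<lambda>i. c i *\<^sub>R de i x"] by (simp add: atLeast0LessThan)
    have eig: "\<forall>i<card F. P_eigvec \<Omega> (m (f i)) (e (f i)) (de (f i))"
      using f F(2) E bij_betwE[OF f] by (auto simp: subset_iff)
    show "\<exists>(n::nat) c m e de. (\<forall>i<n. P_eigvec \<Omega> (m i) (e i) (de i)) \<and>
        ip_H10 (\<lambda>x. g x - (\<Sum>i<n. c i *\<^sub>R de i x)) (\<lambda>x. g x - (\<Sum>i<n. c i *\<^sub>R de i x)) < \<epsilon>"
      by (rule exI, rule exI, rule exI, rule exI, rule exI, rule conjI[OF eig l[unfolded s]])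
  qed
  show "P_eigenvalues \<Omega> = m ` I"
  proof
    show "m ` I \<subseteq> P_eigenvalues \<Omega>" using E by (auto simp: P_eigenvalues_def)
    show "P_eigenvalues \<Omega> \<subseteq> m ` I"
    proof
      fix \<mu> assume "\<mu> \<in> P_eigenvalues \<Omega>"
      then obtain v g where v: "P_eigvec \<Omega> \<mu> v g" by (auto simp: P_eigenvalues_def)
      show "\<mu> \<in> m ` I"
      proof (rule ccontr)
        assume n: "\<mu> \<notin> m ` I"
        have h: "H10 (interior \<Omega>) v g" and nz: "\<not> (AE x in lborel. g x = 0)" using v by (auto simp: P_eigvec_def)
        have "ip_H10 g g \<noteq> 0" using ip_H10_eq_0_iff[OF P_eigvec_L2[OF v]] nz by simp
        then have p: "ip_H10 g g > 0" using ip_H10_nonneg[of g] by simp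
        \<comment> \<open>The tolerance is the energy of \<open>g\<close> itself, a lower bound for
          the squared distance to any field orthogonal to \<open>g\<close>.\<close>
        obtain F c where F: "finite F" "F \<subseteq> I"
          and l: "ip_H10 (\<lambda>x. g x - (\<Sum>i\<in>F. c i *\<^sub>R de i x)) (\<lambda>x. g x - (\<Sum>i\<in>F. c i *\<^sub>R de i x)) < ip_H10 g g"
          using appr[OF h p] by blast
        have Li: "L2_field (de i)" if "i \<in> F" for i using that F by (auto intro: P_eigvec_L2[OF E])
        have "ip_H10 g (\<lambda>x. \<Sum>i\<in>F. c i *\<^sub>R de i x) = (\<Sum>i\<in>F. c i * ip_H10 g (de i))"
          using F Li by (intro ip_H10_sum_right P_eigvec_L2[OF v]) auto
        also have "\<dots> = 0"
        proof (rule sum.neutral, rule ballI)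
          fix i assume "i \<in> F"
          then have "i \<in> I" using F by auto
          then have "ip_H10 g (de i) = 0" using n by (intro eigvec_orthogonal[OF v E]) auto
          then show "c i * ip_H10 g (de i) = 0" by simp
        qed
        finally have o: "ip_H10 g (\<lambda>x. \<Sum>i\<in>F. c i *\<^sub>R de i x) = 0" .
        have s: "L2_field (\<lambda>x. \<Sum>i\<in>F. c i *\<^sub>R de i x)" using F Li by (intro L2_field_sum) auto
        show False using l o ip_H10_diff_self[OF P_eigvec_L2[OF v] s] ip_H10_nonneg[of "\<lambda>x. \<Sum>i\<in>F. c i *\<^sub>R de i x"] by simp
      qed
    qed
  qed
qed

section \<open>Functions vanishing on the boundary\<close>

text \<open>Extension by zero stays C1 because \<open>U\<close> and the complement of
  \<open>K\<close> are open, cover the plane, and the extension vanishes identically on the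
  latter.\<close>

lemma test_fun_localI:
  assumes U: "open U" and K: "compact K" "K \<subseteq> U"
    and d: "\<And>x. x \<in> U \<Longrightarrow> (f has_derivative (\<lambda>h. df x \<bullet> h)) (at x)" and c: "continuous_on U df"
    and z: "\<And>x. x \<in> U \<Longrightarrow> x \<notin> K \<Longrightarrow> f x = 0"
  shows "test_fun U (\<lambda>x. if x \<in> U then f x else 0) (\<lambda>x. if x \<in> U then df x else 0)" (is "test_fun U ?F ?D")
proof -
  have oK: "open (- K)" using K by (auto simp: compact_imp_closed)
  have dz: "df x = 0" if x: "x \<in> U" "x \<notin> K" for x
  proof -
    have "((\<lambda>x. 0) has_derivative (\<lambda>h. df x \<bullet> h)) (at x)"
      by (rule has_derivative_transform_within_open[OF d[OF x(1)] open_Int[OF U oK]]) (use x z in auto)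
    moreover have "((\<lambda>x. 0::real) has_derivative (\<lambda>h. 0)) (at x)" by simp
    ultimately have "(\<lambda>h. df x \<bullet> h) = (\<lambda>h. 0)" by (rule has_derivative_unique)
    then have "df x \<bullet> df x = 0" by meson
    then show ?thesis by simp
  qed
  have "(?F has_derivative (\<lambda>h. ?D x \<bullet> h)) (at x)" for x
  proof (cases "x \<in> U")
    case True
    have "(?F has_derivative (\<lambda>h. df x \<bullet> h)) (at x)"
      by (rule has_derivative_transform_within_open[OF d[OF True] U True]) auto
    then show ?thesis using True by simp
  next
    case False
    have "(?F has_derivative (\<lambda>h. 0)) (at x)"
      by (rule has_derivative_transform_within_open[OF has_derivative_const[of 0] oK]) (use K z oK False in auto)
    then show ?thesis using False by simp
  qed
  moreover have "continuous_on UNIV ?D"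
  proof -
    have "continuous_on (U \<union> - K) ?D"
    proof (rule continuous_on_open_Un[OF U oK])
      show "continuous_on U ?D" using c by (rule continuous_on_eq) simp
      show "continuous_on (- K) ?D" using dz by (intro continuous_on_eq[OF continuous_on_const[of _ 0]]) auto
    qed
    moreover have "U \<union> - K = UNIV" using K by auto
    ultimately show ?thesis by simp
  qed
  moreover have sub: "closure {x. ?F x \<noteq> 0} \<subseteq> K"
    by (rule closure_minimal) (use z K in \<open>auto simp: compact_imp_closed\<close>)
  moreover have "compact (closure {x. ?F x \<noteq> 0})"
    using bounded_subset[OF compact_imp_bounded[OF K(1)] order_trans[OF closure_subset sub]] by (simp only: compact_closure)
  ultimately show ?thesis unfolding test_fun_def using K(2) by blast
qed

lemma has_real_derivative_max_sq: "((\<lambda>t::real. (max 0 (t - 1))\<^sup>2) has_real_derivative 2 * max 0 (t - 1)) (at t)"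
proof -
  consider "t < 1" | "t > 1" | "t = 1" by linarith
  then show ?thesis
  proof cases
    case 1
    then have m: "max 0 (t - 1) = 0" by simp
    have "((\<lambda>t::real. (max 0 (t - 1))\<^sup>2) has_real_derivative 0) (at t)"
      by (rule has_field_derivative_transform_within_open[of "\<lambda>t. 0" _ _ "{..<1}"]) (use 1 in auto)
    then show ?thesis using m by simp
  next
    case 2
    then have m: "max 0 (t - 1) = t - 1" by simp
    have "((\<lambda>t::real. (max 0 (t - 1))\<^sup>2) has_real_derivative 2 * (t - 1)) (at t)"
      by (rule has_field_derivative_transform_within_open[of "\<lambda>t. (t-1)\<^sup>2" _ _ "{1<..}"])
        (use 2 in \<open>auto intro!: derivative_eq_intros\<close>)
    then show ?thesis using m by simp
  next
    case 3
    have "((\<lambda>h::real. (max 0 h)\<^sup>2 / h) \<longlongrightarrow> 0) (at 0)"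
    proof (rule Lim_null_comparison)
      show "\<forall>\<^sub>F h in at (0::real). norm ((max 0 h)\<^sup>2 / h) \<le> \<bar>h\<bar>"
        by (rule always_eventually) (auto simp: max_def power2_eq_square)
      show "((\<lambda>h::real. \<bar>h\<bar>) \<longlongrightarrow> 0) (at 0)" by (auto intro!: tendsto_eq_intros)
    qed
    then show ?thesis using 3 by (simp add: DERIV_def)
  qed
qed

text \<open>The functions \<open>\<psi> (n * \<rho> x)\<close> cut off near the zero set of \<rho>.
  The derivative of this rational profile is controlled by its own deficit,
  \<open>\<bar>d\<psi> s\<bar> * s \<le> 3 * \<kappa> s\<close>; so the large factor
  \<open>n\<close> from the chain rule is absorbed, and every error term carries a factor \<kappa>
  that tends to 0.\<close>

lemma C1_cutoff_function:
  obtains \<psi> d\<psi> \<kappa> :: "real \<Rightarrow> real"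
  where "\<And>s. (\<psi> has_real_derivative d\<psi> s) (at s)" "continuous_on UNIV d\<psi>"
    "\<And>s. s \<le> 1 \<Longrightarrow> \<psi> s = 0" "\<And>s. \<psi> s = 1 - \<kappa> s" "\<And>s. 0 \<le> \<kappa> s" "\<And>s. \<kappa> s \<le> 1"
    "\<And>s. 0 \<le> s \<Longrightarrow> \<bar>d\<psi> s\<bar> * s \<le> 3 * \<kappa> s" "\<And>r. r > 0 \<Longrightarrow> (\<lambda>n. \<kappa> (real n * r)) \<longlonglongrightarrow> 0"
proof -
  define m :: "real \<Rightarrow> real" where "m s = max 0 (s - 1)" for s
  define \<kappa> where "\<kappa> s = 1 / (1 + (m s)\<^sup>2)" for s
  have p: "1 + (m s)\<^sup>2 > 0" for s by (smt (verit) zero_le_power2)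
  have 1: "((\<lambda>s. 1 - \<kappa> s) has_real_derivative 2 * m s / (1 + (m s)\<^sup>2)\<^sup>2) (at s)" for s
  proof -
    have "((\<lambda>s. 1 - 1 / (1 + (max 0 (s - 1))\<^sup>2)) has_real_derivative
        - ((0 * (1 + (m s)\<^sup>2) - 1 * (0 + 2 * max 0 (s - 1))) / ((1 + (m s)\<^sup>2) * (1 + (m s)\<^sup>2)))) (at s)"
      using DERIV_diff[OF DERIV_const[of 1] DERIV_divide[OF DERIV_const[of 1] DERIV_add[OF DERIV_const[of 1] has_real_derivative_max_sq[of s]]]] p[of s]
      by (simp add: m_def)
    then show ?thesis by (simp add: \<kappa>_def m_def power2_eq_square)
  qed
  have cm: "continuous_on UNIV m" unfolding m_def by (intro continuous_intros)
  have 2: "continuous_on UNIV (\<lambda>s. 2 * m s / (1 + (m s)\<^sup>2)\<^sup>2)"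
    using p by (intro continuous_intros cm) (metis less_irrefl power_not_zero)
  have q: "3 * q / q\<^sup>2 = 3 * (1 / q)" if "q > 0" for q :: real using that by (simp add: power2_eq_square)
  have 3: "\<bar>2 * m s / (1 + (m s)\<^sup>2)\<^sup>2\<bar> * s \<le> 3 * \<kappa> s" if "0 \<le> s" for s
  proof (cases "s \<le> 1")
    case True then show ?thesis by (simp add: m_def \<kappa>_def)
  next
    case False
    then have s: "s = m s + 1" and ms: "m s > 0" by (auto simp: m_def)
    \<comment> \<open>The source of the constant 3: the difference of the two sides is
      \<open>(m s - 1)\<^sup>2 + 2\<close>.\<close>
    have "2 * m s * (m s + 1) \<le> 3 * (1 + (m s)\<^sup>2)"
      using zero_le_power2[of "m s - 1"] by (simp add: power2_eq_square algebra_simps)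
    then have "2 * m s * s \<le> 3 * (1 + (m s)\<^sup>2)" using s by metis
    then have "2 * m s * s / (1 + (m s)\<^sup>2)\<^sup>2 \<le> 3 * (1 + (m s)\<^sup>2) / (1 + (m s)\<^sup>2)\<^sup>2"
      by (intro divide_right_mono) auto
    also have "\<dots> = 3 * \<kappa> s" unfolding \<kappa>_def by (rule q[OF p])
    finally show ?thesis using ms by simp
  qed
  have 4: "(\<lambda>n. \<kappa> (real n * r)) \<longlonglongrightarrow> 0" if r: "r > 0" for r
  proof -
    have "filterlim (\<lambda>n. real n * r) at_top sequentially"
      using filterlim_tendsto_pos_mult_at_top[OF tendsto_const r filterlim_real_sequentially] by (simp add: mult.commute)
    then have "filterlim (\<lambda>n. real n * r - 1) at_top sequentially"
      using filterlim_tendsto_add_at_top[OF tendsto_const[of "-1"]] by force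
    then have "filterlim (\<lambda>n. m (real n * r)) at_top sequentially"
      by (rule filterlim_at_top_mono) (auto simp: m_def)
    then have "filterlim (\<lambda>n. (m (real n * r))\<^sup>2) at_top sequentially"
      by (intro filterlim_pow_at_top) auto
    then have "filterlim (\<lambda>n. 1 + (m (real n * r))\<^sup>2) at_top sequentially"
      by (intro filterlim_tendsto_add_at_top[OF tendsto_const])
    then show ?thesis unfolding \<kappa>_def
      by (intro tendsto_divide_0[OF tendsto_const] filterlim_at_top_imp_at_infinity)
  qed
  show ?thesis
    by (rule that[of "\<lambda>s. 1 - \<kappa> s" "\<lambda>s. 2 * m s / (1 + (m s)\<^sup>2)\<^sup>2" \<kappa>, OF 1 2])
      (use 3 4 p in \<open>auto simp: \<kappa>_def m_def less_imp_le\<close>)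
qed

lemma compact_superlevel_in_open:
  assumes "bounded U" and r: "continuous_on UNIV (\<rho> :: 'a::euclidean_space \<Rightarrow> real)" and f: "\<And>x. x \<in> frontier U \<Longrightarrow> \<rho> x = 0"
    and "0 < a"
  shows "compact {x \<in> closure U. a \<le> \<rho> x}" "{x \<in> closure U. a \<le> \<rho> x} \<subseteq> U"
proof -
  have "closed {x. a \<le> \<rho> x}" using r by (intro closed_Collect_le continuous_intros)
  then have "compact (closure U \<inter> {x. a \<le> \<rho> x})" using assms by (intro compact_Int_closed) auto
  moreover have "closure U \<inter> {x. a \<le> \<rho> x} = {x \<in> closure U. a \<le> \<rho> x}" by auto
  ultimately show "compact {x \<in> closure U. a \<le> \<rho> x}" by simp
  show "{x \<in> closure U. a \<le> \<rho> x} \<subseteq> U"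
  proof clarify
    fix x assume x: "x \<in> closure U" "a \<le> \<rho> x"
    then have "x \<notin> frontier U" using f[of x] assms(4) by auto
    with x show "x \<in> U" using closure_Un_frontier[of U] by auto
  qed
qed

text \<open>Derivatives are kept as inner products with a gradient, the shape in which
  \<open>test_fun\<close> demands them.\<close>

lemma has_gradient_mult:
  fixes df dg :: "'a::real_inner"
  assumes "(f has_derivative (\<lambda>h. df \<bullet> h)) (at x)" "(g has_derivative (\<lambda>h. dg \<bullet> h)) (at x)"
  shows "((\<lambda>x. f x * g x) has_derivative (\<lambda>h. (f x *\<^sub>R dg + g x *\<^sub>R df) \<bullet> h)) (at x)"
  by (rule has_derivative_eq_rhs[OF has_derivative_mult[OF assms]]) (auto simp: algebra_simps)

lemma has_gradient_compose:
  fixes dg :: "'a::real_inner"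
  assumes "(f has_real_derivative df) (at (g x))" "(g has_derivative (\<lambda>h. dg \<bullet> h)) (at x)"
  shows "((\<lambda>x. f (g x)) has_derivative (\<lambda>h. (df *\<^sub>R dg) \<bullet> h)) (at x)"
  using has_derivative_compose[OF assms(2), of f "(*) df"] assms(1) by (simp add: has_field_derivative_def)

lemma has_gradient_cmult:
  fixes dg :: "'a::real_inner"
  assumes "(g has_derivative (\<lambda>h. dg \<bullet> h)) (at x)"
  shows "((\<lambda>x. c * g x) has_derivative (\<lambda>h. (c *\<^sub>R dg) \<bullet> h)) (at x)"
  by (rule has_derivative_eq_rhs[OF has_derivative_mult_right[OF assms]]) auto

lemma has_gradient_add:
  fixes df dg :: "'a::real_inner"
  assumes "(f has_derivative (\<lambda>h. df \<bullet> h)) (at x)" "(g has_derivative (\<lambda>h. dg \<bullet> h)) (at x)"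
  shows "((\<lambda>x. f x + g x) has_derivative (\<lambda>h. (df + dg) \<bullet> h)) (at x)"
  by (rule has_derivative_eq_rhs[OF has_derivative_add[OF assms]]) (auto simp: algebra_simps)

text \<open>The bound by a multiple of \<rho> takes the place of a trace theorem. In the gradient of
  \<open>\<psi> (N n * \<rho> x) * u x\<close> the dangerous coefficient is
  \<open>d\<psi> (N n * \<rho> x) * N n * u x\<close>; as
  \<open>\<bar>u x\<bar> \<le> C * \<rho> x\<close>, its absolute value is at most
  \<open>3 * C * \<kappa> (N n * \<rho> x)\<close>, which stays bounded and tends to 0
  pointwise.\<close>

lemma H10_C1_vanishing:
  assumes U: "open U" "bounded U"
    and u: "\<And>x. (u has_derivative (\<lambda>h. du x \<bullet> h)) (at x)" "continuous_on UNIV du"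
    and r: "\<And>x. (\<rho> has_derivative (\<lambda>h. d\<rho> x \<bullet> h)) (at x)" "continuous_on UNIV d\<rho>"
    and pos: "\<And>x. x \<in> U \<Longrightarrow> \<rho> x > 0" and fr: "\<And>x. x \<in> frontier U \<Longrightarrow> \<rho> x = 0"
    and bd: "\<And>x. x \<in> U \<Longrightarrow> \<bar>u x\<bar> \<le> C * \<rho> x"
  shows "H10 U (\<lambda>x. if x \<in> U then u x else 0) (\<lambda>x. if x \<in> U then du x else 0)" (is "H10 U ?u ?g")
proof -
  obtain \<psi> d\<psi> \<kappa> :: "real \<Rightarrow> real" where \<psi>: "\<And>s. (\<psi> has_real_derivative d\<psi> s) (at s)" "continuous_on UNIV d\<psi>"
    "\<And>s. s \<le> 1 \<Longrightarrow> \<psi> s = 0" "\<And>s. \<psi> s = 1 - \<kappa> s" "\<And>s. 0 \<le> \<kappa> s" "\<And>s. \<kappa> s \<le> 1"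
    "\<And>s. 0 \<le> s \<Longrightarrow> \<bar>d\<psi> s\<bar> * s \<le> 3 * \<kappa> s" "\<And>r. r > 0 \<Longrightarrow> (\<lambda>n. \<kappa> (real n * r)) \<longlonglongrightarrow> 0"
    by (rule C1_cutoff_function) blast
  have cu: "continuous_on UNIV u" and c\<rho>: "continuous_on UNIV \<rho>"
    using u(1) r(1) by (meson continuous_at_imp_continuous_on has_derivative_continuous)+
  have c\<psi>: "continuous_on UNIV \<psi>" using \<psi>(1) by (meson continuous_at_imp_continuous_on DERIV_isCont)
  define N where "N n = real (Suc n)" for n
  define f where "f n x = \<psi> (N n * \<rho> x) * u x" for n x
  define df where "df n x = \<psi> (N n * \<rho> x) *\<^sub>R du x + u x *\<^sub>R (d\<psi> (N n * \<rho> x) *\<^sub>R (N n *\<^sub>R d\<rho> x))" for n x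
  define \<phi> where "\<phi> n x = (if x \<in> U then f n x else 0)" for n x
  define d\<phi> where "d\<phi> n x = (if x \<in> U then df n x else 0)" for n x
  have Np: "N n > 0" for n by (simp add: N_def)
  have t: "test_fun U (\<phi> n) (d\<phi> n)" for n
    unfolding \<phi>_def[abs_def] d\<phi>_def[abs_def]
  proof (rule test_fun_localI[OF U(1), where K="{x \<in> closure U. 1 / N n \<le> \<rho> x}"])
    show "compact {x \<in> closure U. 1 / N n \<le> \<rho> x}" "{x \<in> closure U. 1 / N n \<le> \<rho> x} \<subseteq> U"
      using compact_superlevel_in_open[OF U(2) c\<rho> fr, of "1 / N n"] Np by auto
    show "(f n has_derivative (\<lambda>h. df n x \<bullet> h)) (at x)" for x
      unfolding f_def[abs_def] df_def
      by (intro has_gradient_mult has_gradient_compose[OF \<psi>(1)] has_gradient_cmult u(1) r(1))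
    show "continuous_on U (df n)"
    proof -
      have "continuous_on UNIV (df n)" unfolding df_def[abs_def]
        by (intro continuous_intros u r cu c\<rho> continuous_on_compose2[OF c\<psi>] continuous_on_compose2[OF \<psi>(2)]) auto
      then show ?thesis by (rule continuous_on_subset) auto
    qed
    show "f n x = 0" if "x \<in> U" "x \<notin> {x \<in> closure U. 1 / N n \<le> \<rho> x}" for x
    proof -
      have "\<rho> x < 1 / N n" using that closure_subset[of U] by auto
      then have "N n * \<rho> x \<le> 1" using Np[of n] by (simp add: field_simps)
      then show ?thesis by (simp add: f_def \<psi>(3))
    qed
  qed
  have bC: "compact (closure U)" using U by simp
  \<comment> \<open>The dominating function. By \<open>norm_add_sq_le\<close> the squared gradient
    error is at most twice the sum of the two squares; 18 is twice the square of the factor 3 in the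
    cutoff estimate.\<close>
  define w where "w x = (u x)\<^sup>2 + (2 * (norm (du x))\<^sup>2 + 18 * C\<^sup>2 * (norm (d\<rho> x))\<^sup>2)" for x
  have cw: "continuous_on S w" for S unfolding w_def
    by (intro continuous_intros continuous_on_subset[OF cu] continuous_on_subset[OF u(2)] continuous_on_subset[OF r(2)]) auto
  have w0: "w x \<ge> 0" for x by (simp add: w_def)
  have mU[measurable]: "U \<in> sets borel" using U by auto
  have meas: "?u \<in> borel_measurable lborel" "?g \<in> borel_measurable lborel"
  proof -
    have [measurable]: "u \<in> borel_measurable borel" "du \<in> borel_measurable borel"
      using cu u(2) by (auto intro: borel_measurable_continuous_onI)
    show "?u \<in> borel_measurable lborel" "?g \<in> borel_measurable lborel" by measurable
  qed
  have iw: "integrable lborel (\<lambda>x. indicator (closure U) x *\<^sub>R w x)"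
    by (rule borel_integrable_compact[OF bC cw])
  have i1: "integrable lborel (\<lambda>x. (?u x)\<^sup>2)"
  proof (rule Bochner_Integration.integrable_bound[OF iw])
    show "AE x in lborel. norm ((?u x)\<^sup>2) \<le> norm (indicator (closure U) x *\<^sub>R w x)"
      by (rule AE_I2) (use closure_subset[of U] in \<open>auto simp: w_def indicator_def\<close>)
  qed (use meas in measurable)
  have i2: "integrable lborel (\<lambda>x. (norm (?g x))\<^sup>2)"
  proof (rule Bochner_Integration.integrable_bound[OF iw])
    show "AE x in lborel. norm ((norm (?g x))\<^sup>2) \<le> norm (indicator (closure U) x *\<^sub>R w x)"
      by (rule AE_I2) (use closure_subset[of U] in \<open>auto simp: w_def indicator_def abs_of_nonneg\<close>)
  qed (use meas in measurable)
  define G where "G n x = (\<phi> n x - ?u x)\<^sup>2 + (norm (d\<phi> n x - ?g x))\<^sup>2" for n x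
  have Gb: "G n x \<le> (\<kappa> (N n * \<rho> x))\<^sup>2 * w x" if x: "x \<in> U" for n x
  proof -
    define k where "k = \<kappa> (N n * \<rho> x)"
    have k0: "k \<ge> 0" unfolding k_def by (rule \<psi>(5))
    have e1: "\<phi> n x - ?u x = - k * u x" using x by (simp add: \<phi>_def f_def \<psi>(4) k_def algebra_simps)
    define a where "a = (d\<psi> (N n * \<rho> x) * N n * u x) *\<^sub>R d\<rho> x"
    have e2: "d\<phi> n x - ?g x = (- k) *\<^sub>R du x + a" using x
      by (simp add: d\<phi>_def df_def \<psi>(4) k_def a_def algebra_simps)
    have "\<bar>d\<psi> (N n * \<rho> x) * N n * u x\<bar> \<le> \<bar>d\<psi> (N n * \<rho> x)\<bar> * N n * (C * \<rho> x)"
      using bd[OF x] Np[of n] by (simp add: abs_mult mult_left_mono)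
    also have "\<dots> = C * (\<bar>d\<psi> (N n * \<rho> x)\<bar> * (N n * \<rho> x))" by simp
    also have "\<dots> \<le> C * (3 * k)"
    proof (rule mult_left_mono)
      show "\<bar>d\<psi> (N n * \<rho> x)\<bar> * (N n * \<rho> x) \<le> 3 * k" unfolding k_def
        by (rule \<psi>(7)) (use pos[OF x] Np[of n] in auto)
      have "0 \<le> C * \<rho> x" using bd[OF x] by linarith
      then show "0 \<le> C" using pos[OF x] by (simp add: zero_le_mult_iff)
    qed
    finally have "norm a \<le> (C * (3 * k)) * norm (d\<rho> x)" unfolding a_def by (simp add: mult_right_mono)
    then have "(norm a)\<^sup>2 \<le> ((C * (3 * k)) * norm (d\<rho> x))\<^sup>2" by (intro power_mono) auto
    then have "(norm a)\<^sup>2 \<le> 9 * C\<^sup>2 * k\<^sup>2 * (norm (d\<rho> x))\<^sup>2" by (simp add: power_mult_distrib mult_ac)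
    moreover have "(norm ((- k) *\<^sub>R du x + a))\<^sup>2 \<le> 2 * (norm ((- k) *\<^sub>R du x))\<^sup>2 + 2 * (norm a)\<^sup>2"
      by (rule norm_add_sq_le)
    ultimately show ?thesis unfolding G_def e1 e2 w_def k_def[symmetric]
      by (simp add: power_mult_distrib algebra_simps)
  qed
  have Gz: "G n x = 0" if "x \<notin> U" for n x using that by (simp add: G_def \<phi>_def d\<phi>_def)
  have G0: "0 \<le> G n x" for n x by (simp add: G_def)
  have "(\<lambda>n. \<integral>x. G n x \<partial>lborel) \<longlonglongrightarrow> (\<integral>x. 0 \<partial>(lborel :: (real^2) measure))"
  proof (rule integral_dominated_convergence[OF _ _ iw])
    show "G n \<in> borel_measurable lborel" for n
      unfolding G_def using meas test_fun_L2(1,2)[OF t[of n]] by (auto simp: L2_field_def)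
    show "AE x in lborel. (\<lambda>n. G n x) \<longlonglongrightarrow> 0"
    proof (rule AE_I2)
      fix x
      show "(\<lambda>n. G n x) \<longlonglongrightarrow> 0"
      proof (cases "x \<in> U")
        case True
        have "(\<lambda>n. \<kappa> (N n * \<rho> x)) \<longlonglongrightarrow> 0"
          using LIMSEQ_Suc[OF \<psi>(8)[OF pos[OF True]]] by (simp add: N_def)
        then have "(\<lambda>n. (\<kappa> (N n * \<rho> x))\<^sup>2 * w x) \<longlonglongrightarrow> 0"
          by (auto intro!: tendsto_eq_intros)
        then show ?thesis
          by (rule Lim_null_comparison[rotated]) (use Gb[OF True] G0 in \<open>auto intro: always_eventually\<close>)
      next
        case False then show ?thesis using Gz by simp
      qed
    qed
    show "AE x in lborel. norm (G n x) \<le> indicator (closure U) x *\<^sub>R w x" for n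
    proof (rule AE_I2)
      fix x
      show "norm (G n x) \<le> indicator (closure U) x *\<^sub>R w x"
      proof (cases "x \<in> U")
        case True
        have "(\<kappa> (N n * \<rho> x))\<^sup>2 \<le> 1" using \<psi>(5,6) by (simp add: power_le_one)
        then have "(\<kappa> (N n * \<rho> x))\<^sup>2 * w x \<le> w x" using w0[of x] by (simp add: mult_left_le_one_le)
        moreover have "x \<in> closure U" using True closure_subset by auto
        ultimately show ?thesis using Gb[OF True, of n] G0[of n x] by simp
      next
        case False then show ?thesis using Gz w0 by (simp add: indicator_def)
      qed
    qed
  qed simp
  then have "(\<lambda>n. \<integral>x. G n x \<partial>lborel) \<longlonglongrightarrow> 0" by simp
  then show ?thesis unfolding H10_def G_def using t meas i1 i2 by blast
qed

section \<open>Plane waves as eigenfunctions\<close>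

lemma not_AE_zero_on_open:
  fixes g :: "'a::euclidean_space \<Rightarrow> 'b::real_normed_vector"
  assumes "open U" "continuous_on U g" "x \<in> U" "g x \<noteq> 0"
  shows "\<not> (AE x in lborel. (if x \<in> U then g x else 0) = 0)"
proof
  assume ae: "AE x in lborel. (if x \<in> U then g x else 0) = 0"
  define V where "V = U \<inter> g -` (- {0})"
  have o: "open V" unfolding V_def by (rule continuous_open_preimage[OF assms(2,1)]) auto
  have ne: "V \<noteq> {}" using assms by (auto simp: V_def)
  have "AE x in lborel. x \<notin> V" using ae by eventually_elim (auto simp: V_def split: if_splits)
  then have "V \<in> null_sets lborel" using o by (subst AE_iff_null_sets) auto
  then have "negligible V" unfolding negligible_iff_null_sets by (rule null_sets_completionI)
  then show False using open_not_negligible[OF o ne] by simp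
qed

lemma ell_plus_eq_inner: "ell_plus l x = vector [1 / l, 1 / sqrt (1 - l\<^sup>2)] \<bullet> x"
  by (simp add: ell_plus_def inner_vec_def sum_2)

lemma ell_minus_eq_inner: "ell_minus l x = vector [- 1 / l, 1 / sqrt (1 - l\<^sup>2)] \<bullet> x"
  by (simp add: ell_minus_def inner_vec_def sum_2)

text \<open>By d'Alembert, these are the solutions of \<open>\<partial>\<^sub>2\<^sup>2 u = l\<^sup>2 \<Delta> u\<close>.\<close>
definition wave :: "real \<Rightarrow> (real \<Rightarrow> real) \<Rightarrow> (real \<Rightarrow> real) \<Rightarrow> real^2 \<Rightarrow> real" where
  "wave l f h x = f (ell_plus l x) + h (ell_minus l x)"

definition wave_grad :: "real \<Rightarrow> (real \<Rightarrow> real) \<Rightarrow> (real \<Rightarrow> real) \<Rightarrow> real^2 \<Rightarrow> real^2" where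
  "wave_grad l f' h' x = f' (ell_plus l x) *\<^sub>R vector [1 / l, 1 / sqrt (1 - l\<^sup>2)]
     + h' (ell_minus l x) *\<^sub>R vector [- 1 / l, 1 / sqrt (1 - l\<^sup>2)]"

lemma wave_has_gradient:
  assumes "\<And>t. (f has_real_derivative f' t) (at t)" "\<And>t. (h has_real_derivative h' t) (at t)"
  shows "(wave l f h has_derivative (\<lambda>y. wave_grad l f' h' x \<bullet> y)) (at x)"
  unfolding wave_def[abs_def] wave_grad_def
  by (intro has_gradient_add has_gradient_compose assms)
     (auto simp: ell_plus_eq_inner ell_minus_eq_inner intro!: derivative_eq_intros)

lemma continuous_on_ell: "continuous_on S (ell_plus l)" "continuous_on S (ell_minus l)"
  unfolding ell_plus_eq_inner[abs_def] ell_minus_eq_inner[abs_def] by (auto intro!: continuous_intros)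

lemma continuous_on_wave_grad:
  assumes "continuous_on UNIV f'" "continuous_on UNIV h'"
  shows "continuous_on UNIV (wave_grad l f' h')"
  unfolding wave_grad_def[abs_def]
  by (intro continuous_intros continuous_on_compose2[OF assms(1)] continuous_on_compose2[OF assms(2)] continuous_on_ell) auto

text \<open>Multiplying the components of the wave gradient by \<open>- l\<^sup>2\<close> and
  \<open>1 - l\<^sup>2\<close> gives \<open>f' (ell_plus l x) *\<^sub>R wp + h' (ell_minus l x)
  *\<^sub>R wm\<close> with constant vectors along the level lines. Each weight is invariant in its
  own direction, so both integrals against a test function vanish. Only first derivatives of the
  profiles occur.\<close>

lemma wave_P_eigvec:
  assumes l: "0 < l" "l < 1" and bd: "bounded \<Omega>"
    and f: "\<And>t. (f has_real_derivative f' t) (at t)" "continuous_on UNIV f'"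
    and h: "\<And>t. (h has_real_derivative h' t) (at t)" "continuous_on UNIV h'"
    and r: "\<And>x. (\<rho> has_derivative (\<lambda>y. d\<rho> x \<bullet> y)) (at x)" "continuous_on UNIV d\<rho>"
    and pos: "\<And>x. x \<in> interior \<Omega> \<Longrightarrow> \<rho> x > 0" and fr: "\<And>x. x \<in> frontier (interior \<Omega>) \<Longrightarrow> \<rho> x = 0"
    and le: "\<And>x. x \<in> interior \<Omega> \<Longrightarrow> \<bar>wave l f h x\<bar> \<le> C * \<rho> x"
    and nz: "x0 \<in> interior \<Omega>" "wave_grad l f' h' x0 \<noteq> 0"
  shows "P_eigvec \<Omega> (l\<^sup>2) (\<lambda>x. if x \<in> interior \<Omega> then wave l f h x else 0)
     (\<lambda>x. if x \<in> interior \<Omega> then wave_grad l f' h' x else 0)" (is "P_eigvec \<Omega> _ ?u ?g")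
proof -
  define s where "s = sqrt (1 - l\<^sup>2)"
  have l2: "l\<^sup>2 < 1" using l by (simp add: power_less_one_iff)
  then have s: "s > 0" "s\<^sup>2 = 1 - l\<^sup>2" by (auto simp: s_def)
  note cg = continuous_on_wave_grad[OF f(2) h(2), of l]
  have H: "H10 (interior \<Omega>) ?u ?g"
    by (rule H10_C1_vanishing[OF _ _ wave_has_gradient[OF f(1) h(1)] cg r pos fr le])
      (use bd bounded_interior in auto)
  have n: "\<not> (AE x in lborel. ?g x = 0)"
    by (rule not_AE_zero_on_open[OF _ continuous_on_subset[OF cg] nz]) auto
  have "form_P ?g d\<phi> = l\<^sup>2 * ip_H10 ?g d\<phi>" if t: "test_fun (interior \<Omega>) \<phi> d\<phi>" for \<phi> d\<phi>
  proof -
    define K where "K = closure {x. \<phi> x \<noteq> 0}"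
    have K: "compact K" "K \<subseteq> interior \<Omega>" using t by (auto simp: test_fun_def K_def)
    have dz: "d\<phi> x = 0" if "x \<notin> K" for x using that test_fun_gradient_support[OF t] unfolding K_def by blast
    have cd: "continuous_on UNIV d\<phi>" using t by (auto simp: test_fun_def)
    \<comment> \<open>Tangents to the level lines: \<open>ell_plus l wp = 0\<close> and
      \<open>ell_minus l wm = 0\<close>.\<close>
    define wp wm :: "real^2" where "wp = vector [-l, s]" and "wm = vector [l, s]"
    have pw: "(axis 2 (?g x $ 2) - l\<^sup>2 *\<^sub>R ?g x) \<bullet> d\<phi> x =
      f' (ell_plus l x) * (d\<phi> x \<bullet> wp) + h' (ell_minus l x) * (d\<phi> x \<bullet> wm)" for x
    proof (cases "x \<in> K")
      case True
      define a b where "a = f' (ell_plus l x)" and "b = h' (ell_minus l x)"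
      have g: "?g x = vector [(a - b) / l, (a + b) / s]"
        using True K by (auto simp: wave_grad_def vec_eq_iff forall_2 a_def b_def s_def add_divide_distrib diff_divide_distrib)
      have "(axis 2 (?g x $ 2) - l\<^sup>2 *\<^sub>R ?g x) \<bullet> d\<phi> x =
          (1 - l\<^sup>2) * ((a + b) / s) * d\<phi> x $ 2 - l\<^sup>2 * ((a - b) / l) * d\<phi> x $ 1"
        unfolding g by (simp add: inner_vec_def sum_2 axis_def algebra_simps)
      also have "(1 - l\<^sup>2) * ((a + b) / s) = s * (a + b)" unfolding s(2)[symmetric] using s(1) by (simp add: power2_eq_square)
      also have "l\<^sup>2 * ((a - b) / l) = l * (a - b)" using l by (simp add: power2_eq_square)
      finally show ?thesis unfolding a_def[symmetric] b_def[symmetric]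
        by (simp add: wp_def wm_def inner_vec_def sum_2 algebra_simps)
    next
      case False then show ?thesis by (simp add: dz)
    qed
    have c1: "continuous_on UNIV (\<lambda>x. f' (ell_plus l x))" "continuous_on UNIV (\<lambda>x. h' (ell_minus l x))"
      by (intro continuous_on_compose2[OF f(2) continuous_on_ell(1)] continuous_on_compose2[OF h(2) continuous_on_ell(2)], auto)+
    have i: "integrable lborel (\<lambda>x. f' (ell_plus l x) * (d\<phi> x \<bullet> wp))" "integrable lborel (\<lambda>x. h' (ell_minus l x) * (d\<phi> x \<bullet> wm))"
      by (rule integrable_compact_support[OF K(1)]; use c1 cd dz in \<open>auto intro!: continuous_intros\<close>)+
    have "form_P ?g d\<phi> - l\<^sup>2 * ip_H10 ?g d\<phi> = ip_H10 (\<lambda>x. axis 2 (?g x $ 2) - l\<^sup>2 *\<^sub>R ?g x) d\<phi>"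
      by (rule form_P_minus_ip_H10(2)[OF H10_L2[OF H] test_fun_L2(1)[OF t]])
    also have "\<dots> = (\<integral>x. f' (ell_plus l x) * (d\<phi> x \<bullet> wp) + h' (ell_minus l x) * (d\<phi> x \<bullet> wm) \<partial>lborel)"
      unfolding ip_H10_def pw ..
    also have "\<dots> = (\<integral>x. f' (ell_plus l x) * (d\<phi> x \<bullet> wp) \<partial>lborel) + (\<integral>x. h' (ell_minus l x) * (d\<phi> x \<bullet> wm) \<partial>lborel)"
      by (rule Bochner_Integration.integral_add[OF i])
    also have "(\<integral>x. f' (ell_plus l x) * (d\<phi> x \<bullet> wp) \<partial>lborel) = 0"
    proof (rule integral_weighted_directional_derivative_eq_0[OF t c1(1)])
      have "ell_plus l (x + c *\<^sub>R wp) = ell_plus l x" for x c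
        using l s by (simp add: ell_plus_def wp_def s_def[symmetric] field_simps)
      then show "f' (ell_plus l (x + c *\<^sub>R wp)) = f' (ell_plus l x)" for x c by simp
    qed
    also have "(\<integral>x. h' (ell_minus l x) * (d\<phi> x \<bullet> wm) \<partial>lborel) = 0"
    proof (rule integral_weighted_directional_derivative_eq_0[OF t c1(2)])
      have "ell_minus l (x + c *\<^sub>R wm) = ell_minus l x" for x c
        using l s by (simp add: ell_minus_def wm_def s_def[symmetric] field_simps)
      then show "h' (ell_minus l (x + c *\<^sub>R wm)) = h' (ell_minus l x)" for x c by simp
    qed
    finally show ?thesis by simp
  qed
  then have "\<forall>w k. H10 (interior \<Omega>) w k \<longrightarrow> form_P ?g k = l\<^sup>2 * ip_H10 ?g k"
    using weak_equation_from_test_fun[OF H10_L2[OF H]] by blast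
  with H n show ?thesis unfolding P_eigvec_def by blast
qed

lemma ip_H10_le_uniform:
  assumes "L2_field k" "bounded U" "open U" "\<And>x. x \<notin> U \<Longrightarrow> k x = 0" "\<And>x. x \<in> U \<Longrightarrow> norm (k x) \<le> \<epsilon>"
  shows "ip_H10 k k \<le> \<epsilon>\<^sup>2 * measure lborel U"
proof -
  have fin: "emeasure lborel U < \<infinity>" by (rule emeasure_bounded_finite[OF assms(2)])
  have sU: "U \<in> sets lborel" using assms(3) by auto
  have "(\<integral>x. (norm (k x))\<^sup>2 \<partial>lborel) \<le> (\<integral>x. \<epsilon>\<^sup>2 * indicator U x \<partial>lborel)"
  proof (rule integral_mono)
    show "integrable lborel (\<lambda>x. (norm (k x))\<^sup>2)" using assms(1) by (auto simp: L2_field_def)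
    show "integrable lborel (\<lambda>x. \<epsilon>\<^sup>2 * indicator U x)" using fin sU by auto
    show "(norm (k x))\<^sup>2 \<le> \<epsilon>\<^sup>2 * indicator U x" for x
      using assms(4,5)[of x] by (cases "x \<in> U") (auto intro: power_mono)
  qed
  then show ?thesis using sU by (simp add: ip_H10_self)
qed

text \<open>On a bounded domain uniform closeness of gradients implies closeness in energy, so
  density can be checked in the supremum norm.\<close>

theorem complete_eigenvector_family_uniform:
  assumes bd: "bounded \<Omega>"
    and E: "\<And>i. i \<in> I \<Longrightarrow> P_eigvec \<Omega> (m i) (\<lambda>x. if x \<in> interior \<Omega> then u i x else 0) (\<lambda>x. if x \<in> interior \<Omega> then du i x else 0)"
    and dense: "\<And>\<phi> d\<phi> \<epsilon>. test_fun (interior \<Omega>) \<phi> d\<phi> \<Longrightarrow> \<epsilon> > 0 \<Longrightarrow>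
      \<exists>F c. finite F \<and> F \<subseteq> I \<and> (\<forall>x\<in>interior \<Omega>. norm (d\<phi> x - (\<Sum>i\<in>F. c i *\<^sub>R du i x)) \<le> \<epsilon>)"
  shows "P_pure_point \<Omega> \<and> P_eigenvalues \<Omega> = m ` I"
proof -
  define U where "U = interior \<Omega>"
  define de where "de i x = (if x \<in> interior \<Omega> then du i x else 0)" for i x
  have U: "open U" "bounded U" using bd bounded_interior by (auto simp: U_def)
  have E': "P_eigvec \<Omega> (m i) (\<lambda>x. if x \<in> interior \<Omega> then u i x else 0) (de i)" if "i \<in> I" for i
    using E[OF that] unfolding de_def .
  have d: "\<exists>F c. finite F \<and> F \<subseteq> I \<and> ip_H10 (\<lambda>x. d\<phi> x - (\<Sum>i\<in>F. c i *\<^sub>R de i x)) (\<lambda>x. d\<phi> x - (\<Sum>i\<in>F. c i *\<^sub>R de i x)) < \<epsilon>"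
    if t: "test_fun (interior \<Omega>) \<phi> d\<phi>" and e: "\<epsilon> > 0" for \<phi> d\<phi> \<epsilon>
  proof -
    \<comment> \<open>The summand 1 makes \<open>M\<close> positive and strictly larger than the
      measure, which yields the strict inequality in the end.\<close>
    define M where "M = measure lborel U + 1"
    have M: "M > 0" "measure lborel U < M" by (auto simp: M_def intro: add_nonneg_pos)
    define \<delta> where "\<delta> = sqrt (\<epsilon> / M)"
    have dp: "\<delta> > 0" "\<delta>\<^sup>2 = \<epsilon> / M" using e M by (auto simp: \<delta>_def)
    obtain F c where F: "finite F" "F \<subseteq> I" and le: "\<And>x. x \<in> U \<Longrightarrow> norm (d\<phi> x - (\<Sum>i\<in>F. c i *\<^sub>R du i x)) \<le> \<delta>"
      using dense[OF t dp(1)] by (auto simp: U_def)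
    have z: "d\<phi> x = 0" if "x \<notin> U" for x
      using that test_fun_gradient_support[OF t] t by (auto simp: U_def test_fun_def)
    define k where "k x = d\<phi> x - (\<Sum>i\<in>F. c i *\<^sub>R de i x)" for x
    have "L2_field k" unfolding k_def
      using F by (intro L2_field_diff L2_field_sum test_fun_L2(1)[OF t]) (auto intro: P_eigvec_L2[OF E'])
    then have "ip_H10 k k \<le> \<delta>\<^sup>2 * measure lborel U"
      by (rule ip_H10_le_uniform[OF _ U(2,1)]) (use z le in \<open>auto simp: k_def de_def U_def\<close>)
    also have "\<dots> < \<delta>\<^sup>2 * M" using dp M e by (intro mult_strict_left_mono) auto
    also have "\<dots> = \<epsilon>" using dp M by simp
    finally show ?thesis using F unfolding k_def by blast
  qed
  show ?thesis
    by (intro conjI; rule complete_eigenvector_family[of I], erule E', erule (1) d)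
qed

section \<open>Polynomial approximation of functions and gradients\<close>

text \<open>The variance of a binomial mean: the square is expanded into the factorial moments 1,
  \<open>k\<close> and \<open>k * (k - 1)\<close>, whose Bernstein sums are known.\<close>

lemma sum_Bernstein_variance:
  assumes "n > 0"
  shows "(\<Sum>k\<le>n. (x - real k / real n)\<^sup>2 * Bernstein n k x) = x * (1 - x) / real n"
proof -
  have n: "real n > 0" using assms by simp
  have e: "(x - real k / real n)\<^sup>2 * Bernstein n k x =
     x\<^sup>2 * Bernstein n k x + ((1 - 2 * real n * x) / (real n)\<^sup>2) * (real k * Bernstein n k x)
     + (1 / (real n)\<^sup>2) * (real k * (real k - 1) * Bernstein n k x)" for k
    using n by (simp add: field_simps power2_eq_square)
  show ?thesis unfolding e sum.distrib sum_distrib_left[symmetric] sum_Bernstein sum_k_Bernstein sum_kk_Bernstein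
    using n by (simp add: field_simps power2_eq_square)
qed

lemma has_real_derivative_one_minus_power:
  "((\<lambda>x::real. (1 - x) ^ m) has_real_derivative - (real m * (1 - x) ^ (m - 1))) (at x)"
  by (rule derivative_eq_intros refl | simp)+

lemma has_real_derivative_Bernstein_0:
  "(Bernstein (Suc n) 0 has_real_derivative - (real (Suc n) * Bernstein n 0 x)) (at x)"
  using has_real_derivative_one_minus_power[of "Suc n" x] unfolding Bernstein_def[abs_def] by simp

lemma has_real_derivative_Bernstein_Suc:
  assumes "k \<le> n"
  shows "(Bernstein (Suc n) (Suc k) has_real_derivative real (Suc n) * (Bernstein n k x - Bernstein n (Suc k) x)) (at x)"
proof -
  have 1: "real (Suc n choose Suc k) * real (Suc k) = real (Suc n) * real (n choose k)"
    using Suc_times_binomial_eq[of n k] by (metis of_nat_mult)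
  have "(Suc n choose Suc k) * (n - k) = Suc n * (n choose Suc k)"
    using binomial_absorb_comp[of "Suc n" "Suc k"] by (simp add: mult.commute)
  then have 2: "real (Suc n choose Suc k) * real (n - k) = real (Suc n) * real (n choose Suc k)"
    by (metis of_nat_mult)
  have "((\<lambda>x. real (Suc n choose Suc k) * x ^ Suc k * (1 - x) ^ (n - k)) has_real_derivative
      real (Suc n choose Suc k) * real (Suc k) * x ^ k * (1 - x) ^ (n - k)
      - real (Suc n choose Suc k) * real (n - k) * x ^ Suc k * (1 - x) ^ (n - k - 1)) (at x)"
    using DERIV_mult[OF DERIV_cmult[OF DERIV_pow[of "Suc k" x], of "real (Suc n choose Suc k)"] has_real_derivative_one_minus_power[of "n - k" x]]
    by (simp only: diff_Suc_Suc minus_nat.diff_0) (simp only: algebra_simps One_nat_def minus_mult_left[symmetric] minus_mult_right[symmetric] diff_conv_add_uminus)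
  then show ?thesis unfolding 1 2 unfolding Bernstein_def[abs_def] by (simp add: algebra_simps)
qed

text \<open>Summation by parts moves the difference from the basis polynomials to the coefficients.
  The derivative is again a Bernstein sum, now with difference quotients as coefficients, which is
  why Bernstein sums approximate together with first derivatives.\<close>

lemma has_real_derivative_Bernstein_sum:
  "((\<lambda>x. \<Sum>i\<le>Suc n. a i * Bernstein (Suc n) i x) has_real_derivative
     (\<Sum>i\<le>n. real (Suc n) * (a (Suc i) - a i) * Bernstein n i x)) (at x)"
proof -
  have B: "Bernstein n (Suc n) x = 0" by (simp add: Bernstein_def)
  have "((\<lambda>x. a 0 * Bernstein (Suc n) 0 x + (\<Sum>i\<le>n. a (Suc i) * Bernstein (Suc n) (Suc i) x)) has_real_derivative
     a 0 * (- (real (Suc n) * Bernstein n 0 x)) +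
     (\<Sum>i\<le>n. a (Suc i) * (real (Suc n) * (Bernstein n i x - Bernstein n (Suc i) x)))) (at x)"
    by (intro DERIV_add DERIV_cmult DERIV_sum has_real_derivative_Bernstein_0 has_real_derivative_Bernstein_Suc) auto
  moreover have "(\<lambda>x. a 0 * Bernstein (Suc n) 0 x + (\<Sum>i\<le>n. a (Suc i) * Bernstein (Suc n) (Suc i) x))
     = (\<lambda>x. \<Sum>i\<le>Suc n. a i * Bernstein (Suc n) i x)"
    by (subst sum.atMost_Suc_shift) simp
  moreover have "a 0 * (- (real (Suc n) * Bernstein n 0 x)) +
     (\<Sum>i\<le>n. a (Suc i) * (real (Suc n) * (Bernstein n i x - Bernstein n (Suc i) x)))
     = (\<Sum>i\<le>n. real (Suc n) * (a (Suc i) - a i) * Bernstein n i x)"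
  proof -
    have "(\<Sum>i\<le>n. a i * Bernstein n i x) = (\<Sum>i\<le>Suc n. a i * Bernstein n i x)" using B by simp
    also have "\<dots> = a 0 * Bernstein n 0 x + (\<Sum>i\<le>n. a (Suc i) * Bernstein n (Suc i) x)"
      by (rule sum.atMost_Suc_shift)
    finally have s: "(\<Sum>i\<le>n. a (Suc i) * Bernstein n (Suc i) x) = (\<Sum>i\<le>n. a i * Bernstein n i x) - a 0 * Bernstein n 0 x" by simp
    have "(\<Sum>i\<le>n. a (Suc i) * (real (Suc n) * (Bernstein n i x - Bernstein n (Suc i) x)))
      = real (Suc n) * ((\<Sum>i\<le>n. a (Suc i) * Bernstein n i x) - (\<Sum>i\<le>n. a (Suc i) * Bernstein n (Suc i) x))"
      by (simp only: sum_distrib_left sum_subtractf[symmetric]) (auto intro!: sum.cong simp: algebra_simps)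
    moreover have "(\<Sum>i\<le>n. real (Suc n) * (a (Suc i) - a i) * Bernstein n i x)
      = real (Suc n) * ((\<Sum>i\<le>n. a (Suc i) * Bernstein n i x) - (\<Sum>i\<le>n. a i * Bernstein n i x))"
      by (simp only: sum_distrib_left sum_subtractf[symmetric]) (auto intro!: sum.cong simp: algebra_simps)
    ultimately show ?thesis unfolding s by (simp add: algebra_simps)
  qed
  ultimately show ?thesis by simp
qed

lemma sum_Bernstein2_weighted:
  assumes "n > 0" "m > 0"
  shows "(\<Sum>i\<le>n. \<Sum>j\<le>m. (c + d * ((x - real i / real n)\<^sup>2 + (y - real j / real m)\<^sup>2)) * (Bernstein n i x * Bernstein m j y))
    = c + d * (x * (1 - x) / real n + y * (1 - y) / real m)"
proof -
  define v w where "v i = (x - real i / real n)\<^sup>2" and "w j = (y - real j / real m)\<^sup>2" for i j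
  have "(\<Sum>j\<le>m. (c + d * (v i + w j)) * (Bernstein n i x * Bernstein m j y))
     = (c + d * v i) * Bernstein n i x * (\<Sum>j\<le>m. Bernstein m j y) + d * Bernstein n i x * (\<Sum>j\<le>m. w j * Bernstein m j y)" for i
    unfolding sum_distrib_left sum.distrib[symmetric] by (rule sum.cong) (auto simp: algebra_simps)
  then have "(\<Sum>i\<le>n. \<Sum>j\<le>m. (c + d * (v i + w j)) * (Bernstein n i x * Bernstein m j y))
     = (\<Sum>i\<le>n. (c + d * v i) * Bernstein n i x + d * Bernstein n i x * (y * (1 - y) / real m))"
    using sum_Bernstein_variance[OF assms(2), of y] by (simp add: w_def)
  also have "\<dots> = (\<Sum>i\<le>n. (c + d * (y * (1 - y) / real m)) * Bernstein n i x + d * (v i * Bernstein n i x))"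
    by (rule sum.cong) (auto simp: algebra_simps)
  also have "\<dots> = (c + d * (y * (1 - y) / real m)) + d * (x * (1 - x) / real n)"
    using sum_Bernstein_variance[OF assms(1), of x] by (simp add: sum.distrib sum_distrib_left[symmetric] v_def)
  finally show ?thesis by (simp add: v_def w_def algebra_simps)
qed

text \<open>Chebyshev's argument in two variables: near nodes contribute at most \<open>e/2\<close>
  by uniform continuity, far nodes are dominated by the squared distance, whose Bernstein mean is a
  variance. The two degrees are independent because a partial derivative lowers only one of
  them.\<close>

lemma Bernstein2_approx:
  fixes f :: "real \<Rightarrow> real \<Rightarrow> real"
  assumes cont: "continuous_on ({0..1} \<times> {0..1}) (\<lambda>p. f (fst p) (snd p))" and e: "e > 0"
  shows "\<exists>N. \<forall>n m x y. N \<le> n \<and> N \<le> m \<and> x \<in> {0..1} \<and> y \<in> {0..1} \<longrightarrow>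
    \<bar>f x y - (\<Sum>i\<le>n. \<Sum>j\<le>m. f (real i / real n) (real j / real m) * (Bernstein n i x * Bernstein m j y))\<bar> < e"
proof -
  let ?Q = "{0..1::real} \<times> {0..1::real}"
  have cQ: "compact ?Q" by (intro compact_Times) auto
  have "bounded ((\<lambda>p. f (fst p) (snd p)) ` ?Q)"
    by (intro compact_imp_bounded compact_continuous_image cont cQ)
  then obtain M where M: "M > 0" "\<And>p. p \<in> ?Q \<Longrightarrow> norm (f (fst p) (snd p)) \<le> M" by (auto simp: bounded_pos)
  obtain d where d: "d > 0" "\<And>p q. p \<in> ?Q \<Longrightarrow> q \<in> ?Q \<Longrightarrow> dist q p < d \<Longrightarrow> dist (f (fst q) (snd q)) (f (fst p) (snd p)) < e/2"
    using uniformly_continuous_onE[OF compact_uniformly_continuous[OF cont cQ], of "e/2"] e by auto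
  \<comment> \<open>Each variance is at most \<open>1 / N\<close>, so the far contribution is at
    most \<open>4 * M / (d\<^sup>2 * N)\<close>, which this choice pushes below
    \<open>e/2\<close>.\<close>
  obtain N :: nat where N: "real N > 8 * M / (e * d\<^sup>2)" using reals_Archimedean2 by blast
  have "8 * M / (e * d\<^sup>2) > 0" using M d e by simp
  then have N0: "N > 0" using N by (metis less_trans of_nat_0_less_iff)
  have "\<bar>f x y - (\<Sum>i\<le>n. \<Sum>j\<le>m. f (real i / real n) (real j / real m) * (Bernstein n i x * Bernstein m j y))\<bar> < e"
    if nm: "N \<le> n" "N \<le> m" and x: "x \<in> {0..1}" and y: "y \<in> {0..1}" for n m x y
  proof -
    have n0: "n > 0" "m > 0" using nm N0 by auto
    have pt: "\<bar>f x y - f (real i / real n) (real j / real m)\<bar> \<le> e/2 + (2 * M / d\<^sup>2) * ((x - real i / real n)\<^sup>2 + (y - real j / real m)\<^sup>2)"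
      if "i \<le> n" "j \<le> m" for i j
    proof -
      define s t where "s = real i / real n" and "t = real j / real m"
      have st: "(s,t) \<in> ?Q" using that n0 by (auto simp: s_def t_def)
      have xy: "(x,y) \<in> ?Q" using x y by auto
      have nn: "0 \<le> (2 * M / d\<^sup>2) * ((x - s)\<^sup>2 + (y - t)\<^sup>2)" using M d by simp
      show ?thesis
      proof (cases "dist (x,y) (s,t) < d")
        case True
        then show ?thesis using d(2)[OF st xy] nn unfolding s_def[symmetric] t_def[symmetric] by (simp add: dist_real_def)
      next
        case False
        then have "d\<^sup>2 \<le> (dist (x,y) (s,t))\<^sup>2" using d(1) by (intro power_mono) auto
        also have "\<dots> = (x - s)\<^sup>2 + (y - t)\<^sup>2" by (simp add: dist_prod_def dist_real_def)
        finally have "2 * M \<le> (2 * M / d\<^sup>2) * ((x - s)\<^sup>2 + (y - t)\<^sup>2)"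
          using mult_left_mono[of "d\<^sup>2" _ "2 * M / d\<^sup>2"] M d by simp
        moreover have "\<bar>f x y - f s t\<bar> \<le> 2 * M" using M(2)[OF xy] M(2)[OF st] by simp
        ultimately show ?thesis using e unfolding s_def[symmetric] t_def[symmetric] by linarith
      qed
    qed
    have B0: "0 \<le> Bernstein n i x * Bernstein m j y" for i j using x y by (auto intro!: mult_nonneg_nonneg Bernstein_nonneg)
    have one: "f x y = (\<Sum>i\<le>n. \<Sum>j\<le>m. f x y * (Bernstein n i x * Bernstein m j y))"
      by (simp add: sum_distrib_left[symmetric])
    have "f x y - (\<Sum>i\<le>n. \<Sum>j\<le>m. f (real i / real n) (real j / real m) * (Bernstein n i x * Bernstein m j y))
      = (\<Sum>i\<le>n. \<Sum>j\<le>m. (f x y - f (real i / real n) (real j / real m)) * (Bernstein n i x * Bernstein m j y))"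
      by (subst one) (simp add: sum_subtractf[symmetric] left_diff_distrib)
    also have "\<bar>\<dots>\<bar> \<le> (\<Sum>i\<le>n. \<Sum>j\<le>m. \<bar>(f x y - f (real i / real n) (real j / real m)) * (Bernstein n i x * Bernstein m j y)\<bar>)"
      by (intro order_trans[OF sum_abs] sum_mono sum_abs)
    also have "\<dots> \<le> (\<Sum>i\<le>n. \<Sum>j\<le>m. (e/2 + (2 * M / d\<^sup>2) * ((x - real i / real n)\<^sup>2 + (y - real j / real m)\<^sup>2)) * (Bernstein n i x * Bernstein m j y))"
    proof (intro sum_mono)
      fix i j assume "i \<in> {..n}" "j \<in> {..m}"
      then show "\<bar>(f x y - f (real i / real n) (real j / real m)) * (Bernstein n i x * Bernstein m j y)\<bar>
        \<le> (e/2 + (2 * M / d\<^sup>2) * ((x - real i / real n)\<^sup>2 + (y - real j / real m)\<^sup>2)) * (Bernstein n i x * Bernstein m j y)"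
        unfolding abs_mult[of "f x y - f (real i / real n) (real j / real m)"] abs_of_nonneg[OF B0]
        by (intro mult_right_mono pt B0) auto
    qed
    also have "\<dots> = e/2 + (2 * M / d\<^sup>2) * (x * (1 - x) / real n + y * (1 - y) / real m)"
      by (rule sum_Bernstein2_weighted[OF n0])
    also have "\<dots> \<le> e/2 + (2 * M / d\<^sup>2) * (1 / real N + 1 / real N)"
    proof -
      have "x * (1 - x) / real n \<le> 1 / real N" using x nm N0 by (intro frac_le) (auto simp: mult_le_one)
      moreover have "y * (1 - y) / real m \<le> 1 / real N" using y nm N0 by (intro frac_le) (auto simp: mult_le_one)
      ultimately show ?thesis using M d by (intro add_left_mono mult_left_mono) auto
    qed
    also have "\<dots> < e"
      using N N0 M d e by (simp add: field_simps)
    finally show ?thesis .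
  qed
  then show ?thesis by blast
qed

text \<open>By the mean value theorem each coefficient of the differentiated sum is a value of
  \<open>fx\<close> close to the node \<open>i / n\<close>; replacing it by the value at the node
  gives the Bernstein sum of \<open>fx\<close> of degrees \<open>n\<close> and
  \<open>n + 1\<close>.\<close>

lemma Bernstein2_approx_dx:
  fixes f :: "real \<Rightarrow> real \<Rightarrow> real"
  assumes deriv: "\<And>x y. ((\<lambda>x. f x y) has_real_derivative fx x y) (at x)"
    and cont: "continuous_on ({0..1} \<times> {0..1}) (\<lambda>p. fx (fst p) (snd p))" and e: "e > 0"
  shows "\<exists>N. \<forall>n x y. N \<le> n \<and> x \<in> {0..1} \<and> y \<in> {0..1} \<longrightarrow>
    \<bar>fx x y - (\<Sum>i\<le>n. real (Suc n) *
       ((\<Sum>j\<le>Suc n. f (real (Suc i) / real (Suc n)) (real j / real (Suc n)) * Bernstein (Suc n) j y)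
        - (\<Sum>j\<le>Suc n. f (real i / real (Suc n)) (real j / real (Suc n)) * Bernstein (Suc n) j y)) * Bernstein n i x)\<bar> < e"
proof -
  let ?Q = "{0..1::real} \<times> {0..1::real}"
  have cQ: "compact ?Q" by (intro compact_Times) auto
  obtain d where d: "d > 0" "\<And>p q. p \<in> ?Q \<Longrightarrow> q \<in> ?Q \<Longrightarrow> dist q p < d \<Longrightarrow> dist (fx (fst q) (snd q)) (fx (fst p) (snd p)) < e/2"
    using uniformly_continuous_onE[OF compact_uniformly_continuous[OF cont cQ], of "e/2"] e by auto
  obtain N1 where N1: "\<And>n m x y. N1 \<le> n \<and> N1 \<le> m \<and> x \<in> {0..1} \<and> y \<in> {0..1} \<Longrightarrow>
    \<bar>fx x y - (\<Sum>i\<le>n. \<Sum>j\<le>m. fx (real i / real n) (real j / real m) * (Bernstein n i x * Bernstein m j y))\<bar> < e/2"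
    using Bernstein2_approx[OF cont, of "e/2"] e by auto
  obtain N2 :: nat where N2: "real N2 > 1 / d" using reals_Archimedean2 by blast
  define N where "N = max (max N1 N2) 1"
  have "\<bar>fx x y - (\<Sum>i\<le>n. real (Suc n) *
       ((\<Sum>j\<le>Suc n. f (real (Suc i) / real (Suc n)) (real j / real (Suc n)) * Bernstein (Suc n) j y)
        - (\<Sum>j\<le>Suc n. f (real i / real (Suc n)) (real j / real (Suc n)) * Bernstein (Suc n) j y)) * Bernstein n i x)\<bar> < e"
    if n: "N \<le> n" and x: "x \<in> {0..1}" and y: "y \<in> {0..1}" for n x y
  proof -
    have n0: "n > 0" and nN1: "N1 \<le> n" "N1 \<le> Suc n" and nN2: "N2 \<le> n" using n by (auto simp: N_def)
    have dn: "1 / real (Suc n) < d"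
    proof -
      have "1 / d < real (Suc n)" using N2 nN2 by linarith
      then show ?thesis using d(1) by (simp add: field_simps)
    qed
    define G where "G i j = real (Suc n) * (f (real (Suc i) / real (Suc n)) (real j / real (Suc n)) - f (real i / real (Suc n)) (real j / real (Suc n)))" for i j
    have G: "\<bar>G i j - fx (real i / real n) (real j / real (Suc n))\<bar> \<le> e/2" if ij: "i \<le> n" "j \<le> Suc n" for i j
    proof -
      define a b t where "a = real i / real (Suc n)" and "b = real (Suc i) / real (Suc n)" and "t = real j / real (Suc n)"
      have ab: "a < b" "b - a = 1 / real (Suc n)" by (auto simp: a_def b_def divide_simps)
      obtain z where z: "a < z" "z < b" "f b t - f a t = (b - a) * fx z t"
        using MVT2[OF ab(1), of "\<lambda>x. f x t" "\<lambda>x. fx x t"] deriv by auto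
      have Gz: "G i j = fx z t" 
      proof -
        have "G i j = real (Suc n) * (f b t - f a t)" by (simp only: G_def a_def b_def t_def)
        also have "\<dots> = real (Suc n) * (1 / real (Suc n) * fx z t)" by (simp only: z(3) ab(2))
        finally show ?thesis by simp
      qed
      \<comment> \<open>The node \<open>i / n\<close> of the lower degree lies between
        \<open>i / (n + 1)\<close> and \<open>(i + 1) / (n + 1)\<close>, hence within
        \<open>1 / (n + 1)\<close> of the intermediate point \<open>z\<close>.\<close>
      define c where "c = real i / real n"
      have ac: "a \<le> c" using n0 by (auto simp: a_def c_def intro!: divide_left_mono)
      have cb: "c \<le> b" using n0 ij by (simp add: c_def b_def divide_simps algebra_simps)
      have a0: "0 \<le> a" and b1: "b \<le> 1" using ij by (auto simp: a_def b_def)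
      have t01: "t \<in> {0..1}" using ij by (auto simp: t_def)
      have "\<bar>z - c\<bar> < d" using z ac cb ab(2) dn by linarith
      then have "dist (z,t) (c,t) < d" by (simp add: dist_prod_def dist_real_def)
      then have "dist (fx z t) (fx c t) < e/2"
        using d(2)[of "(c,t)" "(z,t)"] z ac cb a0 b1 t01 by auto
      then show ?thesis unfolding Gz c_def[symmetric] t_def[symmetric] by (simp add: dist_real_def)
    qed
    have B0: "0 \<le> Bernstein n i x * Bernstein (Suc n) j y" for i j using x y by (auto intro!: mult_nonneg_nonneg Bernstein_nonneg)
    define S1 where "S1 = (\<Sum>i\<le>n. \<Sum>j\<le>Suc n. G i j * (Bernstein n i x * Bernstein (Suc n) j y))"
    define S2 where "S2 = (\<Sum>i\<le>n. \<Sum>j\<le>Suc n. fx (real i / real n) (real j / real (Suc n)) * (Bernstein n i x * Bernstein (Suc n) j y))"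
    have eq: "(\<Sum>i\<le>n. real (Suc n) *
       ((\<Sum>j\<le>Suc n. f (real (Suc i) / real (Suc n)) (real j / real (Suc n)) * Bernstein (Suc n) j y)
        - (\<Sum>j\<le>Suc n. f (real i / real (Suc n)) (real j / real (Suc n)) * Bernstein (Suc n) j y)) * Bernstein n i x) = S1"
      unfolding S1_def G_def sum_subtractf[symmetric] sum_distrib_left sum_distrib_right
      by (intro sum.cong refl) (simp only: algebra_simps)
    have "\<bar>S1 - S2\<bar> = \<bar>\<Sum>i\<le>n. \<Sum>j\<le>Suc n. (G i j - fx (real i / real n) (real j / real (Suc n))) * (Bernstein n i x * Bernstein (Suc n) j y)\<bar>"
      unfolding S1_def S2_def sum_subtractf[symmetric] left_diff_distrib ..
    also have "\<dots> \<le> (\<Sum>i\<le>n. \<Sum>j\<le>Suc n. \<bar>(G i j - fx (real i / real n) (real j / real (Suc n))) * (Bernstein n i x * Bernstein (Suc n) j y)\<bar>)"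
      by (intro order_trans[OF sum_abs] sum_mono sum_abs)
    also have "\<dots> \<le> (\<Sum>i\<le>n. \<Sum>j\<le>Suc n. e/2 * (Bernstein n i x * Bernstein (Suc n) j y))"
    proof (intro sum_mono)
      fix i j assume "i \<in> {..n}" "j \<in> {..Suc n}"
      then show "\<bar>(G i j - fx (real i / real n) (real j / real (Suc n))) * (Bernstein n i x * Bernstein (Suc n) j y)\<bar> \<le> e/2 * (Bernstein n i x * Bernstein (Suc n) j y)"
        unfolding abs_mult[of "G i j - fx (real i / real n) (real j / real (Suc n))"] abs_of_nonneg[OF B0]
        by (intro mult_right_mono G B0) auto
    qed
    also have "\<dots> = e/2" by (simp only: sum_distrib_left[symmetric] sum_distrib_right[symmetric] sum_Bernstein mult_1_right)
    finally have "\<bar>S1 - S2\<bar> \<le> e/2" .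
    moreover have "\<bar>fx x y - S2\<bar> < e/2" unfolding S2_def by (rule N1) (use nN1 x y in auto)
    ultimately show ?thesis unfolding eq by linarith
  qed
  then show ?thesis by blast
qed

lemma real_polynomial_function_has_gradient:
  assumes "real_polynomial_function (q :: 'a::euclidean_space \<Rightarrow> real)"
  shows "\<exists>dq. (\<forall>x. (q has_derivative (\<lambda>h. dq x \<bullet> h)) (at x)) \<and> continuous_on UNIV dq"
  using assms
proof (induction q rule: real_polynomial_function.induct)
  case (linear f)
  then have l: "linear f" by (rule bounded_linear.linear)
  have "f = (\<lambda>h. adjoint f 1 \<bullet> h)" using adjoint_works[OF l, of _ 1] by (auto simp: inner_commute)
  moreover have "(f has_derivative f) (at x)" for x by (rule bounded_linear_imp_has_derivative[OF linear])
  ultimately show ?case by (intro exI[of _ "\<lambda>x. adjoint f 1"]) auto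
next
  case (const c)
  show ?case by (rule exI[of _ "\<lambda>x. 0"]) auto
next
  case (add f g)
  then obtain df dg where "\<forall>x. (f has_derivative (\<lambda>h. df x \<bullet> h)) (at x)" "continuous_on UNIV df"
     "\<forall>x. (g has_derivative (\<lambda>h. dg x \<bullet> h)) (at x)" "continuous_on UNIV dg" by auto
  then show ?case by (intro exI[of _ "\<lambda>x. df x + dg x"]) (auto intro!: has_gradient_add continuous_intros)
next
  case (mult f g)
  then obtain df dg where d: "\<forall>x. (f has_derivative (\<lambda>h. df x \<bullet> h)) (at x)" "continuous_on UNIV df"
     "\<forall>x. (g has_derivative (\<lambda>h. dg x \<bullet> h)) (at x)" "continuous_on UNIV dg" by auto
  then have "continuous_on UNIV f" "continuous_on UNIV g"
    by (meson continuous_at_imp_continuous_on has_derivative_continuous)+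
  with d show ?case
    by (intro exI[of _ "\<lambda>x. f x *\<^sub>R dg x + g x *\<^sub>R df x"]) (auto intro!: has_gradient_mult continuous_intros)
qed

lemma gradient_component:
  fixes q :: "real^'n \<Rightarrow> real"
  assumes "(q has_derivative (\<lambda>h. dq \<bullet> h)) (at y)"
  shows "((\<lambda>s. q (y + s *\<^sub>R axis k 1)) has_real_derivative dq $ k) (at 0)"
proof -
  have "((\<lambda>s. q (y + s *\<^sub>R axis k 1)) has_derivative (\<lambda>s. dq \<bullet> (s *\<^sub>R axis k 1))) (at 0)"
    by (rule has_derivative_compose[where g=q]) (use assms in \<open>auto intro!: derivative_eq_intros\<close>)
  then show ?thesis by (simp add: has_field_derivative_def inner_axis mult_commute_abs)
qed

lemma norm_vec2_le: "norm (x::real^2) \<le> \<bar>x $ 1\<bar> + \<bar>x $ 2\<bar>"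
  using norm_le_l1_cart[of x] by (simp add: sum_2)

lemma real_polynomial_function_Bernstein:
  assumes "real_polynomial_function g"
  shows "real_polynomial_function (\<lambda>x. Bernstein n k (g x))"
  unfolding Bernstein_def using assms by (intro real_polynomial_function.intros(2,4) real_polynomial_function_power real_polynomial_function_diff)

text \<open>Uniform approximation of values says nothing about gradients, so Bernstein sums are used
  on a square containing \<open>S\<close>, rescaled to the unit square. The second partial
  derivative is covered by \<open>Bernstein2_approx_dx\<close> with the arguments swapped.\<close>

lemma test_fun_C1_polynomial_approx:
  assumes t: "test_fun U \<psi> d\<psi>" and S: "compact S" and e: "\<epsilon> > 0"
  obtains q dq where "real_polynomial_function q" "\<And>x. (q has_derivative (\<lambda>h. dq x \<bullet> h)) (at x)" "continuous_on UNIV dq"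
    "\<And>x. x \<in> S \<Longrightarrow> \<bar>\<psi> x - q x\<bar> < \<epsilon>" "\<And>x. x \<in> S \<Longrightarrow> norm (d\<psi> x - dq x) < \<epsilon>"
proof -
  have d: "\<And>x. (\<psi> has_derivative (\<lambda>h. d\<psi> x \<bullet> h)) (at x)" and cd: "continuous_on UNIV d\<psi>"
    using t by (auto simp: test_fun_def)
  have c\<psi>: "continuous_on UNIV \<psi>" using d by (meson continuous_at_imp_continuous_on has_derivative_continuous)
  obtain R where R: "R > 0" "\<And>x. x \<in> S \<Longrightarrow> norm x \<le> R"
    using compact_imp_bounded[OF S] by (auto simp: bounded_pos)
  define \<Phi> :: "real \<Rightarrow> real \<Rightarrow> real^2" where "\<Phi> s t = (R * (2 * s - 1)) *\<^sub>R axis 1 1 + (R * (2 * t - 1)) *\<^sub>R axis 2 1" for s t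
  define f where "f s t = \<psi> (\<Phi> s t)" for s t
  define fx where "fx s t = 2 * R * d\<psi> (\<Phi> s t) $ 1" for s t
  define fy where "fy s t = 2 * R * d\<psi> (\<Phi> s t) $ 2" for s t
  have c\<Phi>: "continuous_on A (\<lambda>p. \<Phi> (fst p) (snd p))" for A unfolding \<Phi>_def by (intro continuous_intros)
  have cf: "continuous_on A (\<lambda>p. f (fst p) (snd p))" for A
    unfolding f_def by (rule continuous_on_compose2[OF c\<psi> c\<Phi>]) auto
  have cdd: "continuous_on A (\<lambda>p. d\<psi> (\<Phi> (fst p) (snd p)))" for A
    by (rule continuous_on_compose2[OF cd c\<Phi>]) auto
  have cfx: "continuous_on A (\<lambda>p. fx (fst p) (snd p))" and cfy: "continuous_on A (\<lambda>p. fy (snd p) (fst p))" for A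
    unfolding fx_def fy_def
    by (intro continuous_intros cdd continuous_on_compose2[OF cd, of _ "\<lambda>p. \<Phi> (snd p) (fst p)"];
        auto simp: \<Phi>_def intro!: continuous_intros)+
  have dx: "((\<lambda>s. f s t) has_real_derivative fx s t) (at s)" for s t
  proof -
    have "((\<lambda>s. \<Phi> s t) has_derivative (\<lambda>h. (R * (2 * h)) *\<^sub>R axis 1 1)) (at s)"
      unfolding \<Phi>_def by (auto intro!: derivative_eq_intros)
    from has_derivative_compose[OF this d] show ?thesis
      by (simp add: has_field_derivative_def f_def[abs_def] fx_def inner_axis mult_ac mult_commute_abs)
  qed
  have dy: "((\<lambda>t. f s t) has_real_derivative fy s t) (at t)" for s t
  proof -
    have "((\<lambda>t. \<Phi> s t) has_derivative (\<lambda>h. (R * (2 * h)) *\<^sub>R axis 2 1)) (at t)"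
      unfolding \<Phi>_def by (auto intro!: derivative_eq_intros)
    from has_derivative_compose[OF this d] show ?thesis
      by (simp add: has_field_derivative_def f_def[abs_def] fy_def inner_axis mult_ac mult_commute_abs)
  qed
  \<comment> \<open>The factor \<open>min 1 R\<close> pays for the division by \<open>2 * R\<close>
    that the rescaling causes in the gradient.\<close>
  define e' where "e' = \<epsilon> * min 1 R"
  have e': "e' > 0" "e' \<le> \<epsilon>" "e' \<le> \<epsilon> * R" using e R by (auto simp: e'_def min_def)
  obtain N0 where N0: "\<And>n m x y. N0 \<le> n \<and> N0 \<le> m \<and> x \<in> {0..1} \<and> y \<in> {0..1} \<Longrightarrow>
    \<bar>f x y - (\<Sum>i\<le>n. \<Sum>j\<le>m. f (real i / real n) (real j / real m) * (Bernstein n i x * Bernstein m j y))\<bar> < e'"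
    using Bernstein2_approx[OF cf e'(1)] by blast
  define Dx where "Dx n x y = (\<Sum>i\<le>n. real (Suc n) *
       ((\<Sum>j\<le>Suc n. f (real (Suc i) / real (Suc n)) (real j / real (Suc n)) * Bernstein (Suc n) j y)
        - (\<Sum>j\<le>Suc n. f (real i / real (Suc n)) (real j / real (Suc n)) * Bernstein (Suc n) j y)) * Bernstein n i x)" for n x y
  define Dy where "Dy n y x = (\<Sum>i\<le>n. real (Suc n) *
       ((\<Sum>j\<le>Suc n. f (real j / real (Suc n)) (real (Suc i) / real (Suc n)) * Bernstein (Suc n) j y)
        - (\<Sum>j\<le>Suc n. f (real j / real (Suc n)) (real i / real (Suc n)) * Bernstein (Suc n) j y)) * Bernstein n i x)" for n x y
  obtain N1 where N1: "\<And>n x y. N1 \<le> n \<and> x \<in> {0..1} \<and> y \<in> {0..1} \<Longrightarrow> \<bar>fx x y - Dx n x y\<bar> < e'"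
    using Bernstein2_approx_dx[OF dx cfx e'(1)] unfolding Dx_def by blast
  obtain N2 where N2: "\<And>n x y. N2 \<le> n \<and> x \<in> {0..1} \<and> y \<in> {0..1} \<Longrightarrow> \<bar>fy y x - Dy n y x\<bar> < e'"
    using Bernstein2_approx_dx[of "\<lambda>x y. f y x" "\<lambda>x y. fy y x", OF dy cfy e'(1)] unfolding Dy_def by blast
  define n where "n = max N0 (max N1 N2)"
  define P where "P x y = (\<Sum>i\<le>Suc n. \<Sum>j\<le>Suc n. f (real i / real (Suc n)) (real j / real (Suc n)) * (Bernstein (Suc n) i x * Bernstein (Suc n) j y))" for x y
  have Px: "((\<lambda>x. P x y) has_real_derivative Dx n x y) (at x)" for x y
  proof -
    have e: "(\<lambda>x. P x y) = (\<lambda>x. \<Sum>i\<le>Suc n. (\<Sum>j\<le>Suc n. f (real i / real (Suc n)) (real j / real (Suc n)) * Bernstein (Suc n) j y) * Bernstein (Suc n) i x)"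
      unfolding P_def sum_distrib_right by (intro ext sum.cong refl) (simp only: mult_ac)
    show ?thesis unfolding e Dx_def by (rule has_real_derivative_Bernstein_sum)
  qed
  have Py: "((\<lambda>y. P x y) has_real_derivative Dy n x y) (at y)" for x y
  proof -
    have e: "(\<lambda>y. P x y) = (\<lambda>y. \<Sum>j\<le>Suc n. (\<Sum>i\<le>Suc n. f (real i / real (Suc n)) (real j / real (Suc n)) * Bernstein (Suc n) i x) * Bernstein (Suc n) j y)"
      unfolding P_def sum_distrib_right by (subst sum.swap) (intro ext sum.cong refl, simp only: mult_ac)
    show ?thesis unfolding e Dy_def by (rule has_real_derivative_Bernstein_sum)
  qed
  define \<alpha> where "\<alpha> s = (s / R + 1) / 2" for s
  define q where "q y = P (\<alpha> (y $ 1)) (\<alpha> (y $ 2))" for y :: "real^2"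
  have rc: "real_polynomial_function (\<lambda>y::real^2. \<alpha> (y $ k))" for k
    unfolding \<alpha>_def by (intro real_polynomial_function_divide real_polynomial_function.intros(3) real_polynomial_function.intros(2) real_polynomial_function.intros(1) bounded_linear_vec_nth)
  have rq: "real_polynomial_function q"
    unfolding q_def P_def
    by (intro real_polynomial_function_sum real_polynomial_function.intros(4) real_polynomial_function.intros(2) real_polynomial_function_Bernstein rc) auto
  obtain dq where dq: "\<And>x. (q has_derivative (\<lambda>h. dq x \<bullet> h)) (at x)" and cq: "continuous_on UNIV dq"
    using real_polynomial_function_has_gradient[OF rq] by blast
  have da: "((\<lambda>s. \<alpha> (c + s)) has_real_derivative 1 / (2 * R)) (at s)" for s c
    unfolding \<alpha>_def using R by (auto intro!: derivative_eq_intros)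
  have q1: "dq y $ 1 = Dx n (\<alpha> (y $ 1)) (\<alpha> (y $ 2)) / (2 * R)" for y
  proof -
    have e: "(\<lambda>s. q (y + s *\<^sub>R axis 1 1)) = (\<lambda>s. P (\<alpha> (y $ 1 + s)) (\<alpha> (y $ 2)))" by (simp add: q_def axis_def)
    have "((\<lambda>s. P (\<alpha> (y $ 1 + s)) (\<alpha> (y $ 2))) has_real_derivative Dx n (\<alpha> (y $ 1 + 0)) (\<alpha> (y $ 2)) * (1 / (2 * R))) (at 0)"
      by (rule DERIV_chain2[OF Px da])
    from DERIV_unique[OF gradient_component[OF dq, of y 1, unfolded e] this] show ?thesis by simp
  qed
  have q2: "dq y $ 2 = Dy n (\<alpha> (y $ 1)) (\<alpha> (y $ 2)) / (2 * R)" for y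
  proof -
    have e: "(\<lambda>s. q (y + s *\<^sub>R axis 2 1)) = (\<lambda>s. P (\<alpha> (y $ 1)) (\<alpha> (y $ 2 + s)))" by (simp add: q_def axis_def)
    have "((\<lambda>s. P (\<alpha> (y $ 1)) (\<alpha> (y $ 2 + s))) has_real_derivative Dy n (\<alpha> (y $ 1)) (\<alpha> (y $ 2 + 0)) * (1 / (2 * R))) (at 0)"
      by (rule DERIV_chain2[OF Py da])
    from DERIV_unique[OF gradient_component[OF dq, of y 2, unfolded e] this] show ?thesis by simp
  qed
  have pt: "\<alpha> (y $ 1) \<in> {0..1}" "\<alpha> (y $ 2) \<in> {0..1}" "\<Phi> (\<alpha> (y $ 1)) (\<alpha> (y $ 2)) = y" if "y \<in> S" for y
  proof -
    have a01: "\<alpha> (y $ k) \<in> {0..1}" for k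
    proof -
      have "\<bar>y $ k\<bar> \<le> R" using component_le_norm_cart[of y k] R(2)[OF that] by linarith
      then have "-1 \<le> y $ k / R" "y $ k / R \<le> 1" using R(1) by (auto simp: field_simps)
      then show ?thesis by (simp add: \<alpha>_def)
    qed
    then show "\<alpha> (y $ 1) \<in> {0..1}" "\<alpha> (y $ 2) \<in> {0..1}" by auto
    have "R * (2 * \<alpha> s - 1) = s" for s using R(1) by (simp add: \<alpha>_def field_simps)
    then show "\<Phi> (\<alpha> (y $ 1)) (\<alpha> (y $ 2)) = y"
      by (simp add: \<Phi>_def vec_eq_iff forall_2 axis_def)
  qed
  have quo: "\<bar>a - b / (2 * R)\<bar> < \<epsilon> / 2" if "\<bar>2 * R * a - b\<bar> < e'" for a b
  proof -
    have "\<bar>a - b / (2 * R)\<bar> = \<bar>2 * R * a - b\<bar> / (2 * R)" using R(1) by (simp add: field_simps abs_if)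
    also have "\<dots> < \<epsilon> * R / (2 * R)" using that e'(3) R(1) by (intro divide_strict_right_mono) auto
    finally show ?thesis using R(1) by simp
  qed
  show ?thesis
  proof (rule that[OF rq dq cq])
    fix y assume y: "y \<in> S"
    have "\<bar>f (\<alpha> (y $ 1)) (\<alpha> (y $ 2)) - P (\<alpha> (y $ 1)) (\<alpha> (y $ 2))\<bar> < e'"
      unfolding P_def by (rule N0) (use pt[OF y] in \<open>auto simp: n_def\<close>)
    then show "\<bar>\<psi> y - q y\<bar> < \<epsilon>" using pt(3)[OF y] e'(2) by (simp add: f_def q_def)
    have "\<bar>fx (\<alpha> (y $ 1)) (\<alpha> (y $ 2)) - Dx n (\<alpha> (y $ 1)) (\<alpha> (y $ 2))\<bar> < e'"
      by (rule N1) (use pt[OF y] in \<open>auto simp: n_def\<close>)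
    then have 1: "\<bar>d\<psi> y $ 1 - dq y $ 1\<bar> < \<epsilon> / 2" unfolding q1 by (intro quo) (simp add: fx_def pt(3)[OF y])
    have "\<bar>fy (\<alpha> (y $ 1)) (\<alpha> (y $ 2)) - Dy n (\<alpha> (y $ 1)) (\<alpha> (y $ 2))\<bar> < e'"
      by (rule N2) (use pt[OF y] in \<open>auto simp: n_def\<close>)
    then have 2: "\<bar>d\<psi> y $ 2 - dq y $ 2\<bar> < \<epsilon> / 2" unfolding q2 by (intro quo) (simp add: fy_def pt(3)[OF y])
    show "norm (d\<psi> y - dq y) < \<epsilon>" using norm_vec2_le[of "d\<psi> y - dq y"] 1 2 by simp
  qed
qed

text \<open>The polynomial \<open>q\<close> approximates the test function \<open>\<phi> / \<rho>\<close>.\<close>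
lemma test_fun_C1_approx_with_factor:
  assumes t: "test_fun U \<phi> d\<phi>" and U: "open U" "bounded U"
    and r: "\<And>x. (\<rho> has_derivative (\<lambda>y. d\<rho> x \<bullet> y)) (at x)" "continuous_on UNIV d\<rho>"
    and pos: "\<And>x. x \<in> U \<Longrightarrow> \<rho> x > 0" and e: "\<epsilon> > 0"
  shows "\<exists>q dq. real_polynomial_function q \<and> (\<forall>x. (q has_derivative (\<lambda>h. dq x \<bullet> h)) (at x)) \<and>
    (\<forall>x\<in>U. norm (d\<phi> x - (\<rho> x *\<^sub>R dq x + q x *\<^sub>R d\<rho> x)) \<le> \<epsilon>)"
proof -
  have d: "\<And>x. (\<phi> has_derivative (\<lambda>h. d\<phi> x \<bullet> h)) (at x)" and cd: "continuous_on UNIV d\<phi>"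
    using t by (auto simp: test_fun_def)
  have c\<phi>: "continuous_on UNIV \<phi>" and c\<rho>: "continuous_on UNIV \<rho>"
    using d r by (meson continuous_at_imp_continuous_on has_derivative_continuous)+
  define K where "K = closure {x. \<phi> x \<noteq> 0}"
  have K: "compact K" "K \<subseteq> U" using t by (auto simp: test_fun_def K_def)
  have z: "\<phi> x = 0" if "x \<notin> K" for x using that closure_subset[of "{x. \<phi> x \<noteq> 0}"] unfolding K_def by blast
  define f where "f x = \<phi> x * (1 / \<rho> x)" for x
  define df where "df x = \<phi> x *\<^sub>R ((- 1 / (\<rho> x)\<^sup>2) *\<^sub>R d\<rho> x) + (1 / \<rho> x) *\<^sub>R d\<phi> x" for x
  have inv: "((\<lambda>t::real. 1 / t) has_real_derivative - 1 / t\<^sup>2) (at t)" if "t > 0" for t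
    using that by (auto intro!: derivative_eq_intros simp: power2_eq_square)
  \<comment> \<open>The quotient can be extended by zero: inside \<open>U\<close> it vanishes off
    the support of \<phi>, and \<rho> is positive there.\<close>
  have t2: "test_fun U (\<lambda>x. if x \<in> U then f x else 0) (\<lambda>x. if x \<in> U then df x else 0)"
  proof (rule test_fun_localI[OF U(1) K])
    show "(f has_derivative (\<lambda>h. df x \<bullet> h)) (at x)" if "x \<in> U" for x
      unfolding f_def[abs_def] df_def
      by (intro has_gradient_mult d has_gradient_compose[OF inv r(1)] pos that)
    show "continuous_on U df" unfolding df_def[abs_def]
      by (intro continuous_intros continuous_on_subset[OF c\<rho>] continuous_on_subset[OF c\<phi>] continuous_on_subset[OF cd] continuous_on_subset[OF r(2)])
        (use pos less_irrefl in \<open>fastforce+\<close>)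
    show "f x = 0" if "x \<notin> K" for x using z[OF that] by (simp add: f_def)
  qed
  have cU: "compact (closure U)" using U by simp
  have "bounded ((\<lambda>x. \<bar>\<rho> x\<bar> + norm (d\<rho> x)) ` closure U)"
    by (intro compact_imp_bounded compact_continuous_image cU continuous_intros continuous_on_subset[OF c\<rho>] continuous_on_subset[OF r(2)]) auto
  \<comment> \<open>\<open>M\<close> bounds the coefficients \<rho> and \<open>d\<rho>\<close> of
    the product rule, so accuracy \<open>\<epsilon> / M\<close> for the quotient suffices for the
    product.\<close>
  then obtain M where M: "M > 0" "\<And>x. x \<in> closure U \<Longrightarrow> norm (\<bar>\<rho> x\<bar> + norm (d\<rho> x)) \<le> M" by (auto simp: bounded_pos)
  obtain q dq where q: "real_polynomial_function q" "\<And>x. (q has_derivative (\<lambda>h. dq x \<bullet> h)) (at x)" "continuous_on UNIV dq"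
    "\<And>x. x \<in> closure U \<Longrightarrow> \<bar>(if x \<in> U then f x else 0) - q x\<bar> < \<epsilon> / M"
    "\<And>x. x \<in> closure U \<Longrightarrow> norm ((if x \<in> U then df x else 0) - dq x) < \<epsilon> / M"
    using test_fun_C1_polynomial_approx[OF t2 cU, of "\<epsilon> / M"] e M(1) by auto
  have "norm (d\<phi> x - (\<rho> x *\<^sub>R dq x + q x *\<^sub>R d\<rho> x)) \<le> \<epsilon>" if x: "x \<in> U" for x
  proof -
    have xc: "x \<in> closure U" using x closure_subset by auto
    have p: "\<rho> x > 0" by (rule pos[OF x])
    have "d\<phi> x = \<rho> x *\<^sub>R df x + f x *\<^sub>R d\<rho> x"
      using p by (simp add: df_def f_def algebra_simps power2_eq_square)
    then have "d\<phi> x - (\<rho> x *\<^sub>R dq x + q x *\<^sub>R d\<rho> x) = \<rho> x *\<^sub>R (df x - dq x) + (f x - q x) *\<^sub>R d\<rho> x"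
      by (simp add: algebra_simps)
    then have "norm (d\<phi> x - (\<rho> x *\<^sub>R dq x + q x *\<^sub>R d\<rho> x)) \<le> \<bar>\<rho> x\<bar> * norm (df x - dq x) + \<bar>f x - q x\<bar> * norm (d\<rho> x)"
      by (metis norm_triangle_ineq norm_scaleR)
    also have "\<dots> \<le> \<bar>\<rho> x\<bar> * (\<epsilon> / M) + (\<epsilon> / M) * norm (d\<rho> x)"
      using q(4,5)[OF xc] x by (intro add_mono mult_left_mono mult_right_mono) auto
    also have "\<dots> = (\<epsilon> / M) * (\<bar>\<rho> x\<bar> + norm (d\<rho> x))" by (simp add: algebra_simps)
    also have "\<dots> \<le> (\<epsilon> / M) * M" using M(2)[OF xc] e M(1) by (intro mult_left_mono) auto
    finally show ?thesis using M(1) by simp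
  qed
  with q(1,2) show ?thesis by blast
qed

section \<open>Billiard maps conjugate to a rotation\<close>

text \<open>Since \<open>F\<close> is injective, two boundary points share a level line iff their
  circle coordinates have the same component along \<open>a\<close>. Such points are joined by a
  chord perpendicular to \<open>a\<close>, and the reflection in the axis \<open>a\<close> sends
  \<open>z\<close> to \<open>a\<^sup>2 * cnj z\<close>.\<close>

lemma gamma_map_circle:
  assumes fr: "\<kappa> ` sphere 0 1 = frontier \<Omega>" and inj: "inj_on \<kappa> (sphere 0 1)"
    and a: "norm a = 1" and F: "inj_on F {-1..1}"
    and ls: "\<And>z. norm z = 1 \<Longrightarrow> ls (\<kappa> z) = F (Re (z * cnj a))"
    and z: "norm z = 1"
  shows "gamma_map \<Omega> ls (\<kappa> z) = \<kappa> (a\<^sup>2 * cnj z)"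
proof -
  define z' where "z' = a\<^sup>2 * cnj z"
  have nz': "norm z' = 1" using a z by (simp add: z'_def norm_mult norm_power)
  have ac: "a * cnj a = 1" using complex_norm_square[of a] a by simp
  have two: "w = z \<or> w = z'" if w: "norm w = 1" and eq: "Re (w * cnj a) = Re (z * cnj a)" for w
  proof -
    define p q where "p = w * cnj a" and "q = z * cnj a"
    have np: "norm p = 1" "norm q = 1" using w z a by (auto simp: p_def q_def norm_mult)
    have "(Re p)\<^sup>2 + (Im p)\<^sup>2 = 1" "(Re q)\<^sup>2 + (Im q)\<^sup>2 = 1" using np by (simp_all add: cmod_def)
    moreover have "Re p = Re q" using eq by (simp add: p_def q_def)
    ultimately have "(Im p)\<^sup>2 = (Im q)\<^sup>2" by simp
    then have "Im p = Im q \<or> Im p = - Im q" by (simp add: power2_eq_iff)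
    then have "p = q \<or> p = cnj q" using \<open>Re p = Re q\<close> by (auto simp: complex_eq_iff)
    moreover have "w = p * a" "z = q * a" using ac by (simp_all add: p_def q_def mult.assoc mult.commute[of "cnj a"])
    moreover have "cnj q * a = z'" by (simp add: q_def z'_def power2_eq_square mult_ac)
    ultimately show ?thesis by metis
  qed
  have "Re (z' * cnj a) = Re (z * cnj a)"
  proof -
    have "z' * cnj a = a * cnj z * (a * cnj a)" by (simp add: z'_def power2_eq_square)
    also have "\<dots> = cnj (z * cnj a)" using ac by simp
    finally show ?thesis by simp
  qed
  then have lz': "ls (\<kappa> z') = ls (\<kappa> z)" using ls nz' z by simp
  have un: "y = \<kappa> z'" if y: "y \<in> frontier \<Omega>" "y \<noteq> \<kappa> z" "ls y = ls (\<kappa> z)" for y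
  proof -
    obtain w where w: "norm w = 1" "y = \<kappa> w" using y(1) unfolding fr[symmetric] by auto
    have "F (Re (w * cnj a)) = F (Re (z * cnj a))" using y(3) ls w z by simp
    moreover have "Re (w * cnj a) \<in> {-1..1}" "Re (z * cnj a) \<in> {-1..1}"
      using abs_Re_le_cmod[of "w * cnj a"] abs_Re_le_cmod[of "z * cnj a"] w z a by (auto simp: norm_mult abs_le_iff)
    ultimately have "Re (w * cnj a) = Re (z * cnj a)" using F by (auto dest: inj_onD)
    then show ?thesis using two[OF w(1)] w(2) y(2) by auto
  qed
  show ?thesis
  proof (cases "z' = z")
    \<comment> \<open>A fixed point of the reflection: no second boundary point lies on the level
      line, so the default branch of \<open>gamma_map\<close> applies.\<close>
    case True
    then have "\<not> (\<exists>y\<in>frontier \<Omega>. y \<noteq> \<kappa> z \<and> ls y = ls (\<kappa> z))" using un by metis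
    then have "gamma_map \<Omega> ls (\<kappa> z) = \<kappa> z" unfolding gamma_map_def by (rule if_not_P)
    then show ?thesis using True unfolding z'_def by (simp only:)
  next
    case False
    have "\<kappa> z' \<noteq> \<kappa> z" using inj False nz' z by (auto dest: inj_onD)
    moreover have "\<kappa> z' \<in> frontier \<Omega>" using fr nz' by auto
    ultimately have w: "\<kappa> z' \<in> frontier \<Omega> \<and> \<kappa> z' \<noteq> \<kappa> z \<and> ls (\<kappa> z') = ls (\<kappa> z)" using lz' by simp
    have "(THE y. y \<in> frontier \<Omega> \<and> y \<noteq> \<kappa> z \<and> ls y = ls (\<kappa> z)) = \<kappa> z'"
      by (rule the_equality) (use w un in auto)
    moreover have "\<exists>y\<in>frontier \<Omega>. y \<noteq> \<kappa> z \<and> ls y = ls (\<kappa> z)" using w by blast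
    ultimately show ?thesis unfolding gamma_map_def z'_def[symmetric] by (simp only: if_True)
  qed
qed

text \<open>The product of the reflections in two axes is the rotation by twice the angle between
  them.\<close>

lemma chess_map_circle:
  assumes fr: "\<kappa> ` sphere 0 1 = frontier \<Omega>" and inj: "inj_on \<kappa> (sphere 0 1)"
    and F: "inj_on F {-1..1}" and G: "inj_on G {-1..1}"
    and lp: "\<And>z. norm z = 1 \<Longrightarrow> ell_plus l (\<kappa> z) = F (Re (z * cnj (cis \<alpha>)))"
    and lm: "\<And>z. norm z = 1 \<Longrightarrow> ell_minus l (\<kappa> z) = G (Re (z * cnj (cis \<beta>)))"
    and z: "norm z = 1"
  shows "chess_map \<Omega> l (\<kappa> z) = \<kappa> (cis (2 * (\<alpha> - \<beta>)) * z)"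
proof -
  have "gamma_map \<Omega> (ell_minus l) (\<kappa> z) = \<kappa> ((cis \<beta>)\<^sup>2 * cnj z)"
    by (rule gamma_map_circle[OF fr inj _ G lm z]) auto
  moreover have "gamma_map \<Omega> (ell_plus l) (\<kappa> ((cis \<beta>)\<^sup>2 * cnj z)) = \<kappa> ((cis \<alpha>)\<^sup>2 * cnj ((cis \<beta>)\<^sup>2 * cnj z))"
    by (rule gamma_map_circle[OF fr inj _ F lp]) (use z in \<open>auto simp: norm_mult norm_power\<close>)
  moreover have "(cis \<alpha>)\<^sup>2 * cnj ((cis \<beta>)\<^sup>2 * cnj z) = cis (2 * (\<alpha> - \<beta>)) * z"
    by (simp add: cis_cnj cis_mult power2_eq_square algebra_simps)
  ultimately show ?thesis unfolding chess_map_def o_def by (simp only:)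
qed

text \<open>The level functions determine the components of a point along
  \<open>cis \<alpha>\<close> and \<open>cis \<beta>\<close>;
  \<open>sin (\<alpha> - \<beta>)\<close> is up to sign the determinant of this linear
  system.\<close>

lemma inj_on_circle_from_levels:
  assumes "inj_on F {-1..1}" "inj_on G {-1..1}"
    and lp: "\<And>z. norm z = 1 \<Longrightarrow> ell_plus l (\<kappa> z) = F (Re (z * cnj (cis \<alpha>)))"
    and lm: "\<And>z. norm z = 1 \<Longrightarrow> ell_minus l (\<kappa> z) = G (Re (z * cnj (cis \<beta>)))"
    and nd: "sin (\<alpha> - \<beta>) \<noteq> 0"
  shows "inj_on \<kappa> (sphere 0 1)"
proof (rule inj_onI)
  fix z w :: complex assume zw: "z \<in> sphere 0 1" "w \<in> sphere 0 1" "\<kappa> z = \<kappa> w"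
  then have n: "norm z = 1" "norm w = 1" by auto
  have r: "Re (v * cnj (cis \<theta>)) \<in> {-1..1}" if "norm v = 1" for v \<theta>
    using abs_Re_le_cmod[of "v * cnj (cis \<theta>)"] that by (auto simp: norm_mult abs_le_iff)
  have 1: "Re (z * cnj (cis \<alpha>)) = Re (w * cnj (cis \<alpha>))"
    using lp[OF n(1)] lp[OF n(2)] zw(3) r[OF n(1)] r[OF n(2)] assms(1) by (auto dest: inj_onD)
  have 2: "Re (z * cnj (cis \<beta>)) = Re (w * cnj (cis \<beta>))"
    using lm[OF n(1)] lm[OF n(2)] zw(3) r[OF n(1)] r[OF n(2)] assms(2) by (auto dest: inj_onD)
  define x y where "x = Re z - Re w" and "y = Im z - Im w"
  have a: "x * cos \<alpha> + y * sin \<alpha> = 0" using 1 by (simp add: x_def y_def algebra_simps)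
  have b: "x * cos \<beta> + y * sin \<beta> = 0" using 2 by (simp add: x_def y_def algebra_simps)
  have "x * sin (\<alpha> - \<beta>) = (x * cos \<beta> + y * sin \<beta>) * sin \<alpha> - (x * cos \<alpha> + y * sin \<alpha>) * sin \<beta>"
    by (simp add: sin_diff algebra_simps)
  then have x: "x = 0" using a b nd by simp
  have "y * sin (\<alpha> - \<beta>) = (x * cos \<alpha> + y * sin \<alpha>) * cos \<beta> - (x * cos \<beta> + y * sin \<beta>) * cos \<alpha>"
    by (simp add: sin_diff algebra_simps)
  then have "y = 0" using a b nd by simp
  with x show "z = w" by (simp add: x_def y_def complex_eq_iff)
qed

section \<open>Orientation of the boundary, lifts and the rotation number\<close>

lemma cis_eq_cis_imp: "cis a = cis b \<Longrightarrow> \<exists>k::int. a = b + 2 * pi * of_int k"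
  using sin_cos_eq_iff[of a b] by (auto simp: complex_eq_iff) 

text \<open>Whether \<kappa> preserves orientation is not known, but a simple closed curve winds +1
  or -1 times around its inside points, with one sign for all; reversing the direction through
  \<sigma> corrects the sign.\<close>

lemma circle_pos_param:
  assumes cv: "convex \<Omega>" "compact \<Omega>"
    and fr: "\<kappa> ` sphere 0 1 = frontier \<Omega>" and inj: "inj_on \<kappa> (sphere 0 1)" and cont: "continuous_on (sphere 0 1) \<kappa>"
  shows "\<exists>\<sigma>\<in>{1,-1}. pos_param \<Omega> (\<lambda>t. \<kappa> (cis (2 * pi * \<sigma> * t)))"
proof -
  define c :: "real^2 \<Rightarrow> complex" where "c x = Complex (x $ 1) (x $ 2)" for x
  have lc: "linear c" by (rule linearI) (auto simp: c_def complex_eq_iff)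
  have ic: "inj c" by (rule injI) (auto simp: c_def vec_eq_iff forall_2)
  have sc: "surj c"
  proof (rule surjI)
    show "c (vector [Re z, Im z]) = z" for z by (simp add: c_def)
  qed
  have cc: "continuous_on S c" for S using lc by (simp add: linear_continuous_on linear_conv_bounded_linear)
  define p where "p \<sigma> t = \<kappa> (cis (2 * pi * \<sigma> * t))" for \<sigma> t
  have cp: "continuous_on S (p \<sigma>)" for S \<sigma>
    unfolding p_def by (rule continuous_on_compose2[OF cont]) (auto intro!: continuous_intros simp: cis_conv_exp)
  have per: "p \<sigma> (t + 1) = p \<sigma> t" if "\<sigma> \<in> {1,-1}" for \<sigma> t
  proof -
    have "cis (2 * pi * \<sigma> * (t + 1)) = cis (2 * pi * \<sigma> * t) * cis (2 * pi * \<sigma>)" by (simp add: cis_mult algebra_simps)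
    also have "cis (2 * pi * \<sigma>) = 1" using that by (auto simp: complex_eq_iff)
    finally show ?thesis by (simp add: p_def)
  qed
  have ip: "t = u" if "\<sigma> \<in> {1,-1}" "t \<in> {0..<1}" "u \<in> {0..<1}" "p \<sigma> t = p \<sigma> u" for \<sigma> t u
  proof -
    have "cis (2 * pi * \<sigma> * t) = cis (2 * pi * \<sigma> * u)" using inj that(4) by (auto simp: p_def dest: inj_onD)
    then obtain k :: int where "2 * pi * \<sigma> * t = 2 * pi * \<sigma> * u + 2 * pi * of_int k" using cis_eq_cis_imp by blast
    then have "2 * pi * (\<sigma> * t) = 2 * pi * (\<sigma> * u + of_int k)" by (simp add: algebra_simps)
    then have k: "\<sigma> * t = \<sigma> * u + of_int k" by simp
    have "\<bar>\<sigma> * t - \<sigma> * u\<bar> < 1" using that(1-3) by auto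
    then have "\<bar>real_of_int k\<bar> < 1" using k by simp
    then have "k = 0" by linarith
    then show ?thesis using k that(1) by auto
  qed
  have imp: "p \<sigma> ` {0..1} = frontier \<Omega>" if s: "\<sigma> \<in> {1,-1}" for \<sigma>
  proof
    show "p \<sigma> ` {0..1} \<subseteq> frontier \<Omega>" using fr by (auto simp: p_def)
    show "frontier \<Omega> \<subseteq> p \<sigma> ` {0..1}"
    proof
      fix y assume "y \<in> frontier \<Omega>"
      then obtain z where z: "norm z = 1" "y = \<kappa> z" unfolding fr[symmetric] by auto
      define t where "t = frac (\<sigma> * Arg z / (2 * pi))"
      have t: "t \<in> {0..1}" using frac_ge_0[of "\<sigma> * Arg z / (2 * pi)"] frac_lt_1[of "\<sigma> * Arg z / (2 * pi)"] unfolding t_def by simp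
      have ss: "\<sigma> * \<sigma> = 1" using s by auto
      obtain k :: int where k: "k = \<lfloor>\<sigma> * Arg z / (2 * pi)\<rfloor>" by blast
      have tt: "t = \<sigma> * Arg z / (2 * pi) - of_int k" by (simp add: t_def frac_def k)
      have "2 * pi * \<sigma> * t = Arg z - 2 * pi * (\<sigma> * of_int k)"
        unfolding tt using ss by (simp add: algebra_simps)
      then have "cis (2 * pi * \<sigma> * t) = cis (Arg z) * cis (- (2 * pi * (\<sigma> * of_int k)))" by (simp add: cis_mult)
      also have "\<dots> = z"
      proof -
        have "\<sigma> * of_int k \<in> \<int>" using s by auto
        then have "- (\<sigma> * of_int k) \<in> \<int>" by simp
        then have "cis (2 * pi * (- (\<sigma> * of_int k))) = 1" by (rule cis_multiple_2pi)
        moreover have "cis (Arg z) = z" using rcis_cmod_Arg[of z] z(1) by (simp add: rcis_def)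
        ultimately show ?thesis by simp
      qed
      finally show "y \<in> p \<sigma> ` {0..1}" using t z(2) by (intro image_eqI[of _ _ t]) (auto simp: p_def)
    qed
  qed
  define g where "g \<sigma> t = c (p \<sigma> t)" for \<sigma> t
  have p01: "p \<sigma> 1 = p \<sigma> 0" if "\<sigma> \<in> {1,-1}" for \<sigma> using per[OF that, of 0] by simp
  have simple: "simple_path (g \<sigma>)" if s: "\<sigma> \<in> {1,-1}" for \<sigma>
    unfolding simple_path_def
  proof
    show "path (g \<sigma>)" unfolding path_def g_def by (rule continuous_on_compose2[OF cc cp]) auto
    show "loop_free (g \<sigma>)" unfolding loop_free_def
    proof (intro ballI impI)
      fix t u :: real assume tu: "t \<in> {0..1}" "u \<in> {0..1}" "g \<sigma> t = g \<sigma> u"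
      then have e: "p \<sigma> t = p \<sigma> u" using ic by (auto simp: g_def dest: injD)
      consider "t < 1" "u < 1" | "t = 1" "u = 1" | "t = 1" "u < 1" | "t < 1" "u = 1" using tu by fastforce
      then show "t = u \<or> t = 0 \<and> u = 1 \<or> t = 1 \<and> u = 0"
      proof cases
        case 1 then show ?thesis using ip[OF s, of t u] tu e by auto
      next
        case 3 then show ?thesis using ip[OF s, of 0 u] tu e p01[OF s] by auto
      next
        case 4 then show ?thesis using ip[OF s, of t 0] tu e p01[OF s] by auto
      qed auto
    qed
  qed
  have int: "interior (c ` \<Omega>) = c ` interior \<Omega>" using ic sc by (intro interior_bijective_linear_image[OF lc]) (simp only: bij_def simp_thms)
  have inside: "c z \<in> inside (path_image (g \<sigma>))" if "z \<in> interior \<Omega>" "\<sigma> \<in> {1,-1}" for z \<sigma>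
  proof -
    have "path_image (g \<sigma>) = c ` frontier \<Omega>"
      unfolding path_image_def g_def imp[OF that(2), symmetric] by (simp add: image_image)
    also have "\<dots> = frontier (c ` \<Omega>)"
    proof -
      have cl: "closure (c ` \<Omega>) = c ` closure \<Omega>" by (rule closure_injective_linear_image[OF lc ic, symmetric])
      show ?thesis unfolding frontier_def int cl by (rule image_set_diff[OF ic])
    qed
    finally have "path_image (g \<sigma>) = frontier (c ` \<Omega>)" .
    \<comment> \<open>Convexity identifies the inside of the boundary curve with the image of the
      interior, where \<open>pos_param\<close> asks for winding number 1.\<close>
    moreover have "inside (frontier (c ` \<Omega>)) = interior (c ` \<Omega>)"
      by (rule inside_frontier_eq_interior)
        (intro compact_imp_bounded compact_continuous_image cc cv convex_linear_image[OF lc])+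
    ultimately show ?thesis using that by (simp add: int)
  qed
  have pp: "pos_param \<Omega> (p \<sigma>)" if s: "\<sigma> \<in> {1,-1}" and w: "\<And>z. z \<in> inside (path_image (g \<sigma>)) \<Longrightarrow> winding_number (g \<sigma>) z = 1" for \<sigma>
    unfolding pos_param_def
  proof (intro conjI allI ballI)
    show "continuous_on UNIV (p \<sigma>)" by (rule cp)
    show "p \<sigma> (t + 1) = p \<sigma> t" for t by (rule per[OF s])
    show "inj_on (p \<sigma>) {0..<1}" using ip[OF s] by (auto intro: inj_onI)
    show "p \<sigma> ` {0..1} = frontier \<Omega>" by (rule imp[OF s])
    show "winding_number (\<lambda>t. Complex (p \<sigma> t $ 1) (p \<sigma> t $ 2)) (Complex (z $ 1) (z $ 2)) = 1" if "z \<in> interior \<Omega>" for z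
      using w[OF inside[OF that s]] unfolding g_def[abs_def] c_def .
  qed
  have s1: "(1::real) \<in> {1,-1}" and s2: "(-1::real) \<in> {1,-1}" by auto
  have "\<exists>\<sigma>\<in>{1,-1}. pos_param \<Omega> (p \<sigma>)"
  proof (rule simple_closed_path_winding_number_inside[OF simple[OF s1]])
    assume "\<And>z. z \<in> inside (path_image (g 1)) \<Longrightarrow> winding_number (g 1) z = 1"
    then have "pos_param \<Omega> (p 1)" by (rule pp[OF s1])
    then show ?thesis by (rule bexI[OF _ s1])
  next
    assume neg: "\<And>z. z \<in> inside (path_image (g 1)) \<Longrightarrow> winding_number (g 1) z = -1"
    have rev: "g (-1) = reversepath (g 1)"
    proof
      fix t
      \<comment> \<open>Path reversal replaces \<open>t\<close> by \<open>1 - t\<close>, which by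
        periodicity amounts to \<open>- t\<close>.\<close>
      have "g (-1) t = g (-1) (t - 1)" using per[OF s2, of "t - 1"] by (simp add: g_def)
      also have "\<dots> = reversepath (g 1) t" by (simp add: g_def p_def reversepath_def algebra_simps)
      finally show "g (-1) t = reversepath (g 1) t" .
    qed
    have "winding_number (g (-1)) z = 1" if "z \<in> inside (path_image (g (-1)))" for z
    proof -
      have z: "z \<in> inside (path_image (g 1))" using that by (simp add: rev)
      then have "z \<notin> path_image (g 1)" by (auto simp: inside_def)
      then have "winding_number (reversepath (g 1)) z = - winding_number (g 1) z"
        by (intro winding_number_reversepath simple_path_imp_path simple[OF s1])
      then show ?thesis using neg[OF z] by (simp add: rev)
    qed
    then have "pos_param \<Omega> (p (-1))" by (rule pp[OF s2])
    then show ?thesis by (rule bexI[OF _ s2])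
  qed
  then show ?thesis unfolding p_def[abs_def] .
qed

lemma continuous_Ints_valued_constant:
  fixes f :: "real \<Rightarrow> real"
  assumes "continuous_on UNIV f" "\<And>t. f t \<in> \<int>"
  obtains k :: int where "\<And>t. f t = of_int k"
proof -
  have "f constant_on UNIV"
  proof (rule continuous_discrete_range_constant[OF connected_UNIV assms(1)])
    fix x
    have "1 \<le> norm (f y - f x)" if "f y \<noteq> f x" for y
    proof -
      have "f y - f x \<in> \<int>" "f y - f x \<noteq> 0" using assms(2) that by auto
      then show ?thesis by (simp add: Ints_nonzero_abs_ge1)
    qed
    then show "\<exists>e>0. \<forall>y. y \<in> UNIV \<and> f y \<noteq> f x \<longrightarrow> e \<le> norm (f y - f x)" by (intro exI[of _ 1]) auto
  qed
  then obtain c where c: "\<And>t. f t = c" by (auto simp: constant_on_def)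
  moreover have "c \<in> \<int>" using assms(2)[of 0] c by simp
  ultimately show ?thesis using that by (metis Ints_cases)
qed

lemma periodic_int:
  assumes "\<And>t::real. p (t + 1) = p t"
  shows "p (t + of_int k) = p t"
proof (induction k rule: int_induct[where k=0])
  case base show ?case by simp
next
  case (step1 i) then show ?case using assms[of "t + of_int i"] by (simp add: add.assoc)
next
  case (step2 i) then show ?case using assms[of "t + of_int (i - 1)"] by (simp add: add.assoc)
qed

text \<open>Lifting the circle coordinate of \<open>p\<close> to a real function \<sigma> turns the
  map into a translation: \<open>\<sigma> (t + 1) = \<sigma> t + d\<close> and
  \<open>\<sigma> (L t) = \<sigma> t + \<psi> / (2 * pi) + N\<close>. As \<sigma> differs from
  \<open>d * t\<close> by a periodic, hence bounded function, \<open>d\<close> times the mean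
  displacement of \<open>L\<close> tends to \<open>\<psi> / (2 * pi) + N\<close>.\<close>

lemma rotation_limit_circle:
  assumes fr: "\<kappa> ` sphere 0 1 = frontier \<Omega>" and inj: "inj_on \<kappa> (sphere 0 1)" and cont: "continuous_on (sphere 0 1) \<kappa>"
    and b: "\<And>z. norm z = 1 \<Longrightarrow> B (\<kappa> z) = \<kappa> (cis \<psi> * z)"
    and p: "pos_param \<Omega> p" and L: "is_lift p B L" and lim: "(\<lambda>k. ((L ^^ k) x0 - x0) / real k) \<longlonglongrightarrow> r"
  obtains d N :: int where "d \<noteq> 0" "of_int d * r = \<psi> / (2 * pi) + of_int N"
proof -
  define \<iota> where "\<iota> = inv_into (sphere 0 1) \<kappa>"
  have ci: "continuous_on (frontier \<Omega>) \<iota>" unfolding \<iota>_def fr[symmetric]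
    by (rule continuous_on_inv[OF cont compact_sphere]) (use inj in auto)
  have i1: "\<iota> (\<kappa> z) = z" if "norm z = 1" for z unfolding \<iota>_def using inj that by simp
  have i2: "\<kappa> (\<iota> y) = y" "norm (\<iota> y) = 1" if "y \<in> frontier \<Omega>" for y
  proof -
    have y: "y \<in> \<kappa> ` sphere 0 1" using that fr by simp
    show "\<kappa> (\<iota> y) = y" unfolding \<iota>_def by (rule f_inv_into_f[OF y])
    show "norm (\<iota> y) = 1" using inv_into_into[OF y] by (simp add: \<iota>_def)
  qed
  have cp: "continuous_on UNIV p" and per: "\<And>t. p (t + 1) = p t" and ip: "inj_on p {0..<1}" and imp: "p ` {0..1} = frontier \<Omega>"
    using p by (auto simp: pos_param_def)
  have frac: "p t = p (frac t)" for t
    using periodic_int[of p t "- \<lfloor>t\<rfloor>", OF per] by (simp add: frac_def)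
  have pf: "p t \<in> frontier \<Omega>" for t
    using imp frac[of t] frac_ge_0[of t] frac_lt_1[of t] by (metis atLeastAtMost_iff image_eqI less_imp_le)
  define z where "z t = \<iota> (p t)" for t
  have cz: "continuous_on UNIV z" unfolding z_def by (rule continuous_on_compose2[OF ci cp]) (use pf in auto)
  have nz: "norm (z t) = 1" and kz: "\<kappa> (z t) = p t" for t using i2[OF pf] by (auto simp: z_def)
  \<comment> \<open>A continuous logarithm exists since the line is contractible; its imaginary part
    gives the lift.\<close>
  obtain g where cg: "continuous_on UNIV g" and g: "\<And>t. z t = exp (g t)"
  proof (rule continuous_logarithm_on_contractible[OF cz])
    show "contractible (UNIV :: real set)" by (rule convex_imp_contractible) auto
    show "z t \<noteq> 0" for t using nz[of t] by auto
  qed auto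
  define \<sigma> where "\<sigma> t = Im (g t) / (2 * pi)" for t
  have cs: "continuous_on UNIV \<sigma>" unfolding \<sigma>_def by (intro continuous_intros cg) auto
  have zs: "z t = cis (2 * pi * \<sigma> t)" for t
  proof -
    have "exp (Re (g t)) = 1" using nz[of t] g[of t] by simp
    then have "g t = \<i> * of_real (Im (g t))" by (simp add: complex_eq_iff)
    then have "z t = exp (\<i> * of_real (Im (g t)))" using g[of t] by simp
    then show ?thesis by (simp add: cis_conv_exp \<sigma>_def)
  qed
  have sI: "s - t \<in> \<int>" if ce: "cis (2 * pi * s) = cis (2 * pi * t)" for s t
  proof -
    obtain k :: int where "2 * pi * s = 2 * pi * t + 2 * pi * of_int k" using cis_eq_cis_imp[OF ce] by blast
    then have "2 * pi * s = 2 * pi * (t + of_int k)" by (simp add: algebra_simps)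
    then have "s = t + of_int k" by simp
    then show ?thesis by simp
  qed
  obtain d :: int where d: "\<And>t. \<sigma> (t + 1) - \<sigma> t = of_int d"
  proof (rule continuous_Ints_valued_constant[of "\<lambda>t. \<sigma> (t + 1) - \<sigma> t"])
    show "continuous_on UNIV (\<lambda>t. \<sigma> (t + 1) - \<sigma> t)"
      by (intro continuous_intros cs continuous_on_compose2[OF cs]) auto
    show "\<sigma> (t + 1) - \<sigma> t \<in> \<int>" for t
    proof (rule sI)
      show "cis (2 * pi * \<sigma> (t + 1)) = cis (2 * pi * \<sigma> t)" unfolding zs[symmetric] z_def per ..
    qed
  qed (erule that)
  have injs: "t = u" if "t \<in> {0..<1}" "u \<in> {0..<1}" "\<sigma> t = \<sigma> u" for t u
  proof -
    have "\<kappa> (z t) = \<kappa> (z u)" unfolding zs that(3) ..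
    then have "p t = p u" unfolding kz .
    then show ?thesis using ip that by (auto dest: inj_onD)
  qed
  \<comment> \<open>With \<open>d = 0\<close> the lift would be a continuous function on a circle
    and take the value halfway between \<open>\<sigma> 0\<close> and \<open>\<sigma> (1/2)\<close>
    on each of the two half circles, against injectivity of \<open>p\<close>.\<close>
  have d0: "d \<noteq> 0"
  proof
    assume "d = 0"
    then have e: "\<sigma> 1 = \<sigma> 0" using d[of 0] by simp
    define v where "v = (\<sigma> 0 + \<sigma> (1/2)) / 2"
    have ne: "\<sigma> 0 \<noteq> \<sigma> (1/2)" using injs[of 0 "1/2"] by auto
    have "\<exists>t\<ge>0. t \<le> 1/2 \<and> \<sigma> t = v" "\<exists>t\<ge>1/2. t \<le> 1 \<and> \<sigma> t = v"
    proof -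
      have c1: "continuous_on {0..1/2} \<sigma>" "continuous_on {1/2..1} \<sigma>" using cs by (auto intro: continuous_on_subset)
      show "\<exists>t\<ge>0. t \<le> 1/2 \<and> \<sigma> t = v"
        using IVT'[of \<sigma> 0 v "1/2", OF _ _ _ c1(1)] IVT2'[of \<sigma> "1/2" v 0, OF _ _ _ c1(1)] by (cases "\<sigma> 0 \<le> \<sigma> (1/2)") (auto simp: v_def)
      show "\<exists>t\<ge>1/2. t \<le> 1 \<and> \<sigma> t = v"
        using IVT'[of \<sigma> "1/2" v 1, OF _ _ _ c1(2)] IVT2'[of \<sigma> 1 v "1/2", OF _ _ _ c1(2)] e by (cases "\<sigma> 0 \<le> \<sigma> (1/2)") (auto simp: v_def)
    qed
    then obtain t u where t: "0 \<le> t" "t \<le> 1/2" "\<sigma> t = v" and u: "1/2 \<le> u" "u \<le> 1" "\<sigma> u = v" by blast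
    have avg: "(a::real) \<noteq> (a + b) / 2" "b \<noteq> (a + b) / 2" if "a \<noteq> b" for a b using that by auto
    have v1: "\<sigma> 0 \<noteq> v" "\<sigma> (1/2) \<noteq> v" unfolding v_def by (rule avg[OF ne])+
    have "u \<noteq> 1" using u(3) e v1(1) by metis
    moreover have "u \<noteq> 1/2" using u(3) v1(2) by metis
    ultimately have "1/2 < u" "u < 1" using u(1,2) by linarith+
    moreover have "t = u" using injs[of t u] t u \<open>u < 1\<close> by simp
    ultimately show False using t(2) by linarith
  qed
  have lift: "p (L t) = B (p t)" and cL: "continuous_on UNIV L" for t using L by (auto simp: is_lift_def)
  obtain N :: int where N: "\<And>t. \<sigma> (L t) - (\<sigma> t + \<psi> / (2 * pi)) = of_int N"
  proof (rule continuous_Ints_valued_constant[of "\<lambda>t. \<sigma> (L t) - (\<sigma> t + \<psi> / (2 * pi))"])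
    show "continuous_on UNIV (\<lambda>t. \<sigma> (L t) - (\<sigma> t + \<psi> / (2 * pi)))"
      by (intro continuous_intros cs continuous_on_compose2[OF cs cL]) auto
    show "\<sigma> (L t) - (\<sigma> t + \<psi> / (2 * pi)) \<in> \<int>" for t
    proof (rule sI)
      have "z (L t) = \<iota> (B (\<kappa> (z t)))" by (simp add: z_def lift kz[unfolded z_def])
      also have "\<dots> = \<iota> (\<kappa> (cis \<psi> * z t))" using b[OF nz] by simp
      also have "\<dots> = cis \<psi> * z t" using nz by (intro i1) (simp add: norm_mult)
      finally show "cis (2 * pi * \<sigma> (L t)) = cis (2 * pi * (\<sigma> t + \<psi> / (2 * pi)))"
        unfolding zs by (simp add: cis_mult algebra_simps)
    qed
  qed (erule that)
  define c where "c = \<psi> / (2 * pi) + of_int N"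
  have it: "\<sigma> ((L ^^ k) x0) = \<sigma> x0 + real k * c" for k
  proof (induction k)
    case (Suc k)
    have "\<sigma> (L y) = \<sigma> y + c" for y using N[of y] by (simp add: c_def)
    then show ?case using Suc by (simp add: algebra_simps)
  qed simp
  define h where "h t = \<sigma> t - of_int d * t" for t
  have hper: "h (t + 1) = h t" for t using d[of t] by (simp add: h_def algebra_simps)
  have "bounded (h ` {0..1})" unfolding h_def
    by (intro compact_imp_bounded compact_continuous_image continuous_intros continuous_on_subset[OF cs]) auto
  then obtain M where M: "\<And>t. t \<in> {0..1} \<Longrightarrow> norm (h t) \<le> M" unfolding bounded_iff by blast
  have hb: "\<bar>h t\<bar> \<le> M" for t
  proof -
    have "h t = h (frac t)" using periodic_int[of h t "- \<lfloor>t\<rfloor>", OF hper] by (simp add: frac_def)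
    then show ?thesis using M[of "frac t"] frac_ge_0[of t] frac_lt_1[of t] by simp
  qed
  have "(\<lambda>k. of_int d * (((L ^^ k) x0 - x0) / real k)) \<longlonglongrightarrow> of_int d * r" by (intro tendsto_intros lim)
  moreover have "(\<lambda>k. of_int d * (((L ^^ k) x0 - x0) / real k)) \<longlonglongrightarrow> c"
  proof (rule Lim_transform2[where f="\<lambda>k. c"])
    show "(\<lambda>k. c) \<longlonglongrightarrow> c" by simp
    show "(\<lambda>k. c - of_int d * (((L ^^ k) x0 - x0) / real k)) \<longlonglongrightarrow> 0"
    proof (rule Lim_null_comparison)
      show "\<forall>\<^sub>F k in sequentially. norm (c - of_int d * (((L ^^ k) x0 - x0) / real k)) \<le> (2 * M) * (1 / real k)"
      proof (rule eventually_sequentiallyI[of 1])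
        fix k :: nat assume k: "1 \<le> k"
        have "of_int d * ((L ^^ k) x0 - x0) = real k * c - (h ((L ^^ k) x0) - h x0)"
          using it[of k] by (simp add: h_def algebra_simps)
        then have "c - of_int d * (((L ^^ k) x0 - x0) / real k) = (h ((L ^^ k) x0) - h x0) / real k"
          using k by (simp add: field_simps)
        moreover have "\<bar>h ((L ^^ k) x0) - h x0\<bar> \<le> 2 * M" using hb[of "(L ^^ k) x0"] hb[of x0] by linarith
        ultimately show "norm (c - of_int d * (((L ^^ k) x0 - x0) / real k)) \<le> (2 * M) * (1 / real k)"
          by (simp add: divide_right_mono)
      qed
      show "(\<lambda>k. (2 * M) * (1 / real k)) \<longlonglongrightarrow> 0"
        using tendsto_mult[OF tendsto_const[of "2 * M"] lim_1_over_n] by simp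
    qed
  qed
  ultimately have "of_int d * r = c" by (rule LIMSEQ_unique)
  then show ?thesis using that[OF d0] by (simp add: c_def)
qed

text \<open>The definition selects a limit by \<open>SOME\<close>, so a limit must first be
  exhibited, here from a translation that lifts the rotation; whatever is then selected obeys
  \<open>rotation_limit_circle\<close>.\<close>

lemma rotation_number_circle:
  assumes cv: "convex \<Omega>" "compact \<Omega>"
    and fr: "\<kappa> ` sphere 0 1 = frontier \<Omega>" and inj: "inj_on \<kappa> (sphere 0 1)" and cont: "continuous_on (sphere 0 1) \<kappa>"
    and b: "\<And>z. norm z = 1 \<Longrightarrow> chess_map \<Omega> l (\<kappa> z) = \<kappa> (cis \<psi> * z)"
  shows "rotation_number \<Omega> l \<in> \<rat> \<longleftrightarrow> \<psi> / (2 * pi) \<in> \<rat>"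
proof -
  let ?Q = "\<lambda>r. \<exists>p L x0. pos_param \<Omega> p \<and> is_lift p (chess_map \<Omega> l) L \<and> (\<lambda>k. ((L ^^ k) x0 - x0) / real k) \<longlonglongrightarrow> r"
  obtain \<sigma> :: real where s: "\<sigma> \<in> {1,-1}" and p: "pos_param \<Omega> (\<lambda>t. \<kappa> (cis (2 * pi * \<sigma> * t)))"
    using circle_pos_param[OF cv fr inj cont] by blast
  have ss: "\<sigma> * \<sigma> = 1" using s by auto
  define c where "c = \<sigma> * (\<psi> / (2 * pi))"
  have lift: "is_lift (\<lambda>t. \<kappa> (cis (2 * pi * \<sigma> * t))) (chess_map \<Omega> l) (\<lambda>t. t + c)"
    unfolding is_lift_def
  proof
    show "continuous_on UNIV (\<lambda>t. t + c)" by (intro continuous_intros)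
    show "\<forall>t. \<kappa> (cis (2 * pi * \<sigma> * (t + c))) = chess_map \<Omega> l (\<kappa> (cis (2 * pi * \<sigma> * t)))"
    proof
      fix t
      have "2 * pi * \<sigma> * (t + c) = \<psi> * (\<sigma> * \<sigma>) + 2 * pi * \<sigma> * t" by (simp add: c_def algebra_simps)
      then have "cis (2 * pi * \<sigma> * (t + c)) = cis \<psi> * cis (2 * pi * \<sigma> * t)" by (simp add: cis_mult ss)
      then show "\<kappa> (cis (2 * pi * \<sigma> * (t + c))) = chess_map \<Omega> l (\<kappa> (cis (2 * pi * \<sigma> * t)))" by (simp add: b)
    qed
  qed
  have pw: "((\<lambda>t. t + c) ^^ k) 0 = real k * c" for k by (induction k) (auto simp: algebra_simps)
  have "(\<lambda>k. (((\<lambda>t. t + c) ^^ k) 0 - 0) / real k) \<longlonglongrightarrow> c"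
    by (rule Lim_transform_eventually[OF tendsto_const[of c]], rule eventually_sequentiallyI[of 1]) (auto simp: pw)
  then have "?Q c" using p lift by blast
  then have "?Q (SOME r. ?Q r)" by (rule someI)
  then obtain p L x0 where q: "pos_param \<Omega> p" "is_lift p (chess_map \<Omega> l) L"
    "(\<lambda>k. ((L ^^ k) x0 - x0) / real k) \<longlonglongrightarrow> (SOME r. ?Q r)" by blast
  define r where "r = (SOME r. ?Q r)"
  obtain d N :: int where d: "d \<noteq> 0" "of_int d * r = \<psi> / (2 * pi) + of_int N"
    using rotation_limit_circle[OF fr inj cont b q] unfolding r_def by blast
  have "rotation_number \<Omega> l = frac r" by (simp add: rotation_number_def r_def)
  moreover have "frac r \<in> \<rat> \<longleftrightarrow> r \<in> \<rat>"
    unfolding frac_def using Rats_add[of "r - of_int \<lfloor>r\<rfloor>" "of_int \<lfloor>r\<rfloor>"] by auto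
  moreover have "r \<in> \<rat> \<longleftrightarrow> \<psi> / (2 * pi) \<in> \<rat>"
  proof
    assume "r \<in> \<rat>"
    then have "of_int d * r - of_int N \<in> \<rat>" by (intro Rats_diff Rats_mult Rats_of_int)
    then show "\<psi> / (2 * pi) \<in> \<rat>" using d(2) by simp
  next
    assume "\<psi> / (2 * pi) \<in> \<rat>"
    then have "(\<psi> / (2 * pi) + of_int N) / of_int d \<in> \<rat>" by (rule Rats_divide[OF Rats_add[OF _ Rats_of_int] Rats_of_int])
    moreover have "(\<psi> / (2 * pi) + of_int N) / of_int d = r" using d by (simp add: field_simps)
    ultimately show "r \<in> \<rat>" by simp
  qed
  ultimately show ?thesis by simp
qed

text \<open>The form in which both domains meet the hypotheses: each level function is an injective
  function of one component of the circle coordinate.\<close>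

theorem rotation_number_rational_iff:
  assumes cv: "convex \<Omega>" "compact \<Omega>"
    and fr: "\<kappa> ` sphere 0 1 = frontier \<Omega>" and cont: "continuous_on (sphere 0 1) \<kappa>"
    and F: "inj_on F {-1..1}" and G: "inj_on G {-1..1}"
    and lp: "\<And>z. norm z = 1 \<Longrightarrow> ell_plus l (\<kappa> z) = F (Re (z * cnj (cis \<alpha>)))"
    and lm: "\<And>z. norm z = 1 \<Longrightarrow> ell_minus l (\<kappa> z) = G (Re (z * cnj (cis \<beta>)))"
    and nd: "sin (\<alpha> - \<beta>) \<noteq> 0"
  shows "rotation_number \<Omega> l \<in> \<rat> \<longleftrightarrow> (\<alpha> - \<beta>) / pi \<in> \<rat>"
proof -
  have inj: "inj_on \<kappa> (sphere 0 1)" by (rule inj_on_circle_from_levels[OF F G lp lm nd])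
  have "rotation_number \<Omega> l \<in> \<rat> \<longleftrightarrow> 2 * (\<alpha> - \<beta>) / (2 * pi) \<in> \<rat>"
  proof (rule rotation_number_circle[OF cv fr inj cont])
    fix z :: complex assume "norm z = 1"
    with lp lm show "chess_map \<Omega> l (\<kappa> z) = \<kappa> (cis (2 * (\<alpha> - \<beta>)) * z)" by (rule chess_map_circle[OF fr inj F G])
  qed
  also have "2 * (\<alpha> - \<beta>) / (2 * pi) = (\<alpha> - \<beta>) / pi" by (rule mult_divide_mult_cancel_left) simp
  finally show ?thesis .
qed

section \<open>Slopes of the characteristics\<close>

text \<open>The quotient \<open>sqrt (1 - l\<^sup>2) / l\<close> is the absolute slope of the level
  lines of \<open>ell_plus\<close> and \<open>ell_minus\<close>; as a parameter it makes both
  families of eigenvalues explicit.\<close>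

lemma slope_of_parameter:
  assumes "0 < l" "l < 1"
  shows "sqrt (1 - l\<^sup>2) / l > 0" "l\<^sup>2 = 1 / (1 + (sqrt (1 - l\<^sup>2) / l)\<^sup>2)"
proof -
  have "l\<^sup>2 < 1" using assms by (simp add: power_less_one_iff)
  then show "sqrt (1 - l\<^sup>2) / l > 0" "l\<^sup>2 = 1 / (1 + (sqrt (1 - l\<^sup>2) / l)\<^sup>2)"
    using assms by (auto simp: power_divide field_simps)
qed

lemma parameter_of_slope:
  assumes "t > 0"
  obtains l where "0 < l" "l < 1" "l = 1 / sqrt (1 + t\<^sup>2)" "sqrt (1 - l\<^sup>2) = t * l"
proof -
  define r where "r = sqrt (1 + t\<^sup>2)"
  have r: "1 < r" "r\<^sup>2 = 1 + t\<^sup>2" using assms by (auto simp: r_def)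
  have t2: "t\<^sup>2 = r\<^sup>2 - 1" using r by simp
  have "1 - (1 / r)\<^sup>2 = (t * (1 / r))\<^sup>2"
    unfolding power_mult_distrib power_divide t2 using r(1) by (simp add: diff_divide_distrib)
  then have "sqrt (1 - (1 / r)\<^sup>2) = t * (1 / r)" using assms r(1) by simp
  then show ?thesis using r(1) by (intro that[of "1 / r"]) (auto simp: r_def[symmetric])
qed

lemma closure_eigenvalues_of_dense_slopes:
  assumes T: "T \<subseteq> {0<..}" and dense: "\<And>x y. 0 < x \<Longrightarrow> x < y \<Longrightarrow> \<exists>t\<in>T. x < t \<and> t < y"
  shows "closure ((\<lambda>t::real. 1 / (1 + t\<^sup>2)) ` T) = {0..1}"
proof
  let ?E = "(\<lambda>t::real. 1 / (1 + t\<^sup>2)) ` T"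
  have "?E \<subseteq> {0..1}" by (auto simp: divide_le_eq_1_pos add_pos_nonneg)
  then show "closure ?E \<subseteq> {0..1}" by (rule closure_minimal) simp
  have "{0<..<1} \<subseteq> closure ?E"
  proof
    fix r :: real assume r: "r \<in> {0<..<1}"
    show "r \<in> closure ?E" unfolding closure_approachable
    proof (intro allI impI)
      fix e :: real assume e: "e > 0"
      define r' where "r' = min ((1 + r) / 2) (r + e / 2)"
      have r': "r < r'" "r' < 1" "r' < r + e" using r e by (auto simp: r'_def min_def)
      \<comment> \<open>The preimages of \<open>r'\<close> and \<open>r\<close> under the function
        sending \<open>t\<close> to \<open>1 / (1 + t\<^sup>2)\<close>; it is decreasing on positive
        \<open>t\<close>, so the larger value has the smaller preimage.\<close>
      define x y where "x = sqrt (1 / r' - 1)" and "y = sqrt (1 / r - 1)"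
      have "1 / r' < 1 / r" using r r' by (simp add: frac_less2)
      moreover have "1 < 1 / r'" using r r' by simp
      ultimately have xy: "0 < x" "x < y" by (auto simp: x_def y_def)
      obtain t where t: "t \<in> T" "x < t" "t < y" using dense[OF xy] by blast
      have "x\<^sup>2 < t\<^sup>2" "t\<^sup>2 < y\<^sup>2" using t xy by (auto intro!: power_strict_mono)
      moreover have "x\<^sup>2 = 1 / r' - 1" "y\<^sup>2 = 1 / r - 1" using r r' by (auto simp: x_def y_def)
      ultimately have b: "1 / r' < 1 + t\<^sup>2" "1 + t\<^sup>2 < 1 / r" by auto
      have "1 + t\<^sup>2 > 0" by (simp add: add_pos_nonneg)
      then have "1 / (1 + t\<^sup>2) < r'" using b(1) r r' by (simp add: field_simps)
      moreover have "r < 1 / (1 + t\<^sup>2)" using b(2) r \<open>1 + t\<^sup>2 > 0\<close> by (simp add: field_simps)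
      ultimately show "\<exists>y\<in>?E. dist y r < e" using t(1) r' by (intro bexI[of _ "1 / (1 + t\<^sup>2)"]) (auto simp: dist_real_def)
    qed
  qed
  then have "closure {0<..<1::real} \<subseteq> closure ?E" by (metis closure_closure closure_mono)
  then show "{0..1} \<subseteq> closure ?E" by simp
qed

text \<open>For both domains the eigenvalues come from a dense set \<open>T\<close> of slopes, and
  the billiard criterion is membership of the slope in \<open>T\<close>; what remains is the change
  of parameter between slope and \<open>l\<close>.\<close>

lemma spectrum_from_slopes:
  assumes pp: "P_pure_point \<Omega>" and ev: "P_eigenvalues \<Omega> = (\<lambda>t. 1 / (1 + t\<^sup>2)) ` T"
    and T: "T \<subseteq> {0<..}" and dense: "\<And>x y. 0 < x \<Longrightarrow> x < y \<Longrightarrow> \<exists>t\<in>T. x < t \<and> t < y"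
    and rn: "\<And>l. 0 < l \<Longrightarrow> l < 1 \<Longrightarrow> rotation_number \<Omega> l \<in> \<rat> \<longleftrightarrow> sqrt (1 - l\<^sup>2) / l \<in> T"
  shows "P_pure_point \<Omega> \<and>
         closure (P_eigenvalues \<Omega>) = {0..1} \<and> P_eigenvalues \<Omega> \<subseteq> {0..1} \<and>
         P_eigenvalues \<Omega> = {l\<^sup>2 | l. 0 < l \<and> l < 1 \<and> rotation_number \<Omega> l \<in> \<rat>}"
proof -
  define E where "E = (\<lambda>t::real. 1 / (1 + t\<^sup>2))"
  have cl: "closure (E ` T) = {0..1}" unfolding E_def by (rule closure_eigenvalues_of_dense_slopes[OF T dense])
  have eq: "E ` T = {l\<^sup>2 | l. 0 < l \<and> l < 1 \<and> rotation_number \<Omega> l \<in> \<rat>}"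
  proof (rule set_eqI, rule iffI)
    fix \<mu> assume "\<mu> \<in> E ` T"
    then obtain t where t: "t \<in> T" "\<mu> = E t" by blast
    then have tp: "t > 0" using T by auto
    obtain l where l: "0 < l" "l < 1" "l = 1 / sqrt (1 + t\<^sup>2)" "sqrt (1 - l\<^sup>2) = t * l" using parameter_of_slope[OF tp] .
    have s: "sqrt (1 - l\<^sup>2) / l = t" using l by simp
    have "rotation_number \<Omega> l \<in> \<rat>" using rn[OF l(1,2)] t(1) unfolding s by blast
    moreover have "\<mu> = l\<^sup>2" using t(2) slope_of_parameter(2)[OF l(1,2)] unfolding s E_def by simp
    ultimately show "\<mu> \<in> {l\<^sup>2 | l. 0 < l \<and> l < 1 \<and> rotation_number \<Omega> l \<in> \<rat>}" using l(1,2) by blast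
  next
    fix \<mu> assume "\<mu> \<in> {l\<^sup>2 | l. 0 < l \<and> l < 1 \<and> rotation_number \<Omega> l \<in> \<rat>}"
    then obtain l where l: "0 < l" "l < 1" "rotation_number \<Omega> l \<in> \<rat>" "\<mu> = l\<^sup>2" by blast
    have "sqrt (1 - l\<^sup>2) / l \<in> T" using rn[OF l(1,2)] l(3) by blast
    moreover have "\<mu> = E (sqrt (1 - l\<^sup>2) / l)" unfolding l(4) E_def by (rule slope_of_parameter(2)[OF l(1,2)])
    ultimately show "\<mu> \<in> E ` T" by blast
  qed
  have "E ` T \<subseteq> {0..1}" using closure_subset[of "E ` T"] unfolding cl .
  then show ?thesis using pp cl eq unfolding ev E_def[symmetric] by blast
qed

section \<open>The billiard in a rectangle\<close>

lemma rectangle_topology: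
  assumes "a < b" "c < d"
  shows "interior {x::real^2. a \<le> x$1 \<and> x$1 \<le> b \<and> c \<le> x$2 \<and> x$2 \<le> d} = {x. a < x$1 \<and> x$1 < b \<and> c < x$2 \<and> x$2 < d}"
    "frontier {x::real^2. a \<le> x$1 \<and> x$1 \<le> b \<and> c \<le> x$2 \<and> x$2 \<le> d} =
      {x. a \<le> x$1 \<and> x$1 \<le> b \<and> c \<le> x$2 \<and> x$2 \<le> d \<and> (x$1 = a \<or> x$1 = b \<or> x$2 = c \<or> x$2 = d)}"
    "frontier (interior {x::real^2. a \<le> x$1 \<and> x$1 \<le> b \<and> c \<le> x$2 \<and> x$2 \<le> d}) =
      {x. a \<le> x$1 \<and> x$1 \<le> b \<and> c \<le> x$2 \<and> x$2 \<le> d \<and> (x$1 = a \<or> x$1 = b \<or> x$2 = c \<or> x$2 = d)}"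
    "convex {x::real^2. a \<le> x$1 \<and> x$1 \<le> b \<and> c \<le> x$2 \<and> x$2 \<le> d}"
    "compact {x::real^2. a \<le> x$1 \<and> x$1 \<le> b \<and> c \<le> x$2 \<and> x$2 \<le> d}"
proof -
  define A B :: "real^2" where "A = vector [a, c]" and "B = vector [b, d]"
  have O: "{x::real^2. a \<le> x$1 \<and> x$1 \<le> b \<and> c \<le> x$2 \<and> x$2 \<le> d} = cbox A B"
    by (auto simp: mem_box_cart forall_2 A_def B_def)
  have I: "box A B = {x. a < x$1 \<and> x$1 < b \<and> c < x$2 \<and> x$2 < d}"
    by (auto simp: mem_box_cart forall_2 A_def B_def)
  show "interior {x::real^2. a \<le> x$1 \<and> x$1 \<le> b \<and> c \<le> x$2 \<and> x$2 \<le> d} = {x. a < x$1 \<and> x$1 < b \<and> c < x$2 \<and> x$2 < d}"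
    unfolding O interior_cbox I ..
  have ne: "box A B \<noteq> {}"
  proof -
    have "(vector [(a + b) / 2, (c + d) / 2] :: real^2) \<in> box A B" using assms by (simp add: I)
    then show ?thesis by blast
  qed
  have D: "cbox A B - box A B = {x. a \<le> x$1 \<and> x$1 \<le> b \<and> c \<le> x$2 \<and> x$2 \<le> d \<and> (x$1 = a \<or> x$1 = b \<or> x$2 = c \<or> x$2 = d)}"
    unfolding O[symmetric] I by auto
  show "frontier {x::real^2. a \<le> x$1 \<and> x$1 \<le> b \<and> c \<le> x$2 \<and> x$2 \<le> d} =
      {x. a \<le> x$1 \<and> x$1 \<le> b \<and> c \<le> x$2 \<and> x$2 \<le> d \<and> (x$1 = a \<or> x$1 = b \<or> x$2 = c \<or> x$2 = d)}"
    unfolding O frontier_cbox D ..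
  show "frontier (interior {x::real^2. a \<le> x$1 \<and> x$1 \<le> b \<and> c \<le> x$2 \<and> x$2 \<le> d}) =
      {x. a \<le> x$1 \<and> x$1 \<le> b \<and> c \<le> x$2 \<and> x$2 \<le> d \<and> (x$1 = a \<or> x$1 = b \<or> x$2 = c \<or> x$2 = d)}"
    unfolding O interior_cbox using frontier_box[of A B] ne D by simp
  show "convex {x::real^2. a \<le> x$1 \<and> x$1 \<le> b \<and> c \<le> x$2 \<and> x$2 \<le> d}" "compact {x::real^2. a \<le> x$1 \<and> x$1 \<le> b \<and> c \<le> x$2 \<and> x$2 \<le> d}"
    unfolding O by (auto intro: convex_box)
qed

lemma arccos_cos_upper: "pi \<le> x \<Longrightarrow> x \<le> 2 * pi \<Longrightarrow> arccos (cos x) = 2 * pi - x"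
  using arccos_cos[of "2 * pi - x"] by simp

lemma norm_1_cis: assumes "norm z = 1" obtains \<phi> where "0 \<le> \<phi>" "\<phi> \<le> 2 * pi" "z = cis \<phi>"
proof (rule that[of "Arg2pi z"])
  show "0 \<le> Arg2pi z" "Arg2pi z \<le> 2 * pi" using Arg2pi[of z] by auto
  show "z = cis (Arg2pi z)" using Arg2pi_eq[of z] assms by (simp add: cis_conv_exp)
qed

text \<open>In the coordinates \<open>X = (x\<^sub>1 - a) / l\<close>, \<open>Y = (x\<^sub>2 - c) / \<surd>(1 - l\<^sup>2)\<close> the two line families have slopes
  \<open>\<plusminus>1\<close> and arc length along the boundary conjugates both reflections to reflections of a circle; \<open>arccos\<close> of a
  cosine is the tent function which expresses \<open>X \<plusminus> Y\<close> through the arc length.\<close>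
lemma rectangle_rotation_number:
  assumes ab: "a < b" "c < d" and l: "0 < l" "l < 1"
    and O: "\<Omega> = {x::real^2. a \<le> x$1 \<and> x$1 \<le> b \<and> c \<le> x$2 \<and> x$2 \<le> d}"
  shows "rotation_number \<Omega> l \<in> \<rat> \<longleftrightarrow> (b - a) / (d - c) * (sqrt (1 - l\<^sup>2) / l) \<in> \<rat>"
proof -
  define s where "s = sqrt (1 - l\<^sup>2)"
  have "l\<^sup>2 < 1" using l by (simp add: power_less_one_iff)
  then have s: "s > 0" by (simp add: s_def)
  define A B where "A = (b - a) / l" and "B = (d - c) / s"
  have AB: "A > 0" "B > 0" using ab l s by (auto simp: A_def B_def)
  have lA: "l * A = b - a" and sB: "s * B = d - c" using l s by (auto simp: A_def B_def)
  \<comment> \<open>\<open>M\<close> is half the perimeter in the rescaled coordinates,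
    \<open>e\<close> the arc length per unit of angle, and \<beta> the angle at which the bottom
    side ends.\<close>
  define M e \<beta> where "M = A + B" and "e = M / pi" and "\<beta> = pi * A / M"
  have M: "M > 0" using AB by (simp add: M_def)
  have e: "e > 0" "e * pi = M" using M by (auto simp: e_def)
  have eb: "e * \<beta> = A" using M by (simp add: e_def \<beta>_def)
  have b: "0 < \<beta>" "\<beta> < pi" using AB M by (auto simp: \<beta>_def M_def field_simps)
  \<comment> \<open>In the rescaled coordinates \<open>u = X + Y\<close> and
    \<open>v = A - X + Y\<close>, the level functions up to constants; \<kappa> solves these
    equations for \<open>X\<close> and \<open>Y\<close>.\<close>
  define u where "u z = e * arccos (Re z)" for z
  define v where "v z = e * arccos (Re (z * cnj (cis \<beta>)))" for z
  define \<kappa> :: "complex \<Rightarrow> real^2" where "\<kappa> z = vector [a + l * ((u z + A - v z) / 2), c + s * ((u z - A + v z) / 2)]" for z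
  have uc: "u (cis \<phi>) = e * arccos (cos \<phi>)" and vc: "v (cis \<phi>) = e * arccos (cos (\<phi> - \<beta>))" for \<phi>
    by (auto simp: u_def v_def cos_diff)
  \<comment> \<open>The four sides in positive order from the corner \<open>(a, c)\<close>; at each
    corner one of the two tent functions changes its branch.\<close>
  have k1: "\<kappa> (cis \<phi>) = vector [a + l * (e * \<phi>), c]" if "0 \<le> \<phi>" "\<phi> \<le> \<beta>" for \<phi>
  proof -
    have ac: "arccos (cos (\<phi> - \<beta>)) = - (\<phi> - \<beta>)" using that b by (intro arccos_cos2) auto
    have "u (cis \<phi>) = e * \<phi>" "v (cis \<phi>) = A - e * \<phi>"
      unfolding uc vc ac using that b arccos_cos[of \<phi>] eb by (simp_all add: right_diff_distrib)
    then have h: "(u (cis \<phi>) + A - v (cis \<phi>)) / 2 = e * \<phi>" "(u (cis \<phi>) - A + v (cis \<phi>)) / 2 = 0" by (auto simp: field_simps)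
    show ?thesis unfolding \<kappa>_def h by simp
  qed
  have k2: "\<kappa> (cis \<phi>) = vector [b, c + s * (e * \<phi> - A)]" if "\<beta> \<le> \<phi>" "\<phi> \<le> pi" for \<phi>
  proof -
    have ac: "arccos (cos (\<phi> - \<beta>)) = \<phi> - \<beta>" using that b by (intro arccos_cos) auto
    have "u (cis \<phi>) = e * \<phi>" "v (cis \<phi>) = e * \<phi> - A"
      unfolding uc vc ac using that b arccos_cos[of \<phi>] eb by (simp_all add: right_diff_distrib)
    then have h: "(u (cis \<phi>) + A - v (cis \<phi>)) / 2 = A" "(u (cis \<phi>) - A + v (cis \<phi>)) / 2 = e * \<phi> - A" by (auto simp: field_simps)
    show ?thesis unfolding \<kappa>_def h using lA by simp
  qed
  have k3: "\<kappa> (cis \<phi>) = vector [a + l * (M + A - e * \<phi>), d]" if "pi \<le> \<phi>" "\<phi> \<le> pi + \<beta>" for \<phi>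
  proof -
    have ac: "arccos (cos (\<phi> - \<beta>)) = \<phi> - \<beta>" using that b by (intro arccos_cos) auto
    have "u (cis \<phi>) = 2 * M - e * \<phi>" "v (cis \<phi>) = e * \<phi> - A"
      unfolding uc vc ac using that b arccos_cos_upper[of \<phi>] eb e(2) by (simp_all add: right_diff_distrib mult.left_commute[of e 2])
    then have h: "(u (cis \<phi>) + A - v (cis \<phi>)) / 2 = M + A - e * \<phi>" "(u (cis \<phi>) - A + v (cis \<phi>)) / 2 = B"
      by (auto simp: field_simps M_def)
    show ?thesis unfolding \<kappa>_def h using sB by simp
  qed
  have k4: "\<kappa> (cis \<phi>) = vector [a, c + s * (2 * M - e * \<phi>)]" if "pi + \<beta> \<le> \<phi>" "\<phi> \<le> 2 * pi" for \<phi>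
  proof -
    have ac: "arccos (cos (\<phi> - \<beta>)) = 2 * pi - (\<phi> - \<beta>)" using that b by (intro arccos_cos_upper) auto
    have "u (cis \<phi>) = 2 * M - e * \<phi>" "v (cis \<phi>) = 2 * M - e * \<phi> + A"
      unfolding uc vc ac using that b arccos_cos_upper[of \<phi>] eb e(2) by (simp_all add: right_diff_distrib mult.left_commute[of e 2])
    then have h: "(u (cis \<phi>) + A - v (cis \<phi>)) / 2 = 0" "(u (cis \<phi>) - A + v (cis \<phi>)) / 2 = 2 * M - e * \<phi>" by (auto simp: field_simps)
    show ?thesis unfolding \<kappa>_def h by simp
  qed
  have lin: "e * x \<le> e * y \<longleftrightarrow> x \<le> y" for x y using e by simp
  have range: "0 \<le> l * t \<and> l * t \<le> b - a" if "0 \<le> t" "t \<le> A" for t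
    using that l lA mult_left_mono[of t A l] by simp
  have range2: "0 \<le> s * t \<and> s * t \<le> d - c" if "0 \<le> t" "t \<le> B" for t
    using that s sB mult_left_mono[of t B s] by simp
  have fr: "\<kappa> ` sphere 0 1 = frontier \<Omega>"
    unfolding O rectangle_topology(2)[OF ab]
  proof (rule set_eqI, rule iffI)
    fix y assume "y \<in> \<kappa> ` sphere 0 1"
    then obtain z where z: "norm z = 1" "y = \<kappa> z" by auto
    obtain \<phi> where p: "0 \<le> \<phi>" "\<phi> \<le> 2 * pi" "z = cis \<phi>" using norm_1_cis[OF z(1)] .
    have 0: "0 \<le> e * \<phi>" using e p by simp
    consider "\<phi> \<le> \<beta>" | "\<beta> \<le> \<phi>" "\<phi> \<le> pi" | "pi \<le> \<phi>" "\<phi> \<le> pi + \<beta>" | "pi + \<beta> \<le> \<phi>" by linarith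
    then show "y \<in> {x. a \<le> x$1 \<and> x$1 \<le> b \<and> c \<le> x$2 \<and> x$2 \<le> d \<and> (x$1 = a \<or> x$1 = b \<or> x$2 = c \<or> x$2 = d)}"
    proof cases
      case 1
      then have "e * \<phi> \<le> A" using lin[of \<phi> \<beta>] eb by simp
      then show ?thesis using range[of "e * \<phi>"] 0 ab k1[OF p(1) 1] by (simp add: z p(3))
    next
      case 2
      have "A \<le> e * \<phi>" "e * \<phi> \<le> M" using 2 lin[of \<beta> \<phi>] lin[of \<phi> pi] eb e by auto
      then show ?thesis using range2[of "e * \<phi> - A"] ab k2[OF 2] by (simp add: z p(3) M_def)
    next
      case 3
      have "M \<le> e * \<phi>" "e * \<phi> \<le> M + A" using 3 lin[of pi \<phi>] lin[of \<phi> "pi + \<beta>"] eb e by (auto simp: algebra_simps)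
      then show ?thesis using range[of "M + A - e * \<phi>"] ab k3[OF 3] by (simp add: z p(3))
    next
      case 4
      have "M + A \<le> e * \<phi>" "e * \<phi> \<le> 2 * M" using 4 p(2) lin[of "pi + \<beta>" \<phi>] lin[of \<phi> "2 * pi"] eb e by (auto simp: algebra_simps)
      then show ?thesis using range2[of "2 * M - e * \<phi>"] ab k4[OF 4 p(2)] by (simp add: z p(3) M_def)
    qed
  next
    fix y :: "real^2" assume y: "y \<in> {x. a \<le> x$1 \<and> x$1 \<le> b \<and> c \<le> x$2 \<and> x$2 \<le> d \<and> (x$1 = a \<or> x$1 = b \<or> x$2 = c \<or> x$2 = d)}"
    define X Y where "X = (y$1 - a) / l" and "Y = (y$2 - c) / s"
    have X: "0 \<le> X" "X \<le> A" "y $ 1 = a + l * X" using y l by (auto simp: X_def A_def divide_right_mono)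
    have Y: "0 \<le> Y" "Y \<le> B" "y $ 2 = c + s * Y" using y s by (auto simp: Y_def B_def divide_right_mono)
    have im: "y \<in> \<kappa> ` sphere 0 1" if "y = \<kappa> (cis \<phi>)" for \<phi> using that by auto
    have ee: "e * (t / e) = t" for t using e by simp
    have le: "t / e \<le> x" if "t \<le> e * x" for t x using that e by (simp add: field_simps)
    have ge: "x \<le> t / e" if "e * x \<le> t" for t x using that e by (simp add: field_simps)
    consider "y $ 2 = c" | "y $ 1 = b" | "y $ 2 = d" | "y $ 1 = a" using y by auto
    then show "y \<in> \<kappa> ` sphere 0 1"
    proof cases
      case 1
      have "\<kappa> (cis (X / e)) = y"
        by (subst k1) (use X e eb 1 in \<open>auto intro!: le simp: vec_eq_iff forall_2 ee\<close>)
      then show ?thesis using im by blast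
    next
      case 2
      have "\<kappa> (cis ((A + Y) / e)) = y"
        by (subst k2) (use Y e eb 2 in \<open>auto intro!: le ge simp: vec_eq_iff forall_2 ee M_def\<close>)
      then show ?thesis using im by blast
    next
      case 3
      have "\<kappa> (cis ((M + A - X) / e)) = y"
      proof -
        have "pi \<le> (M + A - X) / e" by (rule ge) (use X e in auto)
        moreover have "(M + A - X) / e \<le> pi + \<beta>" by (rule le) (use X e eb in \<open>simp add: distrib_left\<close>)
        ultimately show ?thesis using k3[of "(M + A - X) / e"] X(3) 3 unfolding ee by (simp add: vec_eq_iff forall_2)
      qed
      then show ?thesis using im by blast
    next
      case 4
      have "\<kappa> (cis ((2 * M - Y) / e)) = y"
      proof -
        have "pi + \<beta> \<le> (2 * M - Y) / e" by (rule ge) (use Y e eb M_def in \<open>simp add: distrib_left\<close>)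
        moreover have "(2 * M - Y) / e \<le> 2 * pi" by (rule le) (use Y e in auto)
        ultimately show ?thesis using k4[of "(2 * M - Y) / e"] Y(3) 4 unfolding ee by (simp add: vec_eq_iff forall_2)
      qed
      then show ?thesis using im by blast
    qed
  qed
  have rr: "Re (z * cnj w) \<in> {-1..1}" if "norm z = 1" "norm w = 1" for z w
    using abs_Re_le_cmod[of "z * cnj w"] that by (auto simp: norm_mult abs_le_iff)
  have cu: "continuous_on (sphere 0 1) u" unfolding u_def
    by (intro continuous_intros continuous_on_compose2[OF continuous_on_arccos']) (use rr[of _ 1] in auto)
  have cv: "continuous_on (sphere 0 1) v" unfolding v_def
    by (intro continuous_intros continuous_on_compose2[OF continuous_on_arccos']) (use rr[of _ "cis \<beta>"] in auto)
  have ke: "\<kappa> = (\<lambda>z. (a + l * ((u z + A - v z) / 2)) *\<^sub>R axis 1 1 + (c + s * ((u z - A + v z) / 2)) *\<^sub>R axis 2 1)"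
    by (auto simp: fun_eq_iff \<kappa>_def vec_eq_iff forall_2 axis_def)
  have ck: "continuous_on (sphere 0 1) \<kappa>" unfolding ke
    by (intro continuous_intros cu cv) auto
  \<comment> \<open>The constants are the values of the two level functions at the corner
    \<open>(a, c)\<close>, corrected by the offset \<open>A\<close> of \<open>v\<close>.\<close>
  define F where "F t = e * arccos t + (a / l + c / s)" for t
  define G where "G t = e * arccos t - A + (c / s - a / l)" for t
  have ia: "inj_on arccos {-1..1}"
    by (rule inj_onI) (metis atLeastAtMost_iff cos_arccos)
  have iF: "inj_on F {-1..1}" and iG: "inj_on G {-1..1}"
    using ia e by (auto simp: F_def G_def inj_on_def)
  have "rotation_number \<Omega> l \<in> \<rat> \<longleftrightarrow> (0 - \<beta>) / pi \<in> \<rat>"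
  proof (rule rotation_number_rational_iff[OF _ _ fr ck iF iG])
    show "convex \<Omega>" "compact \<Omega>" unfolding O by (rule rectangle_topology[OF ab])+
    have xl: "(a + l * X) / l = a / l + X" "(c + s * X) / s = c / s + X" for X using l s by (auto simp: field_simps)
    show "ell_plus l (\<kappa> z) = F (Re (z * cnj (cis 0)))" for z
      unfolding ell_plus_def s_def[symmetric] \<kappa>_def vector_2 xl by (simp add: F_def u_def field_simps)
    show "ell_minus l (\<kappa> z) = G (Re (z * cnj (cis \<beta>)))" for z
      unfolding ell_minus_def s_def[symmetric] \<kappa>_def vector_2 minus_divide_left[symmetric] xl by (simp add: G_def v_def field_simps)
    show "sin (0 - \<beta>) \<noteq> 0" using sin_gt_zero[OF b] by simp
  qed
  also have "(0 - \<beta>) / pi = - (A / (A + B))" by (simp add: \<beta>_def M_def)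
  also have "- (A / (A + B)) \<in> \<rat> \<longleftrightarrow> A / (A + B) \<in> \<rat>" by (metis Rats_minus_iff)
  also have "\<dots> \<longleftrightarrow> A / B \<in> \<rat>"
  proof
    assume r: "A / (A + B) \<in> \<rat>"
    have "1 - A / (A + B) = B / (A + B)" using AB by (simp add: field_simps)
    then have "A / B = (A / (A + B)) / (1 - A / (A + B))" using AB by simp
    also have "\<dots> \<in> \<rat>" by (rule Rats_divide[OF r Rats_diff[OF Rats_1 r]])
    finally show "A / B \<in> \<rat>" .
  next
    assume r: "A / B \<in> \<rat>"
    have "1 + A / B = (A + B) / B" using AB by (simp add: field_simps)
    then have "A / (A + B) = (A / B) / (1 + A / B)" using AB by simp
    also have "\<dots> \<in> \<rat>" by (rule Rats_divide[OF r Rats_add[OF Rats_1 r]])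
    finally show "A / (A + B) \<in> \<rat>" .
  qed
  also have "A / B = (b - a) / (d - c) * (s / l)" by (simp add: A_def B_def)
  finally show ?thesis by (simp add: s_def)
qed

section \<open>Uniform approximation of gradients\<close>

text \<open>The density hypothesis of \<open>complete_eigenvector_family_uniform\<close> for a
  single field, isolated so that sums, multiples and uniform limits can be taken.\<close>

definition C1_approximable :: "'i set \<Rightarrow> ('i \<Rightarrow> real^2 \<Rightarrow> real^2) \<Rightarrow> (real^2) set \<Rightarrow> (real^2 \<Rightarrow> real^2) \<Rightarrow> bool" where
  "C1_approximable I du U w \<longleftrightarrow>
     (\<forall>\<epsilon>>0. \<exists>F c. finite F \<and> F \<subseteq> I \<and> (\<forall>x\<in>U. norm (w x - (\<Sum>i\<in>F. c i *\<^sub>R du i x)) \<le> \<epsilon>))"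

lemma C1_approximableE:
  assumes "C1_approximable I du U w" "\<epsilon> > 0"
  obtains F c where "finite F" "F \<subseteq> I" "\<forall>x\<in>U. norm (w x - (\<Sum>i\<in>F. c i *\<^sub>R du i x)) \<le> \<epsilon>"
  using assms unfolding C1_approximable_def by metis

lemma C1_approximable_limit:
  assumes "\<And>\<epsilon>. \<epsilon> > 0 \<Longrightarrow> \<exists>v. C1_approximable I du U v \<and> (\<forall>x\<in>U. norm (w x - v x) \<le> \<epsilon>)"
  shows "C1_approximable I du U w"
  unfolding C1_approximable_def
proof (intro allI impI)
  fix \<epsilon> :: real assume e: "\<epsilon> > 0"
  obtain v where v: "C1_approximable I du U v" "\<forall>x\<in>U. norm (w x - v x) \<le> \<epsilon> / 2" using assms[of "\<epsilon>/2"] e by auto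
  obtain F c where F: "finite F" "F \<subseteq> I" "\<forall>x\<in>U. norm (v x - (\<Sum>i\<in>F. c i *\<^sub>R du i x)) \<le> \<epsilon> / 2"
    using e by (elim C1_approximableE[OF v(1) half_gt_zero])
  have "norm (w x - (\<Sum>i\<in>F. c i *\<^sub>R du i x)) \<le> \<epsilon>" if "x \<in> U" for x
  proof -
    have "norm ((w x - v x) + (v x - (\<Sum>i\<in>F. c i *\<^sub>R du i x))) \<le> \<epsilon> / 2 + \<epsilon> / 2"
      using v(2) F(3) that by (intro order_trans[OF norm_triangle_ineq] add_mono) auto
    then show ?thesis by simp
  qed
  with F show "\<exists>F c. finite F \<and> F \<subseteq> I \<and> (\<forall>x\<in>U. norm (w x - (\<Sum>i\<in>F. c i *\<^sub>R du i x)) \<le> \<epsilon>)" by blast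
qed

lemma C1_approximable_combination:
  assumes "finite F" "F \<subseteq> I"
  shows "C1_approximable I du U (\<lambda>x. \<Sum>i\<in>F. c i *\<^sub>R du i x)"
  unfolding C1_approximable_def
  by (intro allI impI exI[of _ F] exI[of _ c]) (use assms in auto)

lemma C1_approximable_add:
  assumes "C1_approximable I du U v" "C1_approximable I du U w"
  shows "C1_approximable I du U (\<lambda>x. v x + w x)"
  unfolding C1_approximable_def
proof (intro allI impI)
  fix \<epsilon> :: real assume e: "\<epsilon> > 0"
  obtain F c where F: "finite F" "F \<subseteq> I" "\<forall>x\<in>U. norm (v x - (\<Sum>i\<in>F. c i *\<^sub>R du i x)) \<le> \<epsilon> / 2"
    using e by (elim C1_approximableE[OF assms(1) half_gt_zero])
  obtain G d where G: "finite G" "G \<subseteq> I" "\<forall>x\<in>U. norm (w x - (\<Sum>i\<in>G. d i *\<^sub>R du i x)) \<le> \<epsilon> / 2"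
    using e by (elim C1_approximableE[OF assms(2) half_gt_zero])
  define k where "k i = (if i \<in> F then c i else 0) + (if i \<in> G then d i else 0)" for i
  have "(\<Sum>i\<in>F \<union> G. k i *\<^sub>R du i x) = (\<Sum>i\<in>F. c i *\<^sub>R du i x) + (\<Sum>i\<in>G. d i *\<^sub>R du i x)" for x
  proof -
    have "(\<Sum>i\<in>F. c i *\<^sub>R du i x) = (\<Sum>i\<in>F \<union> G. (if i \<in> F then c i else 0) *\<^sub>R du i x)"
      by (rule sum.mono_neutral_cong_left) (use F G in auto)
    moreover have "(\<Sum>i\<in>G. d i *\<^sub>R du i x) = (\<Sum>i\<in>F \<union> G. (if i \<in> G then d i else 0) *\<^sub>R du i x)"
      by (rule sum.mono_neutral_cong_left) (use F G in auto)
    ultimately show ?thesis by (simp add: k_def scaleR_add_left sum.distrib)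
  qed
  moreover have "norm (v x + w x - ((\<Sum>i\<in>F. c i *\<^sub>R du i x) + (\<Sum>i\<in>G. d i *\<^sub>R du i x))) \<le> \<epsilon>" if "x \<in> U" for x
  proof -
    have "norm ((v x - (\<Sum>i\<in>F. c i *\<^sub>R du i x)) + (w x - (\<Sum>i\<in>G. d i *\<^sub>R du i x))) \<le> \<epsilon> / 2 + \<epsilon> / 2"
      using G(3) F(3) that by (intro order_trans[OF norm_triangle_ineq] add_mono) auto
    then show ?thesis by (simp add: algebra_simps)
  qed
  ultimately show "\<exists>F c. finite F \<and> F \<subseteq> I \<and> (\<forall>x\<in>U. norm (v x + w x - (\<Sum>i\<in>F. c i *\<^sub>R du i x)) \<le> \<epsilon>)"
    using F G by (intro exI[of _ "F \<union> G"] exI[of _ k]) auto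
qed

lemma C1_approximable_scaleR:
  assumes "C1_approximable I du U v"
  shows "C1_approximable I du U (\<lambda>x. a *\<^sub>R v x)"
  unfolding C1_approximable_def
proof (intro allI impI)
  fix \<epsilon> :: real assume e: "\<epsilon> > 0"
  have p: "\<bar>a\<bar> + 1 > 0" by simp
  have "\<epsilon> / (\<bar>a\<bar> + 1) > 0" using e p by simp
  then obtain F c where F: "finite F" "F \<subseteq> I" "\<forall>x\<in>U. norm (v x - (\<Sum>i\<in>F. c i *\<^sub>R du i x)) \<le> \<epsilon> / (\<bar>a\<bar> + 1)"
    by (rule C1_approximableE[OF assms])
  have "norm (a *\<^sub>R v x - (\<Sum>i\<in>F. (a * c i) *\<^sub>R du i x)) \<le> \<epsilon>" if "x \<in> U" for x
  proof -
    have "a *\<^sub>R v x - (\<Sum>i\<in>F. (a * c i) *\<^sub>R du i x) = a *\<^sub>R (v x - (\<Sum>i\<in>F. c i *\<^sub>R du i x))"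
      by (simp add: scaleR_diff_right scaleR_sum_right)
    then have "norm (a *\<^sub>R v x - (\<Sum>i\<in>F. (a * c i) *\<^sub>R du i x)) = \<bar>a\<bar> * norm (v x - (\<Sum>i\<in>F. c i *\<^sub>R du i x))" by simp
    also have "\<dots> \<le> (\<bar>a\<bar> + 1) * (\<epsilon> / (\<bar>a\<bar> + 1))" using F(3) that by (intro mult_mono) auto
    also have "\<dots> = \<epsilon>" using p by simp
    finally show ?thesis .
  qed
  then show "\<exists>F c. finite F \<and> F \<subseteq> I \<and> (\<forall>x\<in>U. norm (a *\<^sub>R v x - (\<Sum>i\<in>F. c i *\<^sub>R du i x)) \<le> \<epsilon>)"
    using F by (intro exI[of _ F] exI[of _ "\<lambda>i. a * c i"]) auto
qed

lemma gradient_unique: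
  fixes u v :: "'a::real_inner"
  assumes "(f has_derivative (\<lambda>h. u \<bullet> h)) (at x)" "(f has_derivative (\<lambda>h. v \<bullet> h)) (at x)"
  shows "u = v"
proof -
  have "(\<lambda>h. u \<bullet> h) = (\<lambda>h. v \<bullet> h)" by (rule has_derivative_unique[OF assms])
  then have "u \<bullet> (u - v) = v \<bullet> (u - v)" by meson
  then have "(u - v) \<bullet> (u - v) = 0" by (simp add: inner_diff_left)
  then show ?thesis by simp
qed

lemma has_gradient_tensor:
  assumes "(f has_real_derivative f') (at (x $ 1))" "(g has_real_derivative g') (at (x $ 2))"
  shows "((\<lambda>x::real^2. f (x $ 1) * g (x $ 2)) has_derivative (\<lambda>h. vector [f' * g (x $ 2), f (x $ 1) * g'] \<bullet> h)) (at x)"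
proof -
  have c: "((\<lambda>x::real^2. x $ k) has_derivative (\<lambda>h. axis k 1 \<bullet> h)) (at x)" for k
    by (rule has_derivative_eq_rhs[OF bounded_linear_imp_has_derivative[OF bounded_linear_vec_nth]]) (auto simp: inner_axis')
  have "((\<lambda>x::real^2. f (x $ 1) * g (x $ 2)) has_derivative
      (\<lambda>h. (f (x $ 1) *\<^sub>R (g' *\<^sub>R axis 2 1) + g (x $ 2) *\<^sub>R (f' *\<^sub>R axis 1 1)) \<bullet> h)) (at x)"
    by (intro has_gradient_mult has_gradient_compose c assms)
  moreover have "f (x $ 1) *\<^sub>R (g' *\<^sub>R axis 2 1) + g (x $ 2) *\<^sub>R (f' *\<^sub>R axis 1 1) = (vector [f' * g (x $ 2), f (x $ 1) * g'] :: real^2)"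
    by (simp add: vec_eq_iff forall_2 axis_def)
  ultimately show ?thesis by simp
qed

section \<open>Polynomials in two variables, graded by degree\<close>

interpretation fun_vs: vector_space "\<lambda>(c::real) (f :: real^2 \<Rightarrow> real) x. c * f x"
  by unfold_locales (auto simp: algebra_simps fun_eq_iff)

text \<open>The degree bound is an integer so that \<open>polys (d - 2)\<close> is the zero space
  for \<open>d < 2\<close>; truncated subtraction would let constants in.\<close>

definition polys :: "int \<Rightarrow> (real^2 \<Rightarrow> real) set" where
  "polys d = fun_vs.span {(\<lambda>x. x $ 1 ^ i * x $ 2 ^ j) | i j. int (i + j) \<le> d}"

lemma polys_monomial: "int (i + j) \<le> d \<Longrightarrow> (\<lambda>x. x $ 1 ^ i * x $ 2 ^ j) \<in> polys d"
  unfolding polys_def by (rule fun_vs.span_base) blast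

lemma polys_induct [consumes 1, case_names zero step]:
  assumes "q \<in> polys d" "P (\<lambda>x. 0)"
    "\<And>c i j r. int (i + j) \<le> d \<Longrightarrow> r \<in> polys d \<Longrightarrow> P r \<Longrightarrow> P (\<lambda>x. c * (x $ 1 ^ i * x $ 2 ^ j) + r x)"
  shows "P q"
proof -
  have "q \<in> polys d \<and> P q"
  proof (rule fun_vs.span_induct_alt[of q "{(\<lambda>x. x $ 1 ^ i * x $ 2 ^ j) | i j. int (i + j) \<le> d}" "\<lambda>q. q \<in> polys d \<and> P q"])
    show "q \<in> fun_vs.span {(\<lambda>x. x $ 1 ^ i * x $ 2 ^ j) | i j. int (i + j) \<le> d}" using assms(1) by (simp only: polys_def)
    show "0 \<in> polys d \<and> P 0" using assms(2) fun_vs.span_zero unfolding polys_def zero_fun_def by blast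
    fix c :: real and x y :: "real^2 \<Rightarrow> real" assume x: "x \<in> {(\<lambda>x. x $ 1 ^ i * x $ 2 ^ j) | i j. int (i + j) \<le> d}" and y: "y \<in> polys d \<and> P y"
    then obtain i j where ij: "x = (\<lambda>x. x $ 1 ^ i * x $ 2 ^ j)" "int (i + j) \<le> d" by blast
    have "(\<lambda>z. c * x z) + y \<in> polys d"
      unfolding polys_def
      by (rule fun_vs.span_add[OF fun_vs.span_scale[OF fun_vs.span_base[OF x]] y[unfolded polys_def, THEN conjunct1]])
    moreover have "P ((\<lambda>z. c * x z) + y)" using assms(3)[OF ij(2), of y c] y by (simp add: ij(1) plus_fun_def)
    ultimately show "(\<lambda>z. c * x z) + y \<in> polys d \<and> P ((\<lambda>z. c * x z) + y)" by simp
  qed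
  then show ?thesis by simp
qed

lemma polys_zero: "(\<lambda>x. 0) \<in> polys d"
  unfolding polys_def using fun_vs.span_zero unfolding zero_fun_def by blast

lemma polys_add: "p \<in> polys d \<Longrightarrow> q \<in> polys d \<Longrightarrow> (\<lambda>x. p x + q x) \<in> polys d"
  unfolding polys_def using fun_vs.span_add[of p _ q] unfolding plus_fun_def by blast

lemma polys_scale: "p \<in> polys d \<Longrightarrow> (\<lambda>x. c * p x) \<in> polys d"
  unfolding polys_def by (rule fun_vs.span_scale)

lemma polys_mono: "d \<le> e \<Longrightarrow> polys d \<subseteq> polys e"
  unfolding polys_def by (rule fun_vs.span_mono) (use order_trans in blast)

lemma polys_mult:
  assumes "p \<in> polys d" "q \<in> polys e"
  shows "(\<lambda>x. p x * q x) \<in> polys (d + e)"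
  using assms(1)
proof (induction p rule: polys_induct)
  case zero show ?case using polys_zero by simp
next
  case (step c i j r)
  have "(\<lambda>x. (x $ 1 ^ i * x $ 2 ^ j) * q x) \<in> polys (d + e)"
    using assms(2)
  proof (induction q rule: polys_induct)
    case zero show ?case using polys_zero by simp
  next
    case (step a k m s)
    have "(\<lambda>x. x $ 1 ^ (i + k) * x $ 2 ^ (j + m)) \<in> polys (d + e)"
      by (rule polys_monomial) (use step(1) \<open>int (i + j) \<le> d\<close> in simp)
    from polys_add[OF polys_scale[OF this, of a] step(3)] show ?case
      by (simp add: power_add algebra_simps)
  qed
  from polys_add[OF polys_scale[OF this, of c] step(3)] show ?case by (simp add: algebra_simps)
qed

lemma polys_const: "0 \<le> d \<Longrightarrow> (\<lambda>x. c) \<in> polys d"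
  using polys_scale[OF polys_monomial[of 0 0 d], of c] by simp

lemma polys_linear: "1 \<le> d \<Longrightarrow> (\<lambda>x. a * x $ 1 + b * x $ 2) \<in> polys d"
  using polys_add[OF polys_scale[OF polys_monomial[of 1 0 d], of a] polys_scale[OF polys_monomial[of 0 1 d], of b]] by simp

lemma polys_power: "p \<in> polys 1 \<Longrightarrow> (\<lambda>x. p x ^ n) \<in> polys (int n)"
proof (induction n)
  case 0 show ?case using polys_const[of 0 1] by simp
next
  case (Suc n)
  then show ?case using polys_mult[of p 1 "\<lambda>x. p x ^ n" "int n"] by simp
qed

lemma real_polynomial_function_in_polys:
  assumes "real_polynomial_function q"
  shows "\<exists>d. q \<in> polys d"
  using assms
proof (induction q rule: real_polynomial_function.induct)
  case (linear f)
  have "f x = f (axis 1 1) * x $ 1 + f (axis 2 1) * x $ 2" for x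
  proof -
    have "x = (x $ 1) *\<^sub>R axis 1 1 + (x $ 2) *\<^sub>R axis 2 1" by (simp add: vec_eq_iff forall_2 axis_def)
    then have "f x = f ((x $ 1) *\<^sub>R axis 1 1 + (x $ 2) *\<^sub>R axis 2 1)" by simp
    also have "\<dots> = (x $ 1) *\<^sub>R f (axis 1 1) + (x $ 2) *\<^sub>R f (axis 2 1)"
      using linear by (simp add: linear_add linear_cmul bounded_linear.linear)
    finally show ?thesis by simp
  qed
  then show ?case using polys_linear[of 1 "f (axis 1 1)" "f (axis 2 1)"] by (metis (no_types, lifting) ext order_refl)
next
  case (const c) show ?case using polys_const[of 0 c] by blast
next
  case (add f g)
  then obtain d e where "f \<in> polys d" "g \<in> polys e" by blast
  then have "f \<in> polys (max d e)" "g \<in> polys (max d e)" using polys_mono[of d "max d e"] polys_mono[of e "max d e"] by auto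
  then show ?case using polys_add by blast
next
  case (mult f g) then show ?case using polys_mult by blast
qed

section \<open>Cosine polynomials and sine approximation with derivatives\<close>

definition cos_poly :: "(real \<Rightarrow> real) \<Rightarrow> bool" where
  "cos_poly f \<longleftrightarrow> (\<exists>N c. \<forall>t. f t = (\<Sum>k\<le>N. c k * cos (real k * t)))"

lemma cos_poly_const: "cos_poly (\<lambda>t. a)"
  unfolding cos_poly_def by (rule exI[of _ 0], rule exI[of _ "\<lambda>k. a"]) simp

lemma cos_poly_scale: "cos_poly f \<Longrightarrow> cos_poly (\<lambda>t. a * f t)"
  unfolding cos_poly_def
proof (elim exE)
  fix N c assume "\<forall>t. f t = (\<Sum>k\<le>N. c k * cos (real k * t))"
  then show "\<exists>N c. \<forall>t. a * f t = (\<Sum>k\<le>N. c k * cos (real k * t))"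
    by (intro exI[of _ N] exI[of _ "\<lambda>k. a * c k"]) (simp add: sum_distrib_left mult.assoc)
qed

lemma cos_poly_add:
  assumes "cos_poly f" "cos_poly g"
  shows "cos_poly (\<lambda>t. f t + g t)"
proof -
  obtain N c where f: "\<And>t. f t = (\<Sum>k\<le>N. c k * cos (real k * t))" using assms(1) unfolding cos_poly_def by blast
  obtain M d where g: "\<And>t. g t = (\<Sum>k\<le>M. d k * cos (real k * t))" using assms(2) unfolding cos_poly_def by blast
  define c' where "c' k = (if k \<le> N then c k else 0)" for k
  define d' where "d' k = (if k \<le> M then d k else 0)" for k
  have "f t = (\<Sum>k\<le>max N M. c' k * cos (real k * t))" for t
    unfolding f by (rule sum.mono_neutral_cong_left) (auto simp: c'_def)
  moreover have "g t = (\<Sum>k\<le>max N M. d' k * cos (real k * t))" for t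
    unfolding g by (rule sum.mono_neutral_cong_left) (auto simp: d'_def)
  ultimately have "f t + g t = (\<Sum>k\<le>max N M. (c' k + d' k) * cos (real k * t))" for t
    by (simp add: distrib_right sum.distrib)
  then show ?thesis unfolding cos_poly_def by (intro exI[of _ "max N M"] exI[of _ "\<lambda>k. c' k + d' k"]) blast
qed

lemma cos_poly_sum: "finite A \<Longrightarrow> (\<And>a. a \<in> A \<Longrightarrow> cos_poly (f a)) \<Longrightarrow> cos_poly (\<lambda>t. \<Sum>a\<in>A. f a t)"
  by (induction A rule: finite_induct) (auto simp: cos_poly_const cos_poly_add)

lemma cos_poly_cos: "cos_poly (\<lambda>t. cos (real n * t))"
  unfolding cos_poly_def
  by (rule exI[of _ n], rule exI[of _ "\<lambda>k. if k = n then 1 else 0"]) (simp add: if_distrib[of "\<lambda>x. x * _"] sum.delta cong: if_cong)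

lemma cos_poly_mult_cos:
  assumes "cos_poly f"
  shows "cos_poly (\<lambda>t. cos t * f t)"
proof -
  obtain N c where f: "\<And>t. f t = (\<Sum>k\<le>N. c k * cos (real k * t))" using assms(1) unfolding cos_poly_def by blast
  have "cos_poly (\<lambda>t. \<Sum>k\<le>N. c k * (cos t * cos (real k * t)))"
  proof (intro cos_poly_sum cos_poly_scale)
    fix k
    show "cos_poly (\<lambda>t. cos t * cos (real k * t))"
    proof (cases k)
      case 0 then show ?thesis using cos_poly_cos[of 1] by simp
    next
      case (Suc m)
      \<comment> \<open>Product-to-sum formula; \<open>k = 0\<close> is treated apart because the
        index \<open>k - 1\<close> must stay a natural number.\<close>
      have "(\<lambda>t. cos t * cos (real k * t)) = (\<lambda>t. (1/2) * cos (real m * t) + (1/2) * cos (real (m + 2) * t))"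
      proof
        fix t
        have "real m * t = real k * t - t" "real (m + 2) * t = real k * t + t" by (auto simp: Suc algebra_simps)
        then show "cos t * cos (real k * t) = (1/2) * cos (real m * t) + (1/2) * cos (real (m + 2) * t)"
          by (simp only: cos_add cos_diff) (simp add: algebra_simps)
      qed
      then show ?thesis by (simp only: cos_poly_add[OF cos_poly_scale[OF cos_poly_cos] cos_poly_scale[OF cos_poly_cos]])
    qed
  qed auto
  moreover have "(\<lambda>t. \<Sum>k\<le>N. c k * (cos t * cos (real k * t))) = (\<lambda>t. cos t * f t)"
    by (auto simp: f sum_distrib_left algebra_simps)
  ultimately show ?thesis by simp
qed

lemma cos_poly_real_polynomial_function:
  assumes "real_polynomial_function p"
  shows "cos_poly (\<lambda>t. p (cos t))"
proof -
  obtain a n where p: "p = (\<lambda>x. \<Sum>i\<le>n. a i * x ^ i)" using real_polynomial_function_imp_sum[OF assms] by blast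
  have pw: "cos_poly (\<lambda>t. cos t ^ i)" for i
    by (induction i) (auto simp: cos_poly_const cos_poly_mult_cos)
  show ?thesis unfolding p by (intro cos_poly_sum cos_poly_scale pw) auto
qed

text \<open>Approximate \<open>f'\<close> by a polynomial in \<open>cos\<close> and integrate; the constant term of this
  polynomial is small because \<open>f\<close> vanishes at both end points.\<close>
lemma sine_C1_approx_standard:
  fixes f f' :: "real \<Rightarrow> real"
  assumes f: "\<And>t. (f has_real_derivative f' t) (at t)" and c: "continuous_on UNIV f'"
    and z: "f 0 = 0" "f pi = 0" and e: "\<epsilon> > 0"
  obtains N c where "\<And>t. t \<in> {0..pi} \<Longrightarrow> \<bar>f t - (\<Sum>k\<in>{1..N}. c k * sin (real k * t))\<bar> \<le> \<epsilon>"
    "\<And>t. t \<in> {0..pi} \<Longrightarrow> \<bar>f' t - (\<Sum>k\<in>{1..N}. c k * (real k * cos (real k * t)))\<bar> \<le> \<epsilon>"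
proof -
  \<comment> \<open>Two errors of size \<delta> meet: the polynomial approximation and the constant
    term. Integrated over a length of at most \<open>pi\<close> they add up to \<epsilon>.\<close>
  define \<delta> where "\<delta> = \<epsilon> / (2 * pi)"
  have d: "\<delta> > 0" using e by (simp add: \<delta>_def)
  have "continuous_on {-1..1} (\<lambda>x. f' (arccos x))"
    by (rule continuous_on_compose2[OF c continuous_on_arccos']) auto
  then obtain p where p: "real_polynomial_function p" "\<And>x. x \<in> {-1..1} \<Longrightarrow> \<bar>f' (arccos x) - p x\<bar> < \<delta>"
    using Stone_Weierstrass_real_polynomial_function[of "{-1..1}" "\<lambda>x. f' (arccos x)" \<delta>] d by auto
  obtain N a where a: "\<And>t. p (cos t) = (\<Sum>k\<le>N. a k * cos (real k * t))"
    using cos_poly_real_polynomial_function[OF p(1)] unfolding cos_poly_def by blast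
  have le: "\<bar>f' t - p (cos t)\<bar> \<le> \<delta>" if "t \<in> {0..pi}" for t
    using p(2)[of "cos t"] that by (simp add: arccos_cos)
  \<comment> \<open>Dividing by \<open>k\<close> integrates the nonconstant part of the cosine
    polynomial.\<close>
  define S where "S t = (\<Sum>k\<in>{1..N}. (a k / real k) * sin (real k * t))" for t
  define S' where "S' t = (\<Sum>k\<in>{1..N}. (a k / real k) * (real k * cos (real k * t)))" for t
  have pS: "p (cos t) = a 0 + S' t" for t
  proof -
    have "{..N} = insert 0 {1..N}" by auto
    then have "p (cos t) = a 0 + (\<Sum>k\<in>{1..N}. a k * cos (real k * t))" unfolding a by simp
    also have "(\<Sum>k\<in>{1..N}. a k * cos (real k * t)) = S' t" unfolding S'_def by (rule sum.cong) auto
    finally show ?thesis .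
  qed
  have dS: "(S has_real_derivative S' t) (at t)" for t
    unfolding S_def[abs_def] S'_def by (intro DERIV_sum DERIV_cmult) (auto intro!: derivative_eq_intros)
  have S0: "S 0 = 0" "S pi = 0" by (auto simp: S_def intro!: sum.neutral)
  have dd: "((\<lambda>t. f t - S t) has_real_derivative (f' t - S' t)) (at t)" for t by (intro DERIV_diff f dS)
  have dH: "((\<lambda>t. f t - S t - a 0 * t) has_real_derivative (f' t - p (cos t))) (at t)" for t
    using DERIV_diff[OF dd DERIV_cmult[OF DERIV_ident, of "a 0" t]] pS[of t] by (simp add: algebra_simps)
  \<comment> \<open>\<open>f - S - a 0 * t\<close> changes by \<open>- a 0 * pi\<close> over the
    interval, so its derivative, at most \<delta> in absolute value, equals \<open>- a 0\<close> at
    some point.\<close>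
  obtain \<xi> where x: "0 < \<xi>" "\<xi> < pi"
    "(f pi - S pi - a 0 * pi) - (f 0 - S 0 - a 0 * 0) = (pi - 0) * (f' \<xi> - p (cos \<xi>))"
    using MVT2[OF pi_gt_zero, of "\<lambda>t. f t - S t - a 0 * t" "\<lambda>t. f' t - p (cos t)"] dH by blast
  have "pi * (- a 0) = pi * (f' \<xi> - p (cos \<xi>))" using x(3) z S0 by (simp add: mult.commute)
  then have "- a 0 = f' \<xi> - p (cos \<xi>)" by (simp only: mult_left_cancel[OF pi_neq_zero])
  then have a0: "\<bar>a 0\<bar> \<le> \<delta>" using le[of \<xi>] x by simp
  have le2: "\<bar>f' t - S' t\<bar> \<le> 2 * \<delta>" if "t \<in> {0..pi}" for t
    using le[OF that] a0 pS[of t] by linarith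
  have le1: "\<bar>f t - S t\<bar> \<le> 2 * \<delta> * pi" if t: "t \<in> {0..pi}" for t
  proof (cases "t = 0")
    case True then show ?thesis using z S0 d by simp
  next
    case False
    then have t0: "0 < t" using t by simp
    obtain \<eta> where h: "0 < \<eta>" "\<eta> < t" "(f t - S t) - (f 0 - S 0) = (t - 0) * (f' \<eta> - S' \<eta>)"
      using MVT2[OF t0, of "\<lambda>t. f t - S t" "\<lambda>t. f' t - S' t"] dd by blast
    have "\<bar>f t - S t\<bar> = t * \<bar>f' \<eta> - S' \<eta>\<bar>" using h(3) z S0 t0 by (simp add: abs_mult)
    also have "\<dots> \<le> pi * (2 * \<delta>)" using le2[of \<eta>] h t by (intro mult_mono) auto
    finally show ?thesis by (simp add: mult.commute)
  qed
  have dl: "2 * \<delta> * pi = \<epsilon>" by (simp add: \<delta>_def)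
  have "2 * \<delta> \<le> 2 * \<delta> * pi" using d pi_ge_two by simp
  then have dl2: "2 * \<delta> \<le> \<epsilon>" using dl by simp
  show ?thesis
    by (rule that[where N=N and c="\<lambda>k. a k / real k"]) (use le1 le2 dl dl2 in \<open>force simp: S_def S'_def\<close>)+
qed

lemma sine_C1_approx:
  fixes f f' :: "real \<Rightarrow> real"
  assumes ab: "a < b" and f: "\<And>t. (f has_real_derivative f' t) (at t)" and c: "continuous_on UNIV f'"
    and z: "f a = 0" "f b = 0" and e: "\<epsilon> > 0"
  obtains N c where "\<And>t. t \<in> {a..b} \<Longrightarrow> \<bar>f t - (\<Sum>k\<in>{1..N}. c k * sin (real k * (pi / (b - a)) * (t - a)))\<bar> \<le> \<epsilon>"
    "\<And>t. t \<in> {a..b} \<Longrightarrow> \<bar>f' t - (\<Sum>k\<in>{1..N}. c k * ((real k * (pi / (b - a))) * cos (real k * (pi / (b - a)) * (t - a))))\<bar> \<le> \<epsilon>"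
proof -
  define w where "w = pi / (b - a)"
  have w: "w > 0" using ab by (simp add: w_def)
  define g where "g s = f (a + s / w)" for s
  define g' where "g' s = f' (a + s / w) / w" for s
  have dg: "(g has_real_derivative g' s) (at s)" for s
  proof -
    have "((\<lambda>s. a + s / w) has_real_derivative 1 / w) (at s)" using w by (auto intro!: derivative_eq_intros)
    from DERIV_chain2[OF f this] show ?thesis by (simp add: g_def[abs_def] g'_def)
  qed
  have cg: "continuous_on UNIV g'" unfolding g'_def
    by (intro continuous_intros continuous_on_compose2[OF c]) (use w in auto)
  have gz: "g 0 = 0" "g pi = 0" using z ab by (auto simp: g_def w_def)
  define \<delta> where "\<delta> = min \<epsilon> (\<epsilon> / w)"
  have d: "\<delta> > 0" "\<delta> \<le> \<epsilon>" "w * \<delta> \<le> \<epsilon>" using e w by (auto simp: \<delta>_def min_def field_simps)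
  obtain N cc where 1: "\<And>t. t \<in> {0..pi} \<Longrightarrow> \<bar>g t - (\<Sum>k\<in>{1..N}. cc k * sin (real k * t))\<bar> \<le> \<delta>"
    and 2: "\<And>t. t \<in> {0..pi} \<Longrightarrow> \<bar>g' t - (\<Sum>k\<in>{1..N}. cc k * (real k * cos (real k * t)))\<bar> \<le> \<delta>"
    by (rule sine_C1_approx_standard[OF dg cg gz d(1)]) blast
  have s: "w * (t - a) \<in> {0..pi}" "a + w * (t - a) / w = t" if "t \<in> {a..b}" for t
  proof -
    have "w * (t - a) \<le> w * (b - a)" using that w by (intro mult_left_mono) auto
    then show "w * (t - a) \<in> {0..pi}" using that w ab by (simp add: w_def)
    show "a + w * (t - a) / w = t" using w by simp
  qed
  show ?thesis
  proof (rule that[where N=N and c=cc], unfold w_def[symmetric])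
    fix t assume t: "t \<in> {a..b}"
    show "\<bar>f t - (\<Sum>k\<in>{1..N}. cc k * sin (real k * w * (t - a)))\<bar> \<le> \<epsilon>"
      using 1[OF s(1)[OF t]] s(2)[OF t] d(2) by (simp add: g_def mult.assoc)
    have "f' t - (\<Sum>k\<in>{1..N}. cc k * ((real k * w) * cos (real k * w * (t - a))))
       = w * (g' (w * (t - a)) - (\<Sum>k\<in>{1..N}. cc k * (real k * cos (real k * (w * (t - a))))))"
      using s(2)[OF t] w by (simp add: g'_def right_diff_distrib sum_distrib_left mult_ac)
    then have "\<bar>f' t - (\<Sum>k\<in>{1..N}. cc k * ((real k * w) * cos (real k * w * (t - a))))\<bar> \<le> w * \<delta>"
      using mult_left_mono[OF 2[OF s(1)[OF t]], of w] w by (simp add: abs_mult)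
    then show "\<bar>f' t - (\<Sum>k\<in>{1..N}. cc k * ((real k * w) * cos (real k * w * (t - a))))\<bar> \<le> \<epsilon>" using d(3) by linarith
  qed
qed

section \<open>The spectrum of a rectangle\<close>

definition sin_prod :: "real \<Rightarrow> real \<Rightarrow> real \<Rightarrow> real \<Rightarrow> real^2 \<Rightarrow> real" where
  "sin_prod a c p q x = sin (p * (x $ 1 - a)) * sin (q * (x $ 2 - c))"

definition sin_prod_grad :: "real \<Rightarrow> real \<Rightarrow> real \<Rightarrow> real \<Rightarrow> real^2 \<Rightarrow> real^2" where
  "sin_prod_grad a c p q x =
     vector [p * cos (p * (x $ 1 - a)) * sin (q * (x $ 2 - c)), sin (p * (x $ 1 - a)) * (q * cos (q * (x $ 2 - c)))]"

lemma sin_prod_has_gradient: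
  "(sin_prod a c p q has_derivative (\<lambda>h. sin_prod_grad a c p q x \<bullet> h)) (at x)"
  unfolding sin_prod_def[abs_def] sin_prod_grad_def
  by (rule has_gradient_tensor) (auto intro!: derivative_eq_intros)

text \<open>\<open>l\<close> is chosen so that the characteristics have slope \<open>p / q\<close>;
  then \<open>p * x$1 + q * x$2\<close> and \<open>q * x$2 - p * x$1\<close> are multiples of
  \<open>ell_plus l x\<close> and \<open>ell_minus l x\<close>, and the product-to-sum formula for
  sines yields two plane waves.\<close>

lemma sin_prod_wave:
  assumes "p > 0" "q > 0"
  obtains l f f' h h' where "0 < l" "l < 1" "l\<^sup>2 = 1 / (1 + (p / q)\<^sup>2)"
    "\<And>t. (f has_real_derivative f' t) (at t)" "continuous_on UNIV f'"
    "\<And>t. (h has_real_derivative h' t) (at t)" "continuous_on UNIV h'"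
    "sin_prod a c p q = wave l f h" "sin_prod_grad a c p q = wave_grad l f' h'"
proof -
  have pq: "p / q > 0" using assms by simp
  obtain l where l: "0 < l" "l < 1" "l = 1 / sqrt (1 + (p / q)\<^sup>2)" "sqrt (1 - l\<^sup>2) = p / q * l"
    using parameter_of_slope[OF pq] .
  define K where "K = p * l"
  define z :: "real^2" where "z = vector [a, c]"
  define f where "f t = - (1/2) * cos (K * (t - ell_plus l z))" for t
  define f' where "f' t = (1/2) * (K * sin (K * (t - ell_plus l z)))" for t
  define h where "h t = (1/2) * cos (K * (t - ell_minus l z))" for t
  define h' where "h' t = - (1/2) * (K * sin (K * (t - ell_minus l z)))" for t
  have df: "(f has_real_derivative f' t) (at t)" for t
    unfolding f_def[abs_def] f'_def by (auto intro!: derivative_eq_intros)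
  have dh: "(h has_real_derivative h' t) (at t)" for t
    unfolding h_def[abs_def] h'_def by (auto intro!: derivative_eq_intros)
  have cf: "continuous_on UNIV f'" "continuous_on UNIV h'" unfolding f'_def h'_def by (intro continuous_intros)+
  have qp: "K / (p / q * l) = q" using assms l by (simp add: K_def)
  have kp: "K * (ell_plus l x - ell_plus l z) = p * (x $ 1 - a) + q * (x $ 2 - c)" for x
  proof -
    have "K * (ell_plus l x - ell_plus l z) = (K / l) * (x $ 1 - a) + (K / (p / q * l)) * (x $ 2 - c)"
      unfolding ell_plus_def l(4) z_def vector_2 by (simp add: algebra_simps diff_divide_distrib)
    then show ?thesis unfolding qp using l by (simp add: K_def)
  qed
  have km: "K * (ell_minus l x - ell_minus l z) = q * (x $ 2 - c) - p * (x $ 1 - a)" for x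
  proof -
    have "K * (ell_minus l x - ell_minus l z) = (K / (p / q * l)) * (x $ 2 - c) - (K / l) * (x $ 1 - a)"
      unfolding ell_minus_def l(4) z_def vector_2 by (simp add: algebra_simps diff_divide_distrib)
    then show ?thesis unfolding qp using l by (simp add: K_def)
  qed
  have w: "sin_prod a c p q = wave l f h"
  proof
    fix x
    show "sin_prod a c p q x = wave l f h x"
      unfolding wave_def f_def h_def kp km sin_prod_def cos_add cos_diff by (simp add: algebra_simps)
  qed
  \<comment> \<open>Uniqueness of derivatives replaces a trigonometric verification.\<close>
  have g: "sin_prod_grad a c p q = wave_grad l f' h'"
  proof
    fix x
    show "sin_prod_grad a c p q x = wave_grad l f' h' x"
      by (rule gradient_unique[OF sin_prod_has_gradient]) (unfold w, rule wave_has_gradient[OF df dh])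
  qed
  have "0 < 1 + (p / q)\<^sup>2" by (simp add: add_pos_nonneg)
  then have "l\<^sup>2 = 1 / (1 + (p / q)\<^sup>2)" unfolding l(3) power_divide by simp
  then show ?thesis using that[OF l(1,2) _ df cf(1) dh cf(2) w g] by blast
qed

text \<open>The sine vanishes at both ends, so \<open>\<bar>sin y\<bar> \<le> \<bar>y\<bar>\<close>
  can be used from the nearer end; the distance to the other end is then at least half the interval,
  whence the factor \<open>2 / (b - a)\<close>.\<close>

lemma abs_sin_multiple_le:
  assumes "a < b" "a < t" "t < b"
  shows "\<bar>sin (real m * (pi / (b - a)) * (t - a))\<bar> \<le> (real m * (pi / (b - a)) * (2 / (b - a))) * ((t - a) * (b - t))"
proof -
  define w where "w = real m * (pi / (b - a))"
  have w: "w \<ge> 0" using assms by (simp add: w_def)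
  have 1: "\<bar>sin (w * (t - a))\<bar> \<le> w * (t - a)" using abs_sin_x_le_abs_x[of "w * (t - a)"] w assms by (simp add: abs_mult)
  \<comment> \<open>\<open>w * (b - a)\<close> equals \<open>m * pi\<close>, so the sine measured
    from \<open>b\<close> agrees up to sign with the sine measured from \<open>a\<close>.\<close>
  have e: "w * (t - a) = real m * pi - w * (b - t)" using assms by (simp add: w_def field_simps)
  have "\<bar>sin (w * (t - a))\<bar> = \<bar>sin (w * (b - t))\<bar>"
    unfolding e sin_diff by (simp add: abs_mult)
  then have 2: "\<bar>sin (w * (t - a))\<bar> \<le> w * (b - t)" using abs_sin_x_le_abs_x[of "w * (b - t)"] w assms by (simp add: abs_mult)
  have q: "y \<le> 2 / (b - a) * (y * r)" if "r \<ge> (b - a) / 2" "y \<ge> 0" for y r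
  proof -
    have "y * 1 \<le> y * (2 / (b - a) * r)" using that assms by (intro mult_left_mono) (auto simp: field_simps)
    then show ?thesis by (simp add: mult_ac)
  qed
  show ?thesis
  proof (cases "t - a \<ge> (b - a) / 2")
    case True
    have "\<bar>sin (w * (t - a))\<bar> \<le> w * (2 / (b - a) * ((b - t) * (t - a)))"
      using 2 mult_left_mono[OF q[OF True, of "b - t"] w] assms by simp
    then show ?thesis unfolding w_def by (simp add: mult_ac)
  next
    case False
    then have "b - t \<ge> (b - a) / 2" by (simp add: field_simps)
    then have "\<bar>sin (w * (t - a))\<bar> \<le> w * (2 / (b - a) * ((t - a) * (b - t)))"
      using 1 mult_left_mono[OF q[of "b - t" "t - a"] w] assms by simp
    then show ?thesis unfolding w_def by (simp add: mult_ac)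
  qed
qed

lemma continuous_on_vector2:
  assumes "continuous_on S f" "continuous_on S g"
  shows "continuous_on S (\<lambda>x. vector [f x, g x] :: real^2)"
proof -
  have "(\<lambda>x. vector [f x, g x] :: real^2) = (\<lambda>x. f x *\<^sub>R axis 1 1 + g x *\<^sub>R axis 2 1)"
    by (auto simp: fun_eq_iff vec_eq_iff forall_2 axis_def)
  then show ?thesis using assms by (simp only:) (intro continuous_intros)
qed

section \<open>Eigenfunctions and completeness on a rectangle\<close>

context
  fixes a b c d :: real and \<Omega> :: "(real^2) set"
  assumes ab: "a < b" "c < d" and O: "\<Omega> = {x. a \<le> x$1 \<and> x$1 \<le> b \<and> c \<le> x$2 \<and> x$2 \<le> d}"
begin

abbreviation "w1 \<equiv> pi / (b - a)"
abbreviation "w2 \<equiv> pi / (d - c)"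
abbreviation "\<rho>1 \<equiv> \<lambda>t. (t - a) * (b - t)"
abbreviation "\<rho>2 \<equiv> \<lambda>t. (t - c) * (d - t)"
abbreviation "rect_grad \<equiv> \<lambda>(m, n). sin_prod_grad a c (real m * w1) (real n * w2)"
abbreviation "rect_index \<equiv> {1..} \<times> {1..} :: (nat \<times> nat) set"

lemma has_real_derivative_rho:
  "((\<lambda>t. (t - r) * (s - t)) has_real_derivative (s + r - 2 * t)) (at (t::real))"
  by (auto intro!: derivative_eq_intros)

lemma rectangle_rho_has_gradient:
  "((\<lambda>x::real^2. \<rho>1 (x $ 1) * \<rho>2 (x $ 2)) has_derivative
      (\<lambda>h. vector [(b + a - 2 * x $ 1) * \<rho>2 (x $ 2), \<rho>1 (x $ 1) * (d + c - 2 * x $ 2)] \<bullet> h)) (at x)"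
  by (rule has_gradient_tensor[OF has_real_derivative_rho has_real_derivative_rho])

lemma interior_rect: "interior \<Omega> = {x. a < x$1 \<and> x$1 < b \<and> c < x$2 \<and> x$2 < d}"
  unfolding O by (rule rectangle_topology(1)[OF ab])

lemma rectangle_P_eigvec:
  assumes "(m, n) \<in> rect_index"
  shows "P_eigvec \<Omega> (1 / (1 + ((real m * w1) / (real n * w2))\<^sup>2))
    (\<lambda>x. if x \<in> interior \<Omega> then sin_prod a c (real m * w1) (real n * w2) x else 0)
    (\<lambda>x. if x \<in> interior \<Omega> then rect_grad (m, n) x else 0)"
proof -
  define p q where "p = real m * w1" and "q = real n * w2"
  have mn: "real m \<ge> 1" "real n \<ge> 1" using assms by auto
  have pq: "p > 0" "q > 0" using ab mn by (auto simp: p_def q_def)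
  obtain l f f' h h' where w: "0 < l" "l < 1" "l\<^sup>2 = 1 / (1 + (p / q)\<^sup>2)"
    "\<And>t. (f has_real_derivative f' t) (at t)" "continuous_on UNIV f'"
    "\<And>t. (h has_real_derivative h' t) (at t)" "continuous_on UNIV h'"
    "sin_prod a c p q = wave l f h" "sin_prod_grad a c p q = wave_grad l f' h'"
    using sin_prod_wave[OF pq] by metis
  \<comment> \<open>The first sine is 1 here and the second argument is \<open>pi / 4\<close>, so
    the derivative in the second variable does not vanish; at a common extremum of both sines the
    gradient would be zero.\<close>
  define x0 :: "real^2" where "x0 = vector [a + pi / (2 * p), c + pi / (4 * q)]"
  have "pi / (2 * p) = (b - a) / (2 * real m)" "pi / (4 * q) = (d - c) / (4 * real n)"
    using ab mn by (auto simp: p_def q_def field_simps)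
  moreover have "(b - a) / (2 * real m) < b - a" "(d - c) / (4 * real n) < d - c"
    using ab mn by (auto simp: divide_less_eq)
  moreover have "0 < (b - a) / (2 * real m)" "0 < (d - c) / (4 * real n)" using ab mn by auto
  ultimately have x0: "x0 \<in> interior \<Omega>" by (simp add: interior_rect x0_def)
  have g0: "sin_prod_grad a c p q x0 \<noteq> 0"
  proof -
    have e: "p * (x0 $ 1 - a) = pi / 2" "q * (x0 $ 2 - c) = pi / 4" using pq by (auto simp: x0_def)
    have "sin_prod_grad a c p q x0 $ 2 = q * (sqrt 2 / 2)" unfolding sin_prod_grad_def vector_2 e by (simp add: cos_45)
    moreover have "q * (sqrt 2 / 2) \<noteq> 0" using pq by simp
    ultimately have "sin_prod_grad a c p q x0 $ 2 \<noteq> 0" by (simp only: not_False_eq_True)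
    then show ?thesis by (metis zero_index)
  qed
  have "P_eigvec \<Omega> (l\<^sup>2) (\<lambda>x. if x \<in> interior \<Omega> then wave l f h x else 0) (\<lambda>x. if x \<in> interior \<Omega> then wave_grad l f' h' x else 0)"
  proof (rule wave_P_eigvec[OF w(1,2) _ w(4,5,6,7) rectangle_rho_has_gradient _ _ _ _ x0 g0[unfolded w(9)]])
    show "bounded \<Omega>" unfolding O by (intro compact_imp_bounded rectangle_topology ab)
    show "continuous_on UNIV (\<lambda>x::real^2. vector [(b + a - 2 * x $ 1) * \<rho>2 (x $ 2), \<rho>1 (x $ 1) * (d + c - 2 * x $ 2)] :: real^2)"
      by (intro continuous_on_vector2 continuous_intros)
    show "0 < \<rho>1 (x $ 1) * \<rho>2 (x $ 2)" if "x \<in> interior \<Omega>" for x using that by (simp add: interior_rect)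
    show "\<rho>1 (x $ 1) * \<rho>2 (x $ 2) = 0" if "x \<in> frontier (interior \<Omega>)" for x
      using that unfolding O rectangle_topology(3)[OF ab] by auto
    show "\<bar>wave l f h x\<bar> \<le> (real m * w1 * (2 / (b - a))) * (real n * w2 * (2 / (d - c))) * (\<rho>1 (x $ 1) * \<rho>2 (x $ 2))"
      if "x \<in> interior \<Omega>" for x
    proof -
      have i: "a < x$1" "x$1 < b" "c < x$2" "x$2 < d" using that by (auto simp: interior_rect)
      have "\<bar>sin_prod a c p q x\<bar> \<le> ((real m * w1 * (2 / (b - a))) * \<rho>1 (x $ 1)) * ((real n * w2 * (2 / (d - c))) * \<rho>2 (x $ 2))"
        unfolding sin_prod_def abs_mult p_def q_def
        using abs_sin_multiple_le[OF ab(1) i(1,2), of m] abs_sin_multiple_le[OF ab(2) i(3,4), of n]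
        by (intro mult_mono) (use ab i in auto)
      then show ?thesis unfolding w(8) by (simp only: mult_ac)
    qed
  qed
  then show ?thesis unfolding w(3) w(8,9)[symmetric] p_def q_def prod.case .
qed

text \<open>Multiplying sine approximations in the two variables gives a double sum of
  eigenfunctions. Each partial derivative differentiates just one factor, so the one-dimensional C1
  estimates suffice.\<close>

lemma rectangle_tensor_approximable:
  assumes f: "\<And>t. (f has_real_derivative f' t) (at t)" "continuous_on UNIV f'" "f a = 0" "f b = 0"
    and g: "\<And>t. (g has_real_derivative g' t) (at t)" "continuous_on UNIV g'" "g c = 0" "g d = 0"
  shows "C1_approximable rect_index rect_grad (interior \<Omega>) (\<lambda>x. vector [f' (x $ 1) * g (x $ 2), f (x $ 1) * g' (x $ 2)])"
  unfolding C1_approximable_def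
proof (intro allI impI)
  fix \<epsilon> :: real assume e: "\<epsilon> > 0"
  have cf: "continuous_on UNIV f" "continuous_on UNIV g" using f g by (meson continuous_at_imp_continuous_on DERIV_isCont)+
  have bnd: "\<exists>B>0. \<forall>t\<in>{r..s}. \<bar>k t\<bar> \<le> B" if "continuous_on UNIV k" for k :: "real \<Rightarrow> real" and r s
  proof -
    have "bounded (k ` {r..s})" using that by (intro compact_imp_bounded compact_continuous_image) (auto intro: continuous_on_subset)
    then show ?thesis by (auto simp: bounded_pos)
  qed
  obtain B1 B2 B3 B4 where B: "B1 > 0" "B2 > 0" "B3 > 0" "B4 > 0"
    "\<forall>t\<in>{a..b}. \<bar>f t\<bar> \<le> B1" "\<forall>t\<in>{a..b}. \<bar>f' t\<bar> \<le> B2" "\<forall>t\<in>{c..d}. \<bar>g t\<bar> \<le> B3" "\<forall>t\<in>{c..d}. \<bar>g' t\<bar> \<le> B4"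
    using bnd[OF cf(1)] bnd[OF cf(2)] bnd[OF f(2)] bnd[OF g(2)] by metis
  define B where "B = B1 + B2 + B3 + B4 + 1"
  have Bp: "B > 0" using B by (simp add: B_def)
  have bB: "\<bar>f t\<bar> \<le> B" "\<bar>f' t\<bar> \<le> B" if "t \<in> {a..b}" for t using B(1-4) B(5,6) that unfolding B_def by fastforce+
  have gB: "\<bar>g t\<bar> \<le> B" "\<bar>g' t\<bar> \<le> B" if "t \<in> {c..d}" for t using B(1-4) B(7,8) that unfolding B_def by fastforce+
  \<comment> \<open>Each gradient component is off by at most \<open>(2 * B + 1) * \<delta>\<close>,
    and the norm by the sum of two components; the cap 1 bounds the approximants by
    \<open>B + 1\<close>.\<close>
  define \<delta> where "\<delta> = min 1 (\<epsilon> / (4 * B + 2))"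
  have dp: "\<delta> > 0" "\<delta> \<le> 1" "2 * (2 * B + 1) * \<delta> \<le> \<epsilon>"
  proof -
    show "\<delta> > 0" "\<delta> \<le> 1" using e Bp by (auto simp: \<delta>_def)
    have "(4 * B + 2) * \<delta> \<le> (4 * B + 2) * (\<epsilon> / (4 * B + 2))" using Bp by (intro mult_left_mono) (auto simp: \<delta>_def)
    also have "\<dots> = \<epsilon>" using Bp by simp
    finally show "2 * (2 * B + 1) * \<delta> \<le> \<epsilon>" by (simp add: algebra_simps)
  qed
  obtain N \<alpha> where S: "\<And>t. t \<in> {a..b} \<Longrightarrow> \<bar>f t - (\<Sum>k\<in>{1..N}. \<alpha> k * sin (real k * w1 * (t - a)))\<bar> \<le> \<delta>"
    "\<And>t. t \<in> {a..b} \<Longrightarrow> \<bar>f' t - (\<Sum>k\<in>{1..N}. \<alpha> k * ((real k * w1) * cos (real k * w1 * (t - a))))\<bar> \<le> \<delta>"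
    by (rule sine_C1_approx[OF ab(1) f dp(1)]) blast
  obtain M \<beta> where T: "\<And>t. t \<in> {c..d} \<Longrightarrow> \<bar>g t - (\<Sum>k\<in>{1..M}. \<beta> k * sin (real k * w2 * (t - c)))\<bar> \<le> \<delta>"
    "\<And>t. t \<in> {c..d} \<Longrightarrow> \<bar>g' t - (\<Sum>k\<in>{1..M}. \<beta> k * ((real k * w2) * cos (real k * w2 * (t - c))))\<bar> \<le> \<delta>"
    by (rule sine_C1_approx[OF ab(2) g dp(1)]) blast
  define s s' where "s t = (\<Sum>k\<in>{1..N}. \<alpha> k * sin (real k * w1 * (t - a)))"
    and "s' t = (\<Sum>k\<in>{1..N}. \<alpha> k * ((real k * w1) * cos (real k * w1 * (t - a))))" for t
  define r r' where "r t = (\<Sum>k\<in>{1..M}. \<beta> k * sin (real k * w2 * (t - c)))"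
    and "r' t = (\<Sum>k\<in>{1..M}. \<beta> k * ((real k * w2) * cos (real k * w2 * (t - c))))" for t
  have prod: "\<bar>u * v - u' * v'\<bar> \<le> (2 * B + 1) * \<delta>" if "\<bar>u\<bar> \<le> B" "\<bar>v\<bar> \<le> B" "\<bar>u - u'\<bar> \<le> \<delta>" "\<bar>v - v'\<bar> \<le> \<delta>" for u v u' v'
  proof -
    have "u * v - u' * v' = u * (v - v') + (u - u') * v'" by (simp add: algebra_simps)
    then have "\<bar>u * v - u' * v'\<bar> \<le> \<bar>u\<bar> * \<bar>v - v'\<bar> + \<bar>u - u'\<bar> * \<bar>v'\<bar>" by (metis abs_mult abs_triangle_ineq)
    also have "\<dots> \<le> B * \<delta> + \<delta> * (B + 1)" using that dp Bp by (intro add_mono mult_mono) auto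
    finally show ?thesis by (simp add: algebra_simps)
  qed
  define F where "F = {1..N} \<times> {1..M}"
  define cc where "cc = (\<lambda>(m, n). \<alpha> m * \<beta> n)"
  have sm: "(\<Sum>i\<in>F. cc i *\<^sub>R rect_grad i x) = vector [s' (x $ 1) * r (x $ 2), s (x $ 1) * r' (x $ 2)]" for x
  proof -
    have 1: "(\<Sum>i\<in>F. cc i *\<^sub>R rect_grad i x) $ 1 = s' (x $ 1) * r (x $ 2)"
      unfolding F_def s'_def r_def sum_product sum.cartesian_product sum_component cc_def
      by (rule sum.cong) (auto simp: sin_prod_grad_def mult_ac)
    have 2: "(\<Sum>i\<in>F. cc i *\<^sub>R rect_grad i x) $ 2 = s (x $ 1) * r' (x $ 2)"
      unfolding F_def s_def r'_def sum_product sum.cartesian_product sum_component cc_def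
      by (rule sum.cong) (auto simp: sin_prod_grad_def mult_ac)
    show ?thesis using 1 2 by (simp add: vec_eq_iff forall_2)
  qed
  have "norm (vector [f' (x $ 1) * g (x $ 2), f (x $ 1) * g' (x $ 2)] - (\<Sum>i\<in>F. cc i *\<^sub>R rect_grad i x)) \<le> \<epsilon>"
    if x: "x \<in> interior \<Omega>" for x
  proof -
    have i: "x $ 1 \<in> {a..b}" "x $ 2 \<in> {c..d}" using x by (auto simp: interior_rect)
    have "\<bar>f' (x $ 1) * g (x $ 2) - s' (x $ 1) * r (x $ 2)\<bar> \<le> (2 * B + 1) * \<delta>"
      by (rule prod) (use bB[OF i(1)] gB[OF i(2)] S(2)[OF i(1)] T(1)[OF i(2)] in \<open>auto simp: s'_def r_def\<close>)
    moreover have "\<bar>f (x $ 1) * g' (x $ 2) - s (x $ 1) * r' (x $ 2)\<bar> \<le> (2 * B + 1) * \<delta>"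
      by (rule prod) (use bB[OF i(1)] gB[OF i(2)] S(1)[OF i(1)] T(2)[OF i(2)] in \<open>auto simp: s_def r'_def\<close>)
    moreover have "norm (vector [f' (x $ 1) * g (x $ 2), f (x $ 1) * g' (x $ 2)] - vector [s' (x $ 1) * r (x $ 2), s (x $ 1) * r' (x $ 2)] :: real^2)
       \<le> \<bar>f' (x $ 1) * g (x $ 2) - s' (x $ 1) * r (x $ 2)\<bar> + \<bar>f (x $ 1) * g' (x $ 2) - s (x $ 1) * r' (x $ 2)\<bar>"
      by (rule order_trans[OF norm_vec2_le]) simp
    ultimately show ?thesis unfolding sm using dp(3) by linarith
  qed
  moreover have "finite F" "F \<subseteq> rect_index" by (auto simp: F_def)
  ultimately show "\<exists>F c. finite F \<and> F \<subseteq> rect_index \<and>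
     (\<forall>x\<in>interior \<Omega>. norm (vector [f' (x $ 1) * g (x $ 2), f (x $ 1) * g' (x $ 2)] - (\<Sum>i\<in>F. c i *\<^sub>R rect_grad i x)) \<le> \<epsilon>)"
    by blast
qed

text \<open>For a monomial the product with the defining function separates into
  \<open>\<rho>1 t * t ^ i\<close> and \<open>\<rho>2 t * t ^ j\<close>, each vanishing at both ends
  of its interval.\<close>

lemma rectangle_polys_approximable:
  assumes "q \<in> polys k"
  shows "\<exists>g. (\<forall>x. ((\<lambda>x. (\<rho>1 (x $ 1) * \<rho>2 (x $ 2)) * q x) has_derivative (\<lambda>h. g x \<bullet> h)) (at x)) \<and>
     C1_approximable rect_index rect_grad (interior \<Omega>) g"
  using assms
proof (induction q rule: polys_induct)
  case zero
  show ?case by (rule exI[of _ "\<lambda>x. 0"]) (use C1_approximable_combination[of "{}" rect_index rect_grad] in simp)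
next
  case (step \<gamma> i j r)
  then obtain g where g: "\<And>x. ((\<lambda>x. (\<rho>1 (x $ 1) * \<rho>2 (x $ 2)) * r x) has_derivative (\<lambda>h. g x \<bullet> h)) (at x)"
    "C1_approximable rect_index rect_grad (interior \<Omega>) g" by blast
  define f where "f t = \<rho>1 t * t ^ i" for t
  define f' where "f' t = \<rho>1 t * (real i * t ^ (i - 1)) + (b + a - 2 * t) * t ^ i" for t
  define h where "h t = \<rho>2 t * t ^ j" for t
  define h' where "h' t = \<rho>2 t * (real j * t ^ (j - 1)) + (d + c - 2 * t) * t ^ j" for t
  have df: "(f has_real_derivative f' t) (at t)" for t
    unfolding f_def[abs_def] f'_def
    using DERIV_mult[OF has_real_derivative_rho[of a b t] DERIV_pow[of i t]] by (simp add: add.commute mult.commute)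
  have dh: "(h has_real_derivative h' t) (at t)" for t
    unfolding h_def[abs_def] h'_def
    using DERIV_mult[OF has_real_derivative_rho[of c d t] DERIV_pow[of j t]] by (simp add: add.commute mult.commute)
  define w where "w x = (vector [f' (x $ 1) * h (x $ 2), f (x $ 1) * h' (x $ 2)] :: real^2)" for x :: "real^2"
  have "C1_approximable rect_index rect_grad (interior \<Omega>) w"
    unfolding w_def
    by (rule rectangle_tensor_approximable[OF df _ _ _ dh]) (auto simp: f_def h_def f'_def h'_def intro!: continuous_intros)
  then have A: "C1_approximable rect_index rect_grad (interior \<Omega>) (\<lambda>x. \<gamma> *\<^sub>R w x + g x)"
    by (intro C1_approximable_add C1_approximable_scaleR g(2))
  have "((\<lambda>x. \<gamma> * (f (x $ 1) * h (x $ 2)) + (\<rho>1 (x $ 1) * \<rho>2 (x $ 2)) * r x) has_derivative (\<lambda>y. (\<gamma> *\<^sub>R w x + g x) \<bullet> y)) (at x)" for x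
    unfolding w_def by (intro has_gradient_add has_gradient_cmult has_gradient_tensor g(1) df dh)
  moreover have "(\<lambda>x::real^2. \<gamma> * (f (x $ 1) * h (x $ 2)) + (\<rho>1 (x $ 1) * \<rho>2 (x $ 2)) * r x)
     = (\<lambda>x. (\<rho>1 (x $ 1) * \<rho>2 (x $ 2)) * (\<gamma> * (x $ 1 ^ i * x $ 2 ^ j) + r x))"
    by (auto simp: fun_eq_iff f_def h_def distrib_left mult_ac)
  ultimately show ?case using A by (intro exI[of _ "\<lambda>x. \<gamma> *\<^sub>R w x + g x"]) simp
qed

lemma rectangle_dense:
  assumes t: "test_fun (interior \<Omega>) \<phi> d\<phi>"
  shows "C1_approximable rect_index rect_grad (interior \<Omega>) d\<phi>"
proof (rule C1_approximable_limit)
  fix \<epsilon> :: real assume e: "\<epsilon> > 0"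
  define \<rho> where "\<rho> x = \<rho>1 (x $ 1) * \<rho>2 (x $ 2)" for x :: "real^2"
  define d\<rho> where "d\<rho> x = (vector [(b + a - 2 * x $ 1) * \<rho>2 (x $ 2), \<rho>1 (x $ 1) * (d + c - 2 * x $ 2)] :: real^2)" for x :: "real^2"
  have dr: "(\<rho> has_derivative (\<lambda>h. d\<rho> x \<bullet> h)) (at x)" for x
    unfolding d\<rho>_def \<rho>_def[abs_def] by (rule rectangle_rho_has_gradient)
  have "bounded \<Omega>" unfolding O by (intro compact_imp_bounded rectangle_topology ab)
  then have bi: "bounded (interior \<Omega>)" by (rule bounded_interior)
  have cr: "continuous_on UNIV d\<rho>" unfolding d\<rho>_def by (intro continuous_on_vector2 continuous_intros)
  have pos: "0 < \<rho> x" if "x \<in> interior \<Omega>" for x using that by (simp add: interior_rect \<rho>_def)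
  obtain q dq where q: "real_polynomial_function q" "\<And>x. (q has_derivative (\<lambda>h. dq x \<bullet> h)) (at x)"
    "\<And>x. x \<in> interior \<Omega> \<Longrightarrow> norm (d\<phi> x - (\<rho> x *\<^sub>R dq x + q x *\<^sub>R d\<rho> x)) \<le> \<epsilon>"
    using test_fun_C1_approx_with_factor[OF t open_interior bi dr cr pos e] by blast
  obtain k where "q \<in> polys k" using real_polynomial_function_in_polys[OF q(1)] by blast
  then obtain g where g: "\<And>x. ((\<lambda>x. \<rho> x * q x) has_derivative (\<lambda>h. g x \<bullet> h)) (at x)"
     "C1_approximable rect_index rect_grad (interior \<Omega>) g"
    using rectangle_polys_approximable unfolding \<rho>_def by blast
  have "\<rho> x *\<^sub>R dq x + q x *\<^sub>R d\<rho> x = g x" for x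
    by (rule gradient_unique[OF has_gradient_mult[OF dr q(2)] g(1)])
  then show "\<exists>v. C1_approximable rect_index rect_grad (interior \<Omega>) v \<and> (\<forall>x\<in>interior \<Omega>. norm (d\<phi> x - v x) \<le> \<epsilon>)"
    using q(3) g(2) by auto
qed

end

theorem rectangle_spectrum:
  assumes "is_axis_rectangle \<Omega>"
  shows "P_pure_point \<Omega> \<and>
         closure (P_eigenvalues \<Omega>) = {0..1} \<and> P_eigenvalues \<Omega> \<subseteq> {0..1} \<and>
         P_eigenvalues \<Omega> = {l\<^sup>2 | l. 0 < l \<and> l < 1 \<and> rotation_number \<Omega> l \<in> \<rat>}"
proof -
  obtain a b c d where ab: "a < b" "c < d" and O: "\<Omega> = {x. a \<le> x$1 \<and> x$1 \<le> b \<and> c \<le> x$2 \<and> x$2 \<le> d}"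
    using assms by (auto simp: is_axis_rectangle_def)
  define w1 w2 where "w1 = pi / (b - a)" and "w2 = pi / (d - c)"
  have w: "w1 > 0" "w2 > 0" using ab by (auto simp: w1_def w2_def)
  \<comment> \<open>The aspect ratio in the billiard criterion is the quotient of the two basic
    frequencies, so billiard and eigenvalues lead to the same rationality condition.\<close>
  have wr: "(b - a) / (d - c) = w2 / w1" using ab by (simp add: w1_def w2_def)
  define I where "I = ({1..} \<times> {1..} :: (nat \<times> nat) set)"
  define slope where "slope = (\<lambda>(m, n). (real m * w1) / (real n * w2))"
  define T where "T = slope ` I"
  define E where "E = (\<lambda>t::real. 1 / (1 + t\<^sup>2))"
  have "compact \<Omega>" unfolding O by (rule rectangle_topology[OF ab])
  then have bd: "bounded \<Omega>" by (rule compact_imp_bounded)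
  have *: "P_pure_point \<Omega> \<and> P_eigenvalues \<Omega> = (\<lambda>i. E (slope i)) ` I"
  proof (rule complete_eigenvector_family_uniform[OF bd, where u="\<lambda>(m, n). sin_prod a c (real m * w1) (real n * w2)"
        and du="\<lambda>(m, n). sin_prod_grad a c (real m * w1) (real n * w2)"])
    fix i assume i: "i \<in> I"
    obtain m n where mn: "i = (m, n)" by (cases i)
    show "P_eigvec \<Omega> (E (slope i)) (\<lambda>x. if x \<in> interior \<Omega> then (case i of (m, n) \<Rightarrow> sin_prod a c (real m * w1) (real n * w2)) x else 0)
        (\<lambda>x. if x \<in> interior \<Omega> then (case i of (m, n) \<Rightarrow> sin_prod_grad a c (real m * w1) (real n * w2)) x else 0)"
      using rectangle_P_eigvec[OF ab O i[unfolded I_def mn]] unfolding mn E_def slope_def w1_def w2_def prod.case .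
  next
    fix \<phi> d\<phi> and \<epsilon> :: real assume "test_fun (interior \<Omega>) \<phi> d\<phi>" "\<epsilon> > 0"
    then show "\<exists>F c'. finite F \<and> F \<subseteq> I \<and> (\<forall>x\<in>interior \<Omega>. norm (d\<phi> x - (\<Sum>i\<in>F. c' i *\<^sub>R (case i of (m, n) \<Rightarrow> sin_prod_grad a c (real m * w1) (real n * w2)) x)) \<le> \<epsilon>)"
      using rectangle_dense[OF ab O] unfolding C1_approximable_def I_def w1_def w2_def by blast
  qed
  have Tpos: "T \<subseteq> {0<..}" using w by (auto simp: T_def slope_def I_def)
  have Tchar: "t \<in> T \<longleftrightarrow> t * (w2 / w1) \<in> \<rat>" if "t > 0" for t
  proof
    assume "t \<in> T"
    then obtain m n where "t = (real m * w1) / (real n * w2)" "n \<ge> 1" by (auto simp: T_def slope_def I_def)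
    then have "t * (w2 / w1) = real m / real n" using w by simp
    then show "t * (w2 / w1) \<in> \<rat>" by simp
  next
    assume "t * (w2 / w1) \<in> \<rat>"
    then obtain m n :: nat where mn: "n \<noteq> 0" "\<bar>t * (w2 / w1)\<bar> = real m / real n" by (metis Rats_abs_nat_div_natE)
    have pos: "t * (w2 / w1) > 0" using that w by simp
    have e: "t * (w2 / w1) = real m / real n" by (rule mn(2)[unfolded abs_of_pos[OF pos]])
    have "m \<noteq> 0" using pos unfolding e by (intro notI) simp
    moreover have "t = slope (m, n)" using e w mn(1) by (simp add: slope_def field_simps)
    ultimately show "t \<in> T" using mn(1) by (auto simp: T_def I_def)
  qed
  have rn: "rotation_number \<Omega> l \<in> \<rat> \<longleftrightarrow> sqrt (1 - l\<^sup>2) / l \<in> T" if "0 < l" "l < 1" for l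
    using rectangle_rotation_number[OF ab that O] Tchar[OF slope_of_parameter(1)[OF that]] by (simp add: wr mult.commute)
  show ?thesis
  proof (rule spectrum_from_slopes[OF _ _ Tpos _ rn])
    show "P_pure_point \<Omega>" "P_eigenvalues \<Omega> = (\<lambda>t. 1 / (1 + t\<^sup>2)) ` T" using * by (auto simp: T_def E_def image_image)
    fix x y :: real assume xy: "0 < x" "x < y"
    then have "x * (w2 / w1) < y * (w2 / w1)" using w by (intro mult_strict_right_mono) auto
    then obtain r where r: "r \<in> \<rat>" "x * (w2 / w1) < r" "r < y * (w2 / w1)" using Rats_dense_in_real by blast
    define t where "t = r * (w1 / w2)"
    have tr: "t * (w2 / w1) = r" using w by (simp add: t_def)
    have "x < t" "t < y" using r w by (auto simp: t_def field_simps)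
    moreover have "t \<in> T" using Tchar[of t] xy \<open>x < t\<close> r(1) tr by simp
    ultimately show "\<exists>t\<in>T. x < t \<and> t < y" by blast
  qed
qed

section \<open>Chebyshev polynomials and polynomials vanishing on the circle\<close>

fun cheb :: "nat \<Rightarrow> real poly" where
  "cheb 0 = 1"
| "cheb (Suc 0) = [:0, 1:]"
| "cheb (Suc (Suc n)) = [:0, 2:] * cheb (Suc n) - cheb n"

lemma poly_cheb_cos: "poly (cheb n) (cos \<theta>) = cos (real n * \<theta>)"
proof (induction n rule: cheb.induct)
  case (3 n)
  have e: "real (Suc (Suc n)) * \<theta> = real (Suc n) * \<theta> + \<theta>" "real n * \<theta> = real (Suc n) * \<theta> - \<theta>"
    by (auto simp: algebra_simps)
  show ?case using 3 unfolding e by (simp add: cos_add cos_diff)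
qed auto

text \<open>A degree bound alone would not exclude cancellation in the recurrence, so positivity of
  the leading coefficient is carried along.\<close>

lemma degree_cheb: "degree (cheb n) = n"
proof -
  have "degree (cheb n) \<le> n \<and> coeff (cheb n) n > 0"
  proof (induction n rule: cheb.induct)
    case (3 n)
    have "degree ([:0, 2:] * cheb (Suc n)) \<le> Suc (Suc n)"
      using degree_mult_le[of "[:0, 2:]" "cheb (Suc n)"] 3 by simp
    then have "degree (cheb (Suc (Suc n))) \<le> Suc (Suc n)" using 3 by (simp add: degree_diff_le)
    moreover have "coeff (cheb n) (Suc (Suc n)) = 0" using 3 by (intro coeff_eq_0) simp
    then have "coeff (cheb (Suc (Suc n))) (Suc (Suc n)) = 2 * coeff (cheb (Suc n)) (Suc n)"
      by (simp add: coeff_pCons)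
    ultimately show ?case using 3 by simp
  qed auto
  then show ?thesis by (metis le_antisym le_degree less_irrefl)
qed

text \<open>The nonzero term with the largest index has the largest degree, and its leading
  coefficient cannot cancel.\<close>

lemma sum_distinct_degrees_eq_0:
  fixes p :: "nat \<Rightarrow> real poly"
  assumes "finite N" "\<And>n. n \<in> N \<Longrightarrow> p n \<noteq> 0" "\<And>m n. m \<in> N \<Longrightarrow> n \<in> N \<Longrightarrow> m < n \<Longrightarrow> degree (p m) < degree (p n)"
    and z: "(\<Sum>n\<in>N. smult (c n) (p n)) = 0" and n: "n \<in> N"
  shows "c n = 0"
proof (rule ccontr)
  assume "c n \<noteq> 0"
  define Z where "Z = {n \<in> N. c n \<noteq> 0}"
  have Z: "finite Z" "Z \<noteq> {}" using assms(1) n \<open>c n \<noteq> 0\<close> by (auto simp: Z_def)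
  define m where "m = Max Z"
  have m: "m \<in> N" "c m \<noteq> 0" using Max_in[OF Z] by (auto simp: m_def Z_def)
  have "coeff (\<Sum>n\<in>N. smult (c n) (p n)) (degree (p m)) = (\<Sum>n\<in>N. c n * coeff (p n) (degree (p m)))"
    by (simp add: coeff_sum)
  also have "\<dots> = (\<Sum>n\<in>{m}. c n * coeff (p n) (degree (p m)))"
  proof (rule sum.mono_neutral_right)
    show "\<forall>k\<in>N - {m}. c k * coeff (p k) (degree (p m)) = 0"
    proof
      fix k assume k: "k \<in> N - {m}"
      show "c k * coeff (p k) (degree (p m)) = 0"
      proof (cases "c k = 0")
        case False
        then have "k \<le> m" using Max_ge[OF Z(1), of k] k by (auto simp: m_def Z_def)
        then have "degree (p k) < degree (p m)" using assms(3)[of k m] k m by auto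
        then show ?thesis by (simp add: coeff_eq_0)
      qed simp
    qed
  qed (use assms(1) m in auto)
  also have "\<dots> = c m * lead_coeff (p m)" by simp
  finally show False using z m assms(2)[OF m(1)] by simp
qed

lemma poly_eq_0_on_open_interval:
  fixes p :: "real poly"
  assumes "\<And>s. -1 < s \<Longrightarrow> s < 1 \<Longrightarrow> poly p s = 0"
  shows "p = 0"
proof (rule ccontr)
  assume "p \<noteq> 0"
  then have "finite {s. poly p s = 0}" by (rule poly_roots_finite)
  moreover have "{-1<..<1} \<subseteq> {s. poly p s = 0}" using assms by auto
  ultimately have "finite {-1<..<1::real}" by (rule rev_finite_subset)
  then show False using infinite_Ioo[of "-1::real" 1] by simp
qed

lemma polys_sum: "finite A \<Longrightarrow> (\<And>a. a \<in> A \<Longrightarrow> f a \<in> polys d) \<Longrightarrow> (\<lambda>x. \<Sum>a\<in>A. f a x) \<in> polys d"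
  by (induction A rule: finite_induct) (auto simp: polys_zero polys_add)

lemma polys_poly:
  assumes "degree p \<le> n"
  shows "(\<lambda>x. poly p (a * x $ 1 + b * x $ 2)) \<in> polys (int n)"
proof -
  have "(\<lambda>x. \<Sum>i\<le>degree p. coeff p i * (a * x $ 1 + b * x $ 2) ^ i) \<in> polys (int n)"
  proof (rule polys_sum)
    fix i assume "i \<in> {..degree p}"
    then have "int i \<le> int n" using assms by simp
    then show "(\<lambda>x. coeff p i * (a * x $ 1 + b * x $ 2) ^ i) \<in> polys (int n)"
      using polys_scale[OF polys_power[OF polys_linear[of 1 a b]], of "coeff p i" i] polys_mono[of "int i" "int n"] by auto
  qed simp
  then show ?thesis by (simp add: poly_altdef)
qed

section \<open>Division by the defining function of the disk\<close>

definition disk_rho :: "real^2 \<Rightarrow> real" where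
  "disk_rho x = 1 - ((x $ 1)\<^sup>2 + (x $ 2)\<^sup>2)"

text \<open>Every factor \<open>(x $ 2)\<^sup>2\<close> is replaced by
  \<open>1 - (x $ 1)\<^sup>2 - disk_rho x\<close>, which leaves a remainder of degree at most one in
  \<open>x $ 2\<close>. The quotient loses two degrees, a fact on which the dimension count
  rests.\<close>

lemma monomial_mod_disk_rho:
  "\<exists>r\<in>polys (int (i + j) - 2). \<exists>b c :: real poly. \<forall>x :: real^2.
     x $ 1 ^ i * x $ 2 ^ j = disk_rho x * r x + poly b (x $ 1) + x $ 2 * poly c (x $ 1)"
proof (induction j rule: less_induct)
  case (less j)
  consider "j = 0" | "j = 1" | k where "j = k + 2" by (metis One_nat_def add_2_eq_Suc' not0_implies_Suc)
  then show ?case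
  proof cases
    case 1
    have "x $ 1 ^ i * x $ 2 ^ j = disk_rho x * 0 + poly (monom 1 i) (x $ 1) + x $ 2 * poly 0 (x $ 1)" for x :: "real^2"
      by (simp add: 1 poly_monom)
    then show ?thesis using polys_zero[of "int (i + j) - 2"] by (intro bexI[of _ "\<lambda>x. 0"] exI[of _ "monom 1 i"] exI[of _ 0]) auto
  next
    case 2
    have "x $ 1 ^ i * x $ 2 ^ j = disk_rho x * 0 + poly 0 (x $ 1) + x $ 2 * poly (monom 1 i) (x $ 1)" for x :: "real^2"
      by (simp add: 2 poly_monom)
    then show ?thesis using polys_zero[of "int (i + j) - 2"] by (intro bexI[of _ "\<lambda>x. 0"] exI[of _ 0] exI[of _ "monom 1 i"]) auto
  next
    case 3
    obtain r b c where r: "r \<in> polys (int (i + k) - 2)" and rk: "\<And>x. x $ 1 ^ i * x $ 2 ^ k = disk_rho x * r x + poly b (x $ 1) + x $ 2 * poly c (x $ 1)"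
      using less.IH[of k] 3 by auto
    define r' where "r' x = (-1) * (x $ 1 ^ i * x $ 2 ^ k) + (1 - (x $ 1)\<^sup>2) * r x" for x :: "real^2"
    have "(\<lambda>x. 1 + (-1) * (x $ 1 ^ 2 * x $ 2 ^ 0)) \<in> polys 2"
      by (intro polys_add polys_const polys_scale polys_monomial) auto
    then have p2: "(\<lambda>x. 1 - (x $ 1)\<^sup>2) \<in> polys 2" by simp
    have e: "2 + (int (i + k) - 2) = int (i + j) - 2" using 3 by simp
    have "r' \<in> polys (int (i + j) - 2)" unfolding r'_def
      by (intro polys_add polys_scale polys_monomial polys_mult[OF p2 r, unfolded e]) (use 3 in simp)
    moreover have "x $ 1 ^ i * x $ 2 ^ j = disk_rho x * r' x + poly ([:1, 0, -1:] * b) (x $ 1) + x $ 2 * poly ([:1, 0, -1:] * c) (x $ 1)" for x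
    proof -
      have y2: "(x $ 2)\<^sup>2 = 1 - (x $ 1)\<^sup>2 - disk_rho x" by (simp add: disk_rho_def)
      have "x $ 1 ^ i * x $ 2 ^ j = (x $ 1 ^ i * x $ 2 ^ k) * (x $ 2)\<^sup>2" by (simp add: 3 power_add power2_eq_square)
      also have "\<dots> = disk_rho x * ((-1) * (x $ 1 ^ i * x $ 2 ^ k)) + (1 - (x $ 1)\<^sup>2) * (x $ 1 ^ i * x $ 2 ^ k)"
        unfolding y2 by (simp add: algebra_simps)
      also have "(1 - (x $ 1)\<^sup>2) * (x $ 1 ^ i * x $ 2 ^ k) = (1 - (x $ 1)\<^sup>2) * (disk_rho x * r x + poly b (x $ 1) + x $ 2 * poly c (x $ 1))"
        unfolding rk ..
      finally show ?thesis by (simp add: r'_def algebra_simps power2_eq_square)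
    qed
    ultimately show ?thesis by blast
  qed
qed

lemma polys_mod_disk_rho:
  assumes "q \<in> polys d"
  shows "\<exists>r\<in>polys (d - 2). \<exists>b c :: real poly. \<forall>x. q x = disk_rho x * r x + poly b (x $ 1) + x $ 2 * poly c (x $ 1)"
  using assms
proof (induction q rule: polys_induct)
  case zero
  show ?case by (intro bexI[of _ "\<lambda>x. 0"] exI[of _ 0]) (auto simp: polys_zero)
next
  case (step \<gamma> i j q)
  obtain r b c where r: "r \<in> polys (d - 2)" "\<And>x. q x = disk_rho x * r x + poly b (x $ 1) + x $ 2 * poly c (x $ 1)"
    using step.IH by blast
  obtain r' b' c' where r': "r' \<in> polys (int (i + j) - 2)" "\<And>x. x $ 1 ^ i * x $ 2 ^ j = disk_rho x * r' x + poly b' (x $ 1) + x $ 2 * poly c' (x $ 1)"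
    using monomial_mod_disk_rho[of i j] by blast
  have "r' \<in> polys (d - 2)" using r'(1) step.hyps(1) polys_mono[of "int (i + j) - 2" "d - 2"] by auto
  then have "(\<lambda>x. \<gamma> * r' x + r x) \<in> polys (d - 2)" by (intro polys_add polys_scale r(1))
  moreover have "\<gamma> * (x $ 1 ^ i * x $ 2 ^ j) + q x = disk_rho x * (\<gamma> * r' x + r x) + poly (smult \<gamma> b' + b) (x $ 1) + x $ 2 * poly (smult \<gamma> c' + c) (x $ 1)" for x
    unfolding r(2) r'(2) by (simp add: algebra_simps)
  ultimately show ?case by (intro bexI[of _ "\<lambda>x. \<gamma> * r' x + r x"] exI[of _ "smult \<gamma> b' + b"] exI[of _ "smult \<gamma> c' + c"]) auto
qed

text \<open>At the circle points \<open>(s, y)\<close> and \<open>(s, -y)\<close> the remainder is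
  \<open>b + y c\<close> and \<open>b - y c\<close>; with \<open>y \<noteq> 0\<close> both
  polynomials vanish on an interval and hence identically.\<close>

lemma polys_vanishing_on_circle:
  assumes "q \<in> polys d" and z: "\<And>x. norm x = 1 \<Longrightarrow> q x = 0"
  obtains r where "r \<in> polys (d - 2)" "\<And>x. q x = disk_rho x * r x"
proof -
  obtain r b c where r: "r \<in> polys (d - 2)" and e: "\<And>x. q x = disk_rho x * r x + poly b (x $ 1) + x $ 2 * poly c (x $ 1)"
    using polys_mod_disk_rho[OF assms(1)] by blast
  have bc: "poly b s = 0 \<and> poly c s = 0" if "-1 < s" "s < 1" for s
  proof -
    define y where "y = sqrt (1 - s\<^sup>2)"
    have "s\<^sup>2 < 1" using that by (simp add: abs_square_less_1 abs_less_iff)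
    then have y: "y > 0" "y\<^sup>2 = 1 - s\<^sup>2" by (auto simp: y_def)
    have "poly b s + t * poly c s = 0" if t: "t\<^sup>2 = 1 - s\<^sup>2" for t
    proof -
      have n: "norm (vector [s, t] :: real^2) = 1" using t by (simp add: norm_vec_def L2_set_def sum_2)
      have "disk_rho (vector [s, t]) = 0" using t by (simp add: disk_rho_def)
      then show ?thesis using e[of "vector [s, t]"] z[OF n] by simp
    qed
    from this[of y] this[of "- y"] y have "poly b s + y * poly c s = 0" "poly b s - y * poly c s = 0" by auto
    then have "poly b s = 0" "y * poly c s = 0" by linarith+
    then show ?thesis using y by simp
  qed
  then have "b = 0" "c = 0" using poly_eq_0_on_open_interval by blast+
  then show ?thesis using that[OF r] e by simp
qed

section \<open>Exchange argument for the dimension count\<close>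

lemma fun_sum_apply: "(\<Sum>i\<in>A. f i) x = (\<Sum>i\<in>A. (f i :: 'a \<Rightarrow> 'b::comm_monoid_add) x)"
  by (induction A rule: infinite_finite_induct) auto

text \<open>There are as many independent vectors \<open>b\<close> as generators \<open>a\<close>:
  if some \<open>a j\<close> were outside their span, adding it would give more independent vectors
  than generators.\<close>

lemma span_exchange:
  fixes a b :: "'i \<Rightarrow> real^2 \<Rightarrow> real"
  assumes J: "finite J" and sub: "\<And>j. j \<in> J \<Longrightarrow> b j \<in> fun_vs.span (a ` J)"
    and ind: "\<And>c. (\<And>x. (\<Sum>j\<in>J. c j * b j x) = 0) \<Longrightarrow> \<forall>j\<in>J. c j = 0"
    and j: "j \<in> J"
  shows "a j \<in> fun_vs.span (b ` J)"
proof -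
  \<comment> \<open>Independence is assumed for the family but used for its image, and a repeated
    vector would be lost there.\<close>
  have inj: "inj_on b J"
  proof (rule inj_onI, rule ccontr)
    fix i k assume ik: "i \<in> J" "k \<in> J" "b i = b k" "i \<noteq> k"
    define c where "c l = (if l = i then 1 else if l = k then -1 else (0::real))" for l
    have "(\<Sum>j\<in>J. c j * b j x) = 0" for x
    proof -
      have "(\<Sum>j\<in>J. c j * b j x) = (\<Sum>j\<in>{i, k}. c j * b j x)"
        by (rule sum.mono_neutral_right) (use J ik in \<open>auto simp: c_def\<close>)
      then show ?thesis using ik by (simp add: c_def)
    qed
    then have "c i = 0" using ind ik by blast
    then show False by (simp add: c_def)
  qed
  have indep: "fun_vs.independent (b ` J)"
  proof (rule fun_vs.independent_if_scalars_zero)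
    fix f x assume s: "(\<Sum>x\<in>b ` J. (\<lambda>y. f x * x y)) = 0" and x: "x \<in> b ` J"
    then obtain k where k: "k \<in> J" "x = b k" by blast
    have "(\<Sum>j\<in>J. f (b j) * b j y) = 0" for y
    proof -
      have "(\<Sum>j\<in>J. f (b j) * b j y) = (\<Sum>x\<in>b ` J. (\<lambda>y. f x * x y)) y"
        by (simp add: fun_sum_apply sum.reindex[OF inj])
      then show ?thesis unfolding s by simp
    qed
    then show "f x = 0" using ind[of "\<lambda>j. f (b j)"] k by blast
  qed (use J in simp)
  show ?thesis
  proof (rule ccontr)
    assume na: "a j \<notin> fun_vs.span (b ` J)"
    have "fun_vs.independent (insert (a j) (b ` J))" using fun_vs.independent_insertI[OF na indep] .
    moreover have "insert (a j) (b ` J) \<subseteq> fun_vs.span (a ` J)" using sub j by (auto intro: fun_vs.span_base)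
    ultimately have "card (insert (a j) (b ` J)) \<le> card (a ` J)"
      using fun_vs.independent_span_bound[of "a ` J" "insert (a j) (b ` J)"] J by auto
    moreover have "a j \<notin> b ` J" using na fun_vs.span_base by blast
    then have "card (insert (a j) (b ` J)) = Suc (card J)" using J inj by (simp add: card_image)
    ultimately show False using card_image_le[OF J, of a] by simp
  qed
qed

section \<open>The spectrum of an ellipse\<close>

text \<open>\<open>q\<close> is the cotangent of the angle from \<open>P\<close> to
  \<open>Q\<close>. The positive cross product puts that angle into (0, pi), where the inverse
  cotangent is \<open>pi / 2 - arctan q\<close>, so no ambiguity modulo \<open>pi\<close>
  remains.\<close>

lemma polar_pair:
  fixes P Q :: "real^2"
  assumes cr: "P $ 1 * Q $ 2 - P $ 2 * Q $ 1 = D" "D > 0" and dot: "P $ 1 * Q $ 1 + P $ 2 * Q $ 2 = D * q"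
  obtains \<alpha> r s where "r > 0" "s > 0" "P $ 1 = r * cos \<alpha>" "P $ 2 = r * sin \<alpha>"
    "Q $ 1 = s * cos (\<alpha> + (pi / 2 - arctan q))" "Q $ 2 = s * sin (\<alpha> + (pi / 2 - arctan q))"
proof -
  define r where "r = sqrt ((P $ 1)\<^sup>2 + (P $ 2)\<^sup>2)"
  have "(P $ 1)\<^sup>2 + (P $ 2)\<^sup>2 \<noteq> 0"
    using cr by (auto simp: sum_power2_eq_zero_iff)
  then have "(P $ 1)\<^sup>2 + (P $ 2)\<^sup>2 > 0" by (simp add: sum_power2_gt_zero_iff)
  then have r: "r > 0" "r\<^sup>2 = (P $ 1)\<^sup>2 + (P $ 2)\<^sup>2" by (auto simp: r_def)
  have "(P $ 1 / r)\<^sup>2 + (P $ 2 / r)\<^sup>2 = ((P $ 1)\<^sup>2 + (P $ 2)\<^sup>2) / r\<^sup>2" by (simp add: power_divide add_divide_distrib)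
  also have "\<dots> = 1" unfolding r(2)[symmetric] using r(1) by simp
  finally have "(P $ 1 / r)\<^sup>2 + (P $ 2 / r)\<^sup>2 = 1" .
  then obtain \<alpha> where \<alpha>: "P $ 1 / r = cos \<alpha>" "P $ 2 / r = sin \<alpha>" using sincos_total_2pi by metis
  then have P: "P $ 1 = r * cos \<alpha>" "P $ 2 = r * sin \<alpha>" using r(1) by (auto simp: field_simps)
  \<comment> \<open>\<open>1 / k\<close> is the sine of the angle; since \<open>D\<close> is the
    product of both lengths and this sine, the length of \<open>Q\<close> is
    \<open>D * k / r\<close>.\<close>
  define k where "k = sqrt (1 + q\<^sup>2)"
  have k: "k > 0" by (simp add: k_def add_pos_nonneg)
  have ct: "cos (pi / 2 - arctan q) = q / k" "sin (pi / 2 - arctan q) = 1 / k"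
    by (simp_all add: cos_diff sin_diff k_def sin_arctan cos_arctan)
  have D: "D = r * (cos \<alpha> * Q $ 2 - sin \<alpha> * Q $ 1)" using cr(1) P by (simp add: algebra_simps)
  have Dq: "D * q = r * (cos \<alpha> * Q $ 1 + sin \<alpha> * Q $ 2)" using dot P by (simp add: algebra_simps)
  have Dr: "D / r = cos \<alpha> * Q $ 2 - sin \<alpha> * Q $ 1" using r(1) unfolding D by simp
  have Dqr: "D * q / r = cos \<alpha> * Q $ 1 + sin \<alpha> * Q $ 2" using r(1) unfolding Dq by simp
  have Dq2: "(cos \<alpha> * Q $ 2 - sin \<alpha> * Q $ 1) * q = cos \<alpha> * Q $ 1 + sin \<alpha> * Q $ 2"
    unfolding Dr[symmetric] Dqr[symmetric] by simp
  have cs: "cos \<alpha> * cos \<alpha> + sin \<alpha> * sin \<alpha> = 1" using sin_cos_squared_add3 .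
  have "D * k / r * cos (\<alpha> + (pi / 2 - arctan q)) = (D * q * cos \<alpha> - D * sin \<alpha>) / r"
    unfolding cos_add ct using k r(1) by (simp add: field_simps)
  also have "\<dots> = (cos \<alpha> * Q $ 1 + sin \<alpha> * Q $ 2) * cos \<alpha> - (cos \<alpha> * Q $ 2 - sin \<alpha> * Q $ 1) * sin \<alpha>"
    by (simp only: diff_divide_distrib Dr Dq2 times_divide_eq_left[symmetric])
  also have "\<dots> = Q $ 1 * (cos \<alpha> * cos \<alpha> + sin \<alpha> * sin \<alpha>)" by (simp only: algebra_simps)
  finally have q1: "Q $ 1 = D * k / r * cos (\<alpha> + (pi / 2 - arctan q))" unfolding cs by simp
  have "D * k / r * sin (\<alpha> + (pi / 2 - arctan q)) = (D * q * sin \<alpha> + D * cos \<alpha>) / r"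
    unfolding sin_add ct using k r(1) by (simp add: field_simps)
  also have "\<dots> = (cos \<alpha> * Q $ 1 + sin \<alpha> * Q $ 2) * sin \<alpha> + (cos \<alpha> * Q $ 2 - sin \<alpha> * Q $ 1) * cos \<alpha>"
    by (simp only: add_divide_distrib Dr Dq2 times_divide_eq_left[symmetric])
  also have "\<dots> = Q $ 2 * (cos \<alpha> * cos \<alpha> + sin \<alpha> * sin \<alpha>)" by (simp only: algebra_simps)
  finally have q2: "Q $ 2 = D * k / r * sin (\<alpha> + (pi / 2 - arctan q))" unfolding cs by simp
  have "D * k / r > 0" using cr(2) k r(1) by simp
  then show ?thesis using that[OF r(1) _ P q1 q2] by blast
qed

lemma continuous_on_polys: "q \<in> polys d \<Longrightarrow> continuous_on S q"
proof (induction q rule: polys_induct)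
  case (step c i j r)
  then show ?case by (intro continuous_intros) auto
qed auto

lemma norm_vec2_sq: "(norm (x::real^2))\<^sup>2 = (x $ 1)\<^sup>2 + (x $ 2)\<^sup>2"
  unfolding power2_norm_eq_inner inner_vec_def sum_2 by (simp add: power2_eq_square)

lemma disk_rho_eq: "disk_rho x = 1 - (norm x)\<^sup>2"
  by (simp add: disk_rho_def norm_vec2_sq)

section \<open>The affine chart from the ellipse to the unit disk\<close>

context
  fixes A :: "real^2^2" and v :: "real^2" and \<Omega> :: "(real^2) set"
  assumes dA: "det A > 0" and O: "\<Omega> = (\<lambda>x. A *v x + v) ` cball 0 1"
begin

definition "chart y = matrix_inv A *v (y - v)"

lemma chart_inverse: "chart (A *v x + v) = x" "A *v chart y + v = y"
proof -
  have "invertible A" using dA by (simp add: invertible_det_nz)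
  then have "A ** matrix_inv A = mat 1 \<and> matrix_inv A ** A = mat 1"
    unfolding invertible_def matrix_inv_def by (rule someI_ex)
  then show "chart (A *v x + v) = x" "A *v chart y + v = y"
    by (auto simp: chart_def matrix_vector_mul_assoc)
qed

lemma chart_image: "(\<lambda>x. A *v x + v) ` S = {y. chart y \<in> S}"
proof (rule set_eqI, rule iffI)
  fix y assume "y \<in> {y. chart y \<in> S}"
  then show "y \<in> (\<lambda>x. A *v x + v) ` S" using chart_inverse(2)[of y] by (intro image_eqI[of _ _ "chart y"]) auto
qed (auto simp: chart_inverse)

lemma ellipse_topology:
  "interior \<Omega> = {y. chart y \<in> ball 0 1}" "frontier \<Omega> = {y. chart y \<in> sphere 0 1}"
  "frontier (interior \<Omega>) = {y. chart y \<in> sphere 0 1}" "convex \<Omega>" "compact \<Omega>"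
proof -
  have bj: "bij ((*v) A)" using dA by (simp add: invertible_eq_bij[symmetric] invertible_det_nz)
  have im: "(\<lambda>x. A *v x + v) ` S = (+) v ` ((*v) A ` S)" for S by (auto simp: image_image add.commute)
  have lin: "linear ((*v) A)" by simp
  have int: "interior ((\<lambda>x. A *v x + v) ` S) = (\<lambda>x. A *v x + v) ` interior S" for S
    unfolding im interior_translation interior_bijective_linear_image[OF lin bj] ..
  have cl: "closure ((\<lambda>x. A *v x + v) ` S) = (\<lambda>x. A *v x + v) ` closure S" for S
    unfolding im closure_translation closure_injective_linear_image[OF lin bij_is_inj[OF bj]] ..
  have int_O: "interior \<Omega> = (\<lambda>x. A *v x + v) ` ball 0 1" unfolding O int by simp
  then show i: "interior \<Omega> = {y. chart y \<in> ball 0 1}" unfolding chart_image .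
  have "closure \<Omega> = (\<lambda>x. A *v x + v) ` cball 0 1" unfolding O cl by simp
  then have cl_O: "closure \<Omega> = {y. chart y \<in> cball 0 1}" unfolding chart_image .
  show "frontier \<Omega> = {y. chart y \<in> sphere 0 1}" unfolding frontier_def i cl_O by auto
  have "closure (interior \<Omega>) = (\<lambda>x. A *v x + v) ` cball 0 1" unfolding int_O cl by simp
  then have cl_i: "closure (interior \<Omega>) = {y. chart y \<in> cball 0 1}" unfolding chart_image .
  show "frontier (interior \<Omega>) = {y. chart y \<in> sphere 0 1}"
    unfolding frontier_def interior_interior cl_i unfolding i by auto
  show "convex \<Omega>" unfolding O im by (intro convex_translation convex_linear_image lin convex_cball)
  show "compact \<Omega>" unfolding O im by (intro compact_translation compact_continuous_image matrix_vector_mult_linear_continuous_on compact_cball)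
qed

definition "chart_rho y = disk_rho (chart y)"
definition "chart_drho y = (-2) *\<^sub>R (chart y v* matrix_inv A)"

lemma chart_rho_has_gradient: "(chart_rho has_derivative (\<lambda>h. chart_drho y \<bullet> h)) (at y)"
proof -
  have c: "(chart has_derivative (\<lambda>h. matrix_inv A *v h)) (at y)"
    unfolding chart_def[abs_def] by (rule has_derivative_compose[of "\<lambda>y. y - v" "\<lambda>h. h" y UNIV "(*v) (matrix_inv A)"])
      (auto intro!: derivative_eq_intros bounded_linear_imp_has_derivative)
  have "((\<lambda>y. 1 - chart y \<bullet> chart y) has_derivative (\<lambda>h. 0 - (chart y \<bullet> (matrix_inv A *v h) + (matrix_inv A *v h) \<bullet> chart y))) (at y)"
    by (intro derivative_intros c)
  moreover have "(\<lambda>y. 1 - chart y \<bullet> chart y) = chart_rho" by (auto simp: chart_rho_def disk_rho_eq power2_norm_eq_inner)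
  moreover have "(\<lambda>h. 0 - (chart y \<bullet> (matrix_inv A *v h) + (matrix_inv A *v h) \<bullet> chart y)) = (\<lambda>h. chart_drho y \<bullet> h)"
  proof
    fix h
    have "(matrix_inv A *v h) \<bullet> chart y = chart y \<bullet> (matrix_inv A *v h)" by (rule inner_commute)
    then show "0 - (chart y \<bullet> (matrix_inv A *v h) + (matrix_inv A *v h) \<bullet> chart y) = chart_drho y \<bullet> h"
      by (simp add: chart_drho_def dot_lmul_matrix)
  qed
  ultimately show ?thesis by simp
qed

lemma continuous_on_chart: "continuous_on S chart"
  unfolding chart_def[abs_def] by (intro matrix_vector_mult_linear_continuous_on[THEN continuous_on_compose2] continuous_intros) auto

lemma continuous_on_chart_drho: "continuous_on S chart_drho"
proof -
  have "chart_drho = (\<lambda>y. (-2) *\<^sub>R (transpose (matrix_inv A) *v chart y))" by (auto simp: chart_drho_def)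
  then show ?thesis
    by (simp only:) (intro continuous_intros continuous_on_compose2[OF matrix_vector_mult_linear_continuous_on continuous_on_chart], auto)
qed

lemma chart_rho_props:
  "y \<in> interior \<Omega> \<Longrightarrow> chart_rho y > 0" "y \<in> frontier (interior \<Omega>) \<Longrightarrow> chart_rho y = 0"
  using ellipse_topology(1,3) by (auto simp: chart_rho_def disk_rho_eq abs_square_less_1)

section \<open>The angle between the characteristics in disk coordinates\<close>

definition "gram1 = (A $ 1 $ 1)\<^sup>2 + (A $ 1 $ 2)\<^sup>2"
definition "gram2 = (A $ 2 $ 1)\<^sup>2 + (A $ 2 $ 2)\<^sup>2"
text \<open>Quotient of inner and cross product of the linear parts of \<open>ell_plus\<close> and
  \<open>ell_minus\<close>, pulled back to the disk. The mixed products of the rows of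
  \<open>A\<close> cancel in the inner product, which leaves the squared row lengths
  \<open>gram1\<close> and \<open>gram2\<close>.\<close>

definition "cotangent t = (gram2 / t - gram1 * t) / (2 * det A)"
definition "angle t = pi / 2 - arctan (cotangent t)"

lemma gram_pos: "gram1 > 0" "gram2 > 0"
  using dA unfolding det_2 gram1_def gram2_def by (auto simp: sum_power2_gt_zero_iff)

lemma angle_range: "0 < angle t" "angle t < pi"
  using arctan_bounded[of "cotangent t"] by (auto simp: angle_def)

lemma angle_strict_mono:
  assumes "0 < x" "x < y"
  shows "angle x < angle y"
proof -
  have "gram2 / y < gram2 / x" "gram1 * x < gram1 * y" using assms gram_pos by (auto intro: divide_strict_left_mono)
  then have "cotangent y < cotangent x" unfolding cotangent_def using dA by (intro divide_strict_right_mono) auto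
  then show ?thesis by (simp add: angle_def arctan_less_iff)
qed

text \<open>\<open>cotangent t = k\<close> is the quadratic equation
  \<open>gram1 * t\<^sup>2 + 2 * b * t = gram2\<close> with \<open>b = det A * k\<close>; its roots
  have opposite signs, and \<open>t\<close> is the positive one.\<close>

lemma angle_surj:
  assumes "0 < \<theta>" "\<theta> < pi"
  obtains t where "t > 0" "angle t = \<theta>"
proof -
  define k where "k = tan (pi / 2 - \<theta>)"
  define b where "b = det A * k"
  have g: "gram1 * gram2 > 0" using gram_pos by simp
  define w where "w = sqrt (b\<^sup>2 + gram1 * gram2)"
  have w2: "w\<^sup>2 = b\<^sup>2 + gram1 * gram2" using g by (simp add: w_def add_nonneg_nonneg)
  have "\<bar>b\<bar> < w" unfolding w_def using g by (intro real_less_rsqrt) auto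
  then have wb: "w - b > 0" by simp
  define t where "t = (w - b) / gram1"
  have t: "t > 0" using wb gram_pos by (simp add: t_def)
  have gt: "gram1 * t = w - b" using gram_pos by (simp add: t_def)
  have "(gram1 * t) * t * gram1 = (w - b)\<^sup>2" unfolding gt t_def using gram_pos by (simp add: power2_eq_square)
  also have "\<dots> = (gram2 - 2 * b * t) * gram1"
  proof -
    have "t * gram1 = w - b" using gt by (simp add: mult.commute)
    moreover have "(gram2 - 2 * b * t) * gram1 = gram1 * gram2 - 2 * b * (t * gram1)" by (simp add: algebra_simps)
    ultimately have "(gram2 - 2 * b * t) * gram1 = gram1 * gram2 - 2 * b * (w - b)" by simp
    also have "\<dots> = (w - b)\<^sup>2" using w2 by (simp add: power2_eq_square algebra_simps)
    finally show ?thesis by simp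
  qed
  finally have "gram1 * t * t = gram2 - 2 * b * t" using gram_pos(1) by (metis less_irrefl mult_right_cancel)
  then have "gram2 / t - gram1 * t = 2 * b" using t by (simp add: field_simps)
  then have "cotangent t = k" using dA by (simp add: cotangent_def b_def)
  moreover have "arctan k = pi / 2 - \<theta>" unfolding k_def by (rule arctan_tan) (use assms in auto)
  ultimately show ?thesis using that[OF t] by (simp add: angle_def)
qed

definition "lpar t = 1 / sqrt (1 + t\<^sup>2)" for t :: real

text \<open>In disk coordinates the level functions are affine, and their linear parts are written
  in polar form. The angle between them governs the billiard, while \<open>r\<close> and
  \<open>s\<close> normalise the two coordinates to \<open>[-1,1]\<close> on the disk.\<close>

lemma level_lines:
  assumes "t > 0"
  shows "0 < lpar t" "lpar t < 1" "sqrt (1 - (lpar t)\<^sup>2) = t * lpar t" "(lpar t)\<^sup>2 = 1 / (1 + t\<^sup>2)"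
    "\<exists>\<alpha> r s. r > 0 \<and> s > 0 \<and>
      (\<forall>x. ell_plus (lpar t) (A *v x + v) = ell_plus (lpar t) v + r * (cos \<alpha> * x $ 1 + sin \<alpha> * x $ 2)) \<and>
      (\<forall>x. ell_minus (lpar t) (A *v x + v) = ell_minus (lpar t) v + s * (cos (\<alpha> + angle t) * x $ 1 + sin (\<alpha> + angle t) * x $ 2))"
proof -
  define l where "l = lpar t"
  have l: "0 < l" "l < 1" "sqrt (1 - l\<^sup>2) = t * l"
    using parameter_of_slope[OF assms] unfolding l_def lpar_def by metis+
  then show "0 < lpar t" "lpar t < 1" "sqrt (1 - (lpar t)\<^sup>2) = t * lpar t" by (simp_all add: l_def)
  have "0 < 1 + t\<^sup>2" by (simp add: add_pos_nonneg)
  then show "(lpar t)\<^sup>2 = 1 / (1 + t\<^sup>2)" by (simp add: lpar_def power_divide)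
  define P Q :: "real^2" where "P = vector [A$1$1 / l + A$2$1 / (t * l), A$1$2 / l + A$2$2 / (t * l)]"
    and "Q = vector [- A$1$1 / l + A$2$1 / (t * l), - A$1$2 / l + A$2$2 / (t * l)]"
  define D where "D = 2 * det A / (t * l\<^sup>2)"
  have cr: "P $ 1 * Q $ 2 - P $ 2 * Q $ 1 = D"
    using l assms by (simp add: P_def Q_def D_def det_2 field_simps power2_eq_square)
  have Dp: "D > 0" using dA assms l by (simp add: D_def)
  have dot: "P $ 1 * Q $ 1 + P $ 2 * Q $ 2 = D * cotangent t"
  proof -
    have "P $ 1 * Q $ 1 + P $ 2 * Q $ 2 = (gram2 / t\<^sup>2 - gram1) / l\<^sup>2"
      using l assms by (simp add: P_def Q_def gram1_def gram2_def field_simps power2_eq_square)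
    also have "\<dots> = D * cotangent t"
      using l assms dA by (simp add: D_def cotangent_def field_simps power2_eq_square)
    finally show ?thesis .
  qed
  obtain \<alpha> r s where p: "r > 0" "s > 0" "P $ 1 = r * cos \<alpha>" "P $ 2 = r * sin \<alpha>"
    "Q $ 1 = s * cos (\<alpha> + angle t)" "Q $ 2 = s * sin (\<alpha> + angle t)"
    using polar_pair[OF cr Dp dot] unfolding angle_def by blast
  have Ax: "(A *v x) $ 1 = A$1$1 * x$1 + A$1$2 * x$2" "(A *v x) $ 2 = A$2$1 * x$1 + A$2$2 * x$2" for x
    by (simp_all add: matrix_vector_mult_def sum_2)
  have "ell_plus l (A *v x + v) = ell_plus l v + (P $ 1 * x $ 1 + P $ 2 * x $ 2)" for x
    unfolding ell_plus_def l(3) vector_add_component Ax P_def vector_2 by (simp add: add_divide_distrib algebra_simps)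
  moreover have "ell_minus l (A *v x + v) = ell_minus l v + (Q $ 1 * x $ 1 + Q $ 2 * x $ 2)" for x
    unfolding ell_minus_def l(3) vector_add_component Ax Q_def vector_2 by (simp add: add_divide_distrib diff_divide_distrib algebra_simps)
  ultimately have "(\<forall>x. ell_plus l (A *v x + v) = ell_plus l v + r * (cos \<alpha> * x $ 1 + sin \<alpha> * x $ 2)) \<and>
      (\<forall>x. ell_minus l (A *v x + v) = ell_minus l v + s * (cos (\<alpha> + angle t) * x $ 1 + sin (\<alpha> + angle t) * x $ 2))"
    unfolding p(3-6) by (simp add: algebra_simps)
  then show "\<exists>\<alpha> r s. r > 0 \<and> s > 0 \<and>
      (\<forall>x. ell_plus (lpar t) (A *v x + v) = ell_plus (lpar t) v + r * (cos \<alpha> * x $ 1 + sin \<alpha> * x $ 2)) \<and>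
      (\<forall>x. ell_minus (lpar t) (A *v x + v) = ell_minus (lpar t) v + s * (cos (\<alpha> + angle t) * x $ 1 + sin (\<alpha> + angle t) * x $ 2))"
    using p(1,2) unfolding l_def by blast
qed

text \<open>The unit circle itself serves as coordinate of the boundary, and the functions
  \<open>F\<close> and \<open>G\<close> of the general criterion are affine; the two directions
  differ by \<open>angle t\<close>.\<close>

lemma ellipse_rotation_number:
  assumes "0 < l" "l < 1"
  shows "rotation_number \<Omega> l \<in> \<rat> \<longleftrightarrow> angle (sqrt (1 - l\<^sup>2) / l) / pi \<in> \<rat>"
proof -
  define t where "t = sqrt (1 - l\<^sup>2) / l"
  have t: "t > 0" "l\<^sup>2 = 1 / (1 + t\<^sup>2)" unfolding t_def by (rule slope_of_parameter[OF assms])+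
  have lp: "lpar t = l" using level_lines(1,4)[OF t(1)] t(2) assms(1) by (metis less_imp_le power2_eq_imp_eq)
  obtain \<alpha> r s where rs: "r > 0" "s > 0"
    and p: "\<And>x. ell_plus l (A *v x + v) = ell_plus l v + r * (cos \<alpha> * x $ 1 + sin \<alpha> * x $ 2)"
    and m: "\<And>x. ell_minus l (A *v x + v) = ell_minus l v + s * (cos (\<alpha> + angle t) * x $ 1 + sin (\<alpha> + angle t) * x $ 2)"
    using level_lines(5)[OF t(1)] unfolding lp by blast
  define V :: "complex \<Rightarrow> real^2" where "V z = Re z *\<^sub>R axis 1 1 + Im z *\<^sub>R axis 2 1" for z
  have Vc: "V z $ 1 = Re z" "V z $ 2 = Im z" for z by (simp_all add: V_def axis_def)
  have Vn: "norm (V z) = norm z" for z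
    using norm_vec2_sq[of "V z"] by (simp add: Vc cmod_def real_sqrt_unique)
  define \<kappa> where "\<kappa> z = A *v V z + v" for z
  have fr: "\<kappa> ` sphere 0 1 = frontier \<Omega>"
  proof -
    have "V ` sphere 0 1 = sphere 0 1"
    proof (rule set_eqI, rule iffI)
      fix x :: "real^2" assume x: "x \<in> sphere 0 1"
      have "V (Complex (x $ 1) (x $ 2)) = x" by (simp add: vec_eq_iff forall_2 Vc)
      then show "x \<in> V ` sphere 0 1" using x Vn by (intro image_eqI[of _ _ "Complex (x $ 1) (x $ 2)"]) (metis, metis dist_0_norm mem_sphere)
    qed (auto simp: Vn)
    moreover have "\<kappa> ` sphere 0 1 = (\<lambda>x. A *v x + v) ` V ` sphere 0 1" unfolding \<kappa>_def[abs_def] image_image ..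
    ultimately have "\<kappa> ` sphere 0 1 = (\<lambda>x. A *v x + v) ` sphere 0 1" by (simp only:)
    then show ?thesis unfolding ellipse_topology(2) chart_image .
  qed
  have ck: "continuous_on (sphere 0 1) \<kappa>" unfolding \<kappa>_def V_def
    by (intro continuous_intros continuous_on_compose2[OF matrix_vector_mult_linear_continuous_on]) auto
  have "rotation_number \<Omega> l \<in> \<rat> \<longleftrightarrow> (\<alpha> - (\<alpha> + angle t)) / pi \<in> \<rat>"
  proof (rule rotation_number_rational_iff[OF ellipse_topology(4,5) fr ck,
        where F="\<lambda>u. ell_plus l v + r * u" and G="\<lambda>u. ell_minus l v + s * u"])
    show "inj_on (\<lambda>u. ell_plus l v + r * u) {-1..1}" "inj_on (\<lambda>u. ell_minus l v + s * u) {-1..1}"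
      using rs by (auto simp: inj_on_def)
    show "ell_plus l (\<kappa> z) = ell_plus l v + r * Re (z * cnj (cis \<alpha>))" for z
      unfolding \<kappa>_def p Vc by (simp add: mult.commute)
    show "ell_minus l (\<kappa> z) = ell_minus l v + s * Re (z * cnj (cis (\<alpha> + angle t)))" for z
      unfolding \<kappa>_def m Vc by (simp add: mult.commute)
    show "sin (\<alpha> - (\<alpha> + angle t)) \<noteq> 0" using sin_gt_zero[OF angle_range[of t]] by simp
  qed
  also have "(\<alpha> - (\<alpha> + angle t)) / pi = - (angle t / pi)" by simp
  also have "- (angle t / pi) \<in> \<rat> \<longleftrightarrow> angle t / pi \<in> \<rat>" by (metis Rats_minus_iff)
  finally show ?thesis unfolding t_def .
qed

section \<open>The Chebyshev eigenfunctions of the ellipse\<close>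

definition "line_data t = (SOME p. case p of (\<alpha>, r, s) \<Rightarrow> r > 0 \<and> s > 0 \<and>
      (\<forall>x. ell_plus (lpar t) (A *v x + v) = ell_plus (lpar t) v + r * (cos \<alpha> * x $ 1 + sin \<alpha> * x $ 2)) \<and>
      (\<forall>x. ell_minus (lpar t) (A *v x + v) = ell_minus (lpar t) v + s * (cos (\<alpha> + angle t) * x $ 1 + sin (\<alpha> + angle t) * x $ 2)))"
definition "dir t = fst (line_data t)"
definition "amp_p t = fst (snd (line_data t))"
definition "amp_m t = snd (snd (line_data t))"

text \<open>Choosing one triple per \<open>t\<close> makes the eigenfunctions depend on the pair
  \<open>(n, t)\<close> alone.\<close>

lemma line_data:
  assumes "t > 0"
  shows "amp_p t > 0" "amp_m t > 0"
    "ell_plus (lpar t) y = ell_plus (lpar t) v + amp_p t * (cos (dir t) * chart y $ 1 + sin (dir t) * chart y $ 2)"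
    "ell_minus (lpar t) y = ell_minus (lpar t) v + amp_m t * (cos (dir t + angle t) * chart y $ 1 + sin (dir t + angle t) * chart y $ 2)"
proof -
  have "\<exists>p. case p of (\<alpha>, r, s) \<Rightarrow> r > 0 \<and> s > 0 \<and>
      (\<forall>x. ell_plus (lpar t) (A *v x + v) = ell_plus (lpar t) v + r * (cos \<alpha> * x $ 1 + sin \<alpha> * x $ 2)) \<and>
      (\<forall>x. ell_minus (lpar t) (A *v x + v) = ell_minus (lpar t) v + s * (cos (\<alpha> + angle t) * x $ 1 + sin (\<alpha> + angle t) * x $ 2))"
    using level_lines(5)[OF assms] by simp
  from someI_ex[OF this, folded line_data_def]
  have *: "amp_p t > 0 \<and> amp_m t > 0 \<and>
      (\<forall>x. ell_plus (lpar t) (A *v x + v) = ell_plus (lpar t) v + amp_p t * (cos (dir t) * x $ 1 + sin (dir t) * x $ 2)) \<and>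
      (\<forall>x. ell_minus (lpar t) (A *v x + v) = ell_minus (lpar t) v + amp_m t * (cos (dir t + angle t) * x $ 1 + sin (dir t + angle t) * x $ 2))"
    unfolding case_prod_beta dir_def amp_p_def amp_m_def .
  show "amp_p t > 0" "amp_m t > 0" using * by blast+
  show "ell_plus (lpar t) y = ell_plus (lpar t) v + amp_p t * (cos (dir t) * chart y $ 1 + sin (dir t) * chart y $ 2)"
    "ell_minus (lpar t) y = ell_minus (lpar t) v + amp_m t * (cos (dir t + angle t) * chart y $ 1 + sin (dir t + angle t) * chart y $ 2)"
    using * chart_inverse(2)[of y] by metis+
qed

text \<open>The factor \<open>cos (real n * angle t)\<close> is 1 or -1 for the pairs in
  \<open>ell_index\<close> and thus selects between the difference and the sum of the two Chebyshev
  terms.\<close>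

definition "disk_fun n t x = poly (cheb n) (cos (dir t) * x $ 1 + sin (dir t) * x $ 2)
   - cos (real n * angle t) * poly (cheb n) (cos (dir t + angle t) * x $ 1 + sin (dir t + angle t) * x $ 2)" for x :: "real^2"

definition "prof_p n t u = poly (cheb n) ((u - ell_plus (lpar t) v) / amp_p t)"
definition "prof_p' n t u = poly (pderiv (cheb n)) ((u - ell_plus (lpar t) v) / amp_p t) / amp_p t"
definition "prof_m n t u = - cos (real n * angle t) * poly (cheb n) ((u - ell_minus (lpar t) v) / amp_m t)"
definition "prof_m' n t u = - cos (real n * angle t) * (poly (pderiv (cheb n)) ((u - ell_minus (lpar t) v) / amp_m t) / amp_m t)"
definition "eig_grad n t = wave_grad (lpar t) (prof_p' n t) (prof_m' n t)"
text \<open>The condition on the sine says that \<open>angle t\<close> is a multiple of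
  \<open>pi / n\<close>. The bound on \<open>n\<close> keeps out the zero function at
  \<open>n = 0\<close>.\<close>

definition "ell_index = {(n::nat, t). 2 \<le> n \<and> 0 < t \<and> sin (real n * angle t) = 0}"

lemma prof_derivatives:
  "(prof_p n t has_real_derivative prof_p' n t u) (at u)" "continuous_on UNIV (prof_p' n t)"
  "(prof_m n t has_real_derivative prof_m' n t u) (at u)" "continuous_on UNIV (prof_m' n t)"
proof -
  have d: "((\<lambda>u. poly (cheb n) ((u - c) / a)) has_real_derivative poly (pderiv (cheb n)) ((u - c) / a) / a) (at u)" for c a
  proof -
    have "((\<lambda>u. (u - c) / a) has_real_derivative 1 / a) (at u)"
      by (rule DERIV_cong[OF DERIV_cdivide[OF DERIV_diff[OF DERIV_ident DERIV_const]]]) simp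
    from DERIV_chain2[OF poly_DERIV this] show ?thesis by simp
  qed
  show "(prof_p n t has_real_derivative prof_p' n t u) (at u)"
    unfolding prof_p_def[abs_def] prof_p'_def by (rule d)
  show "(prof_m n t has_real_derivative prof_m' n t u) (at u)"
    unfolding prof_m_def[abs_def] prof_m'_def by (rule DERIV_cmult[OF d])
  have c: "continuous_on UNIV (\<lambda>u. poly (pderiv (cheb n)) ((u - c) / a))" for c a
    by (rule continuous_on_compose2[OF continuous_on_poly[OF continuous_on_id]]) (auto simp: divide_inverse intro!: continuous_intros)
  show "continuous_on UNIV (prof_p' n t)" "continuous_on UNIV (prof_m' n t)"
    unfolding prof_p'_def[abs_def] prof_m'_def[abs_def] divide_inverse[of _ "amp_p t"] divide_inverse[of _ "amp_m t"]
    using c[of _ "amp_p t"] c[of _ "amp_m t"] by (auto intro!: continuous_intros simp: divide_inverse)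
qed

lemma wave_eq_disk_fun:
  assumes "t > 0"
  shows "wave (lpar t) (prof_p n t) (prof_m n t) y = disk_fun n t (chart y)"
  using line_data(1,2)[OF assms] unfolding wave_def prof_p_def prof_m_def disk_fun_def line_data(3,4)[OF assms, of y] by simp

lemma eig_grad_gradient:
  assumes "t > 0"
  shows "((\<lambda>y. disk_fun n t (chart y)) has_derivative (\<lambda>h. eig_grad n t y \<bullet> h)) (at y)"
  using wave_has_gradient[OF prof_derivatives(1,3), of "lpar t" n t n t y]
  unfolding wave_eq_disk_fun[OF assms, abs_def] eig_grad_def .

text \<open>The vector is tangent to the level lines of \<open>ell_minus\<close>, so it isolates the
  derivative of the first profile; \<open>ell_plus\<close> takes the value 2 on it, which explains
  the factor.\<close>

lemma eig_grad_dot: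
  assumes "t > 0"
  shows "eig_grad n t y \<bullet> vector [lpar t, sqrt (1 - (lpar t)\<^sup>2)] =
    2 / amp_p t * poly (pderiv (cheb n)) (cos (dir t) * chart y $ 1 + sin (dir t) * chart y $ 2)"
proof -
  have "(ell_plus (lpar t) y - ell_plus (lpar t) v) / amp_p t = cos (dir t) * chart y $ 1 + sin (dir t) * chart y $ 2"
    using line_data(1)[OF assms] unfolding line_data(3)[OF assms, of y] by simp
  moreover have "sqrt (1 - (lpar t)\<^sup>2) \<noteq> 0" "lpar t \<noteq> 0" using level_lines(1,3)[OF assms] assms by auto
  ultimately show ?thesis
    unfolding eig_grad_def wave_grad_def prof_p'_def by (simp add: inner_vec_def sum_2 algebra_simps)
qed

lemma disk_point:
  assumes "-1 < s" "s < 1"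
  obtains y where "y \<in> interior \<Omega>" "cos \<alpha> * chart y $ 1 + sin \<alpha> * chart y $ 2 = s"
proof -
  define x :: "real^2" where "x = vector [s * cos \<alpha>, s * sin \<alpha>]"
  have "(norm x)\<^sup>2 = s\<^sup>2 * ((cos \<alpha>)\<^sup>2 + (sin \<alpha>)\<^sup>2)" unfolding norm_vec2_sq by (simp only: x_def vector_2 power_mult_distrib distrib_left)
  then have "(norm x)\<^sup>2 = s\<^sup>2" by simp
  moreover have "s\<^sup>2 < 1" using assms by (simp add: abs_square_less_1 abs_less_iff)
  ultimately have "norm x < 1" using abs_square_less_1[of "norm x"] by simp
  then have "A *v x + v \<in> interior \<Omega>" unfolding ellipse_topology(1) by (simp add: chart_inverse)
  moreover have "cos \<alpha> * x $ 1 + sin \<alpha> * x $ 2 = s * ((cos \<alpha>)\<^sup>2 + (sin \<alpha>)\<^sup>2)"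
    unfolding x_def vector_2 by (simp only: algebra_simps power2_eq_square)
  then have "cos \<alpha> * x $ 1 + sin \<alpha> * x $ 2 = s" by simp
  ultimately show ?thesis using that[of "A *v x + v"] by (simp add: chart_inverse)
qed

text \<open>At the boundary angle \<phi> the Chebyshev terms are
  \<open>cos (n * (\<phi> - dir t))\<close> and the same shifted by \<open>n * angle t\<close>, a
  multiple of \<open>pi\<close>. The shift is a sign, which the factor in \<open>disk_fun\<close>
  undoes.\<close>

lemma disk_fun_factor:
  assumes "(n, t) \<in> ell_index"
  shows "\<exists>r\<in>polys (int n - 2). \<forall>x. disk_fun n t x = disk_rho x * r x"
proof (rule polys_vanishing_on_circle[of "disk_fun n t" "int n"])
  have "(\<lambda>x. poly (cheb n) (cos (dir t) * x $ 1 + sin (dir t) * x $ 2)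
     + (- cos (real n * angle t)) * poly (cheb n) (cos (dir t + angle t) * x $ 1 + sin (dir t + angle t) * x $ 2)) \<in> polys (int n)"
    by (intro polys_add polys_scale polys_poly) (simp_all add: degree_cheb)
  then show "disk_fun n t \<in> polys (int n)" unfolding disk_fun_def[abs_def] by simp
  fix x :: "real^2" assume "norm x = 1"
  then have "(x $ 1)\<^sup>2 + (x $ 2)\<^sup>2 = 1" using norm_vec2_sq[of x] by simp
  then obtain \<phi> where x: "x $ 1 = cos \<phi>" "x $ 2 = sin \<phi>" using sincos_total_2pi by metis
  have c: "cos a * cos \<phi> + sin a * sin \<phi> = cos (\<phi> - a)" for a by (simp add: cos_diff mult.commute)
  have s: "sin (real n * angle t) = 0" using assms by (simp add: ell_index_def)
  then have c2: "cos (real n * angle t) * cos (real n * angle t) = 1" using sin_cos_squared_add3[of "real n * angle t"] by simp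
  have e: "real n * (\<phi> - (dir t + angle t)) = real n * (\<phi> - dir t) - real n * angle t" by (simp add: algebra_simps)
  have "cos (real n * (\<phi> - (dir t + angle t))) = cos (real n * (\<phi> - dir t)) * cos (real n * angle t)"
    unfolding e cos_diff[of "real n * (\<phi> - dir t)"] s by simp
  then show "disk_fun n t x = 0" unfolding disk_fun_def x c poly_cheb_cos using c2 by (simp add: mult_ac)
qed blast

lemma pderiv_cheb:
  assumes "2 \<le> n"
  shows "degree (pderiv (cheb n)) = n - 1" "pderiv (cheb n) \<noteq> 0"
proof -
  show d: "degree (pderiv (cheb n)) = n - 1" by (simp add: degree_pderiv degree_cheb)
  then show "pderiv (cheb n) \<noteq> 0" using assms by auto
qed

text \<open>The cofactor of \<open>disk_rho\<close> is bounded on the disk, which gives the bound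
  required near the boundary. Nontriviality comes from a point where the derivative of the Chebyshev
  polynomial is nonzero.\<close>

lemma ellipse_P_eigvec:
  assumes i: "(n, t) \<in> ell_index"
  shows "P_eigvec \<Omega> (1 / (1 + t\<^sup>2)) (\<lambda>y. if y \<in> interior \<Omega> then disk_fun n t (chart y) else 0)
    (\<lambda>y. if y \<in> interior \<Omega> then eig_grad n t y else 0)"
proof -
  have t: "t > 0" and n: "2 \<le> n" using i by (auto simp: ell_index_def)
  obtain r where r: "r \<in> polys (int n - 2)" "\<And>x. disk_fun n t x = disk_rho x * r x" using disk_fun_factor[OF i] by blast
  have "bounded (r ` cball 0 1)" by (intro compact_imp_bounded compact_continuous_image continuous_on_polys[OF r(1)] compact_cball)
  then obtain C where C: "\<And>x. x \<in> cball 0 1 \<Longrightarrow> norm (r x) \<le> C" unfolding bounded_iff by blast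
  have "\<exists>s. -1 < s \<and> s < 1 \<and> poly (pderiv (cheb n)) s \<noteq> 0"
    using poly_eq_0_on_open_interval pderiv_cheb(2)[OF n] by blast
  then obtain s where s: "-1 < s" "s < 1" "poly (pderiv (cheb n)) s \<noteq> 0" by blast
  obtain y0 where y0: "y0 \<in> interior \<Omega>" "cos (dir t) * chart y0 $ 1 + sin (dir t) * chart y0 $ 2 = s"
    using disk_point[OF s(1,2)] .
  have "eig_grad n t y0 \<noteq> 0"
    using eig_grad_dot[OF t, of n y0] s(3) line_data(1)[OF t] unfolding y0(2) by auto
  then have g: "wave_grad (lpar t) (prof_p' n t) (prof_m' n t) y0 \<noteq> 0" by (simp add: eig_grad_def)
  have "P_eigvec \<Omega> ((lpar t)\<^sup>2) (\<lambda>y. if y \<in> interior \<Omega> then wave (lpar t) (prof_p n t) (prof_m n t) y else 0)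
     (\<lambda>y. if y \<in> interior \<Omega> then wave_grad (lpar t) (prof_p' n t) (prof_m' n t) y else 0)"
  proof (rule wave_P_eigvec[OF level_lines(1,2)[OF t] _ prof_derivatives chart_rho_has_gradient continuous_on_chart_drho
        chart_rho_props _ y0(1) g])
    show "bounded \<Omega>" by (rule compact_imp_bounded[OF ellipse_topology(5)])
    fix y assume y: "y \<in> interior \<Omega>"
    then have "chart y \<in> cball 0 1" unfolding ellipse_topology(1) by simp
    then have "\<bar>r (chart y)\<bar> \<le> C" using C by simp
    then have "\<bar>r (chart y)\<bar> * chart_rho y \<le> C * chart_rho y" using chart_rho_props(1)[OF y] by (intro mult_right_mono) auto
    then show "\<bar>wave (lpar t) (prof_p n t) (prof_m n t) y\<bar> \<le> C * chart_rho y"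
      using chart_rho_props(1)[OF y] unfolding wave_eq_disk_fun[OF t] r(2) chart_rho_def by (simp add: abs_mult mult.commute)
  qed
  then show ?thesis unfolding wave_eq_disk_fun[OF t] level_lines(4)[OF t] eig_grad_def .
qed

text \<open>Different \<open>t\<close> belong to different eigenvalues, so the parts with a fixed \<open>t\<close> are orthogonal to each other;
  for a fixed \<open>t\<close> the derivatives along the characteristic direction have different degrees.\<close>
lemma disk_fun_independent:
  assumes J: "finite J" "J \<subseteq> ell_index" and z: "\<And>x. (\<Sum>(n, t)\<in>J. c (n, t) * disk_fun n t x) = 0"
    and i: "i \<in> J"
  shows "c i = 0"
proof -
  obtain n0 t0 where i0: "i = (n0, t0)" by (cases i)
  have t0: "t0 > 0" using i J by (auto simp: i0 ell_index_def)
  define g where "g = (\<lambda>(n, t) y. if y \<in> interior \<Omega> then eig_grad n t y else 0)"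
  have E: "P_eigvec \<Omega> (1 / (1 + (snd j)\<^sup>2)) (\<lambda>y. if y \<in> interior \<Omega> then disk_fun (fst j) (snd j) (chart y) else 0) (g j)" if "j \<in> J" for j
    using ellipse_P_eigvec[of "fst j" "snd j"] that J(2) unfolding g_def case_prod_beta by auto
  have L: "L2_field (g j)" if "j \<in> J" for j by (rule P_eigvec_L2[OF E[OF that]])
  have grad0: "(\<Sum>(n, t)\<in>J. c (n, t) *\<^sub>R eig_grad n t y) = 0" for y
  proof -
    have "((\<lambda>y. \<Sum>j\<in>J. c j * disk_fun (fst j) (snd j) (chart y)) has_derivative (\<lambda>h. \<Sum>j\<in>J. (c j *\<^sub>R eig_grad (fst j) (snd j) y) \<bullet> h)) (at y)"
      using J(2) by (intro has_derivative_sum has_gradient_cmult eig_grad_gradient) (auto simp: ell_index_def)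
    moreover have "(\<lambda>y. \<Sum>j\<in>J. c j * disk_fun (fst j) (snd j) (chart y)) = (\<lambda>y. 0)"
      using z by (auto simp: case_prod_beta)
    moreover have "(\<lambda>h. \<Sum>j\<in>J. (c j *\<^sub>R eig_grad (fst j) (snd j) y) \<bullet> h) = (\<lambda>h. (\<Sum>j\<in>J. c j *\<^sub>R eig_grad (fst j) (snd j) y) \<bullet> h)"
      by (simp only: inner_sum_left)
    ultimately have "((\<lambda>y. 0) has_derivative (\<lambda>h. (\<Sum>j\<in>J. c j *\<^sub>R eig_grad (fst j) (snd j) y) \<bullet> h)) (at y)" by simp
    moreover have "((\<lambda>y. 0::real) has_derivative (\<lambda>h. 0 \<bullet> h)) (at y)" by simp
    ultimately have "(\<Sum>j\<in>J. c j *\<^sub>R eig_grad (fst j) (snd j) y) = 0" by (rule gradient_unique)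
    then show ?thesis by (simp add: case_prod_beta)
  qed
  \<comment> \<open>The members with the same slope as \<open>i\<close>; all others have different
    eigenvalues.\<close>
  define J0 where "J0 = {j \<in> J. snd j = t0}"
  have J0: "finite J0" "J0 \<subseteq> J" "finite (J - J0)" using J by (auto simp: J0_def)
  define S where "S y = (\<Sum>j\<in>J0. c j *\<^sub>R g j y)" for y
  define R where "R y = (\<Sum>j\<in>J - J0. c j *\<^sub>R g j y)" for y
  have LS: "L2_field S" unfolding S_def using J0 L by (intro L2_field_sum) auto
  have LR: "L2_field R" unfolding R_def using J0 L by (intro L2_field_sum) auto
  have SR: "S y + R y = 0" for y
  proof -
    have "S y + R y = (\<Sum>j\<in>J. c j *\<^sub>R g j y)" unfolding S_def R_def using sum.subset_diff[OF J0(2) J(1), of "\<lambda>j. c j *\<^sub>R g j y"] by simp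
    also have "\<dots> = (if y \<in> interior \<Omega> then (\<Sum>(n, t)\<in>J. c (n, t) *\<^sub>R eig_grad n t y) else 0)"
      by (auto simp: g_def case_prod_beta)
    finally show ?thesis using grad0 by simp
  qed
  have "ip_H10 S R = (\<Sum>j\<in>J - J0. c j * ip_H10 S (g j))" unfolding R_def using J0 L by (intro ip_H10_sum_right LS) auto
  also have "\<dots> = 0"
  proof (rule sum.neutral, rule ballI)
    fix j assume j: "j \<in> J - J0"
    have "ip_H10 (g j) S = (\<Sum>k\<in>J0. c k * ip_H10 (g j) (g k))" unfolding S_def using J0 L j by (intro ip_H10_sum_right) auto
    also have "\<dots> = 0"
    proof (rule sum.neutral, rule ballI)
      fix k assume k: "k \<in> J0"
      have "snd j > 0" "snd j \<noteq> t0" "snd k = t0" using j k J by (auto simp: J0_def ell_index_def)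
      then have "(snd j)\<^sup>2 \<noteq> (snd k)\<^sup>2" using t0 by (auto simp: power2_eq_iff)
      moreover have "1 + (snd j)\<^sup>2 \<noteq> 0" "1 + (snd k)\<^sup>2 \<noteq> 0" by (smt (verit) zero_le_power2)+
      ultimately have "1 / (1 + (snd j)\<^sup>2) \<noteq> 1 / (1 + (snd k)\<^sup>2)" by (simp add: field_simps)
      then have "ip_H10 (g j) (g k) = 0" using eigvec_orthogonal[OF E E] j k J0 by blast
      then show "c k * ip_H10 (g j) (g k) = 0" by simp
    qed
    finally have "ip_H10 S (g j) = 0" by (simp add: ip_H10_commute[of S])
    then show "c j * ip_H10 S (g j) = 0" by simp
  qed
  finally have "ip_H10 S R = 0" .
  moreover have "R = (\<lambda>y. (-1) *\<^sub>R S y)"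
  proof
    fix y show "R y = (-1) *\<^sub>R S y" using SR[of y] by (simp add: eq_neg_iff_add_eq_0 add.commute)
  qed
  \<comment> \<open>\<open>S\<close> is orthogonal to \<open>R = - S\<close>, hence to
    itself.\<close>
  ultimately have "ip_H10 S S = 0" using ip_H10_scaleR_right[of S "-1" S] by simp
  then have ae: "AE y in lborel. S y = 0" using ip_H10_eq_0_iff[OF LS] by simp
  define w where "w y = (\<Sum>j\<in>J0. c j *\<^sub>R eig_grad (fst j) t0 y)" for y
  have Sw: "S = (\<lambda>y. if y \<in> interior \<Omega> then w y else 0)"
    unfolding S_def[abs_def] w_def[abs_def] g_def by (auto simp: fun_eq_iff case_prod_beta J0_def intro!: sum.cong)
  have cw: "continuous_on S' w" for S' unfolding w_def eig_grad_def
    by (intro continuous_intros continuous_on_subset[OF continuous_on_wave_grad[OF prof_derivatives(2,4)]]) auto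
  have w0: "w y = 0" if "y \<in> interior \<Omega>" for y
    using not_AE_zero_on_open[OF open_interior cw that] ae unfolding Sw by blast
  define N where "N = fst ` J0"
  have inj: "inj_on fst J0" by (auto simp: inj_on_def J0_def)
  \<comment> \<open>Pairing with the characteristic direction leaves a relation between derivatives
    of Chebyshev polynomials in one variable, which takes every value in (-1, 1) on the
    interior.\<close>
  have pz: "(\<Sum>n\<in>N. smult (c (n, t0)) (pderiv (cheb n))) = 0"
  proof (rule poly_eq_0_on_open_interval)
    fix s :: real assume s: "-1 < s" "s < 1"
    obtain y where y: "y \<in> interior \<Omega>" "cos (dir t0) * chart y $ 1 + sin (dir t0) * chart y $ 2 = s" using disk_point[OF s] .
    have "0 = w y \<bullet> vector [lpar t0, sqrt (1 - (lpar t0)\<^sup>2)]" using w0[OF y(1)] by simp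
    also have "\<dots> = (\<Sum>j\<in>J0. c j * (2 / amp_p t0 * poly (pderiv (cheb (fst j))) s))"
      unfolding w_def inner_sum_left inner_scaleR_left eig_grad_dot[OF t0] y(2) ..
    also have "\<dots> = 2 / amp_p t0 * (\<Sum>j\<in>J0. c j * poly (pderiv (cheb (fst j))) s)"
      unfolding sum_distrib_left by (rule sum.cong) auto
    finally have "(\<Sum>j\<in>J0. c j * poly (pderiv (cheb (fst j))) s) = 0" using line_data(1)[OF t0] by simp
    moreover have "(\<Sum>j\<in>J0. c j * poly (pderiv (cheb (fst j))) s) = (\<Sum>n\<in>N. c (n, t0) * poly (pderiv (cheb n)) s)"
      unfolding N_def sum.reindex[OF inj] by (rule sum.cong) (auto simp: J0_def)
    ultimately show "poly (\<Sum>n\<in>N. smult (c (n, t0)) (pderiv (cheb n))) s = 0" by (simp add: poly_sum)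
  qed
  have N2: "2 \<le> n" if "n \<in> N" for n using that J by (auto simp: N_def J0_def ell_index_def)
  have "c (n0, t0) = 0"
  proof (rule sum_distinct_degrees_eq_0[OF _ _ _ pz])
    show "finite N" using J0 by (simp add: N_def)
    show "pderiv (cheb n) \<noteq> 0" if "n \<in> N" for n by (rule pderiv_cheb(2)[OF N2[OF that]])
    show "degree (pderiv (cheb m)) < degree (pderiv (cheb n))" if "m \<in> N" "n \<in> N" "m < n" for m n
      unfolding pderiv_cheb(1)[OF N2[OF that(1)]] pderiv_cheb(1)[OF N2[OF that(2)]] using that(3) N2[OF that(1)] by simp
    show "n0 \<in> N" using i by (force simp: N_def J0_def i0)
  qed
  then show ?thesis by (simp add: i0)
qed

text \<open>The exponents \<open>(i, j)\<close> correspond to degree \<open>n = i + j + 2\<close>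
  and angle \<open>pi * (i + 1) / n\<close>: for fixed \<open>n\<close> the numbers
  \<open>i + 1\<close> run from 1 to \<open>n - 1\<close>, giving exactly the multiples of
  \<open>pi / n\<close> in (0, pi). The eigenfunctions so indexed are independent and lie in the
  span of equally many products of \<open>disk_rho\<close> with monomials, so they generate
  it.\<close>

lemma disk_rho_polys_span:
  assumes q: "q \<in> polys d"
  shows "(\<lambda>x. disk_rho x * q x) \<in> fun_vs.span {disk_fun n t | n t. (n, t) \<in> ell_index}" (is "_ \<in> fun_vs.span ?B")
proof -
  define N where "N = nat d"
  define J where "J = {p. fst p + snd p \<le> N}"
  have "J \<subseteq> {..N} \<times> {..N}" by (auto simp: J_def)
  then have J: "finite J" by (rule finite_subset) simp
  define n where "n p = fst p + snd p + 2" for p :: "nat \<times> nat"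
  have "\<forall>p :: nat \<times> nat. \<exists>t. t > 0 \<and> angle t = pi * real (fst p + 1) / real (n p)"
  proof
    fix p :: "nat \<times> nat"
    have n: "real (fst p + 1) < real (n p)" "0 < real (n p)" by (simp_all add: n_def)
    have "0 < pi * real (fst p + 1) / real (n p)" using n(2) by (intro divide_pos_pos mult_pos_pos) auto
    moreover have "pi * real (fst p + 1) / real (n p) < pi" using n by (simp add: pos_divide_less_eq)
    ultimately obtain t where "t > 0" "angle t = pi * real (fst p + 1) / real (n p)" by (rule angle_surj)
    then show "\<exists>t. t > 0 \<and> angle t = pi * real (fst p + 1) / real (n p)" by blast
  qed
  from choice[OF this] obtain \<tau> where \<tau>: "\<And>p. \<tau> p > 0" "\<And>p. angle (\<tau> p) = pi * real (fst p + 1) / real (n p)" by blast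
  define idx where "idx p = (n p, \<tau> p)" for p
  have idx: "(n p, \<tau> p) \<in> ell_index" for p
  proof -
    have "real (n p) * angle (\<tau> p) = pi * real (fst p + 1)" unfolding \<tau>(2) by (simp add: n_def)
    then have "sin (real (n p) * angle (\<tau> p)) = 0" by (simp only: sin_npi2)
    then show ?thesis using \<tau>(1) by (simp add: ell_index_def n_def)
  qed
  have inj: "inj_on idx J"
  proof (rule inj_onI)
    fix p r assume "idx p = idx r"
    then have e: "n p = n r" "\<tau> p = \<tau> r" by (auto simp: idx_def)
    have "angle (\<tau> p) = angle (\<tau> r)" using e(2) by simp
    then have "pi * real (fst p + 1) / real (n r) = pi * real (fst r + 1) / real (n r)" unfolding \<tau>(2) e(1) .
    then have "fst p = fst r" by (simp add: n_def)
    with e(1) show "p = r" by (simp add: n_def prod_eq_iff)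
  qed
  define a where "a p x = disk_rho x * (x $ 1 ^ fst p * x $ 2 ^ snd p)" for p :: "nat \<times> nat" and x :: "real^2"
  define b where "b p = disk_fun (n p) (\<tau> p)" for p
  have mul: "(\<lambda>x. disk_rho x * r x) \<in> fun_vs.span (a ` J)" if "r \<in> polys (int N)" for r
    using that
  proof (induction r rule: polys_induct)
    case zero
    show ?case using fun_vs.span_zero[of "a ` J"] by (simp add: zero_fun_def)
  next
    case (step c i j r)
    have "a (i, j) \<in> fun_vs.span (a ` J)" using step(1) by (intro fun_vs.span_base) (auto simp: J_def)
    from fun_vs.span_add[OF fun_vs.span_scale[OF this, of c] step(3)]
    have "(\<lambda>x. c * a (i, j) x) + (\<lambda>x. disk_rho x * r x) \<in> fun_vs.span (a ` J)" .
    moreover have "(\<lambda>x. c * a (i, j) x) + (\<lambda>x. disk_rho x * r x) = (\<lambda>x. disk_rho x * (c * (x $ 1 ^ i * x $ 2 ^ j) + r x))"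
      by (auto simp: fun_eq_iff a_def algebra_simps)
    ultimately show ?case by simp
  qed
  have aB: "a p \<in> fun_vs.span (b ` J)" if p: "p \<in> J" for p
  proof (rule span_exchange[OF J _ _ p])
    fix k assume k: "k \<in> J"
    obtain r where r: "r \<in> polys (int (n k) - 2)" "\<And>x. b k x = disk_rho x * r x"
      using disk_fun_factor[OF idx[of k]] by (auto simp: b_def)
    \<comment> \<open>Here the two degrees lost in the division count: \<open>n k - 2\<close> is the
      degree of the corresponding monomial and thus at most \<open>N\<close>.\<close>
    have "r \<in> polys (int N)" using r(1) k polys_mono[of "int (n k) - 2" "int N"] by (auto simp: n_def J_def)
    from mul[OF this] show "b k \<in> fun_vs.span (a ` J)" unfolding r(2)[symmetric] .
  next
    fix c assume z: "\<And>x. (\<Sum>k\<in>J. c k * b k x) = 0"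
    \<comment> \<open>Transports the coefficients to the set of pairs \<open>(n, t)\<close>, for
      which \<open>disk_fun_independent\<close> is stated.\<close>
    define c' where "c' = c \<circ> inv_into J idx"
    have "c' (idx k) = 0" if "k \<in> J" for k
    proof (rule disk_fun_independent[of "idx ` J"])
      show "finite (idx ` J)" "idx ` J \<subseteq> ell_index" "idx k \<in> idx ` J" using J idx that by (auto simp: idx_def)
      fix x
      have "(\<Sum>(n, t)\<in>idx ` J. c' (n, t) * disk_fun n t x) = (\<Sum>k\<in>J. c k * b k x)"
        unfolding sum.reindex[OF inj] by (rule sum.cong) (use inv_into_f_f[OF inj] in \<open>auto simp: c'_def idx_def b_def\<close>)
      then show "(\<Sum>(n, t)\<in>idx ` J. c' (n, t) * disk_fun n t x) = 0" using z by simp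
    qed
    then show "\<forall>k\<in>J. c k = 0" using inv_into_f_f[OF inj] by (simp add: c'_def)
  qed
  have bB: "b ` J \<subseteq> ?B" using idx by (auto simp: b_def)
  have "a ` J \<subseteq> fun_vs.span ?B" using aB fun_vs.span_mono[OF bB] by blast
  then have "fun_vs.span (a ` J) \<subseteq> fun_vs.span ?B" by (rule fun_vs.span_minimal[OF _ fun_vs.subspace_span])
  moreover have "q \<in> polys (int N)" using q polys_mono[of d "int N"] by (auto simp: N_def)
  ultimately show ?thesis using mul by blast
qed

text \<open>Gradients depend linearly on the function, so a combination of \<open>disk_fun\<close>
  has the same combination of \<open>eig_grad\<close> as its gradient.\<close>

lemma disk_span_approximable:
  assumes "w \<in> fun_vs.span {disk_fun n t | n t. (n, t) \<in> ell_index}"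
  shows "\<exists>g. (\<forall>y. ((\<lambda>y. w (chart y)) has_derivative (\<lambda>h. g y \<bullet> h)) (at y)) \<and>
     C1_approximable ell_index (\<lambda>(n, t). eig_grad n t) (interior \<Omega>) g"
proof (rule fun_vs.span_induct_alt[OF assms(1)])
  show "\<exists>g. (\<forall>y. ((\<lambda>y. 0 (chart y)) has_derivative (\<lambda>h. g y \<bullet> h)) (at y)) \<and>
     C1_approximable ell_index (\<lambda>(n, t). eig_grad n t) (interior \<Omega>) g"
    using C1_approximable_combination[of "{}" ell_index "\<lambda>(n, t). eig_grad n t"] by (intro exI[of _ "\<lambda>y. 0"]) simp
  fix c x y
  assume "x \<in> {disk_fun n t | n t. (n, t) \<in> ell_index}"
  then obtain n t where nt: "x = disk_fun n t" "(n, t) \<in> ell_index" by blast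
  then have t: "t > 0" by (simp add: ell_index_def)
  assume "\<exists>g. (\<forall>z. ((\<lambda>z. y (chart z)) has_derivative (\<lambda>h. g z \<bullet> h)) (at z)) \<and>
     C1_approximable ell_index (\<lambda>(n, t). eig_grad n t) (interior \<Omega>) g"
  then obtain g where g: "\<And>z. ((\<lambda>z. y (chart z)) has_derivative (\<lambda>h. g z \<bullet> h)) (at z)"
     "C1_approximable ell_index (\<lambda>(n, t). eig_grad n t) (interior \<Omega>) g" by blast
  have "C1_approximable ell_index (\<lambda>(n, t). eig_grad n t) (interior \<Omega>) (\<lambda>z. c *\<^sub>R eig_grad n t z)"
    using C1_approximable_combination[of "{(n, t)}" ell_index "\<lambda>(n, t). eig_grad n t" "interior \<Omega>" "\<lambda>i. c"] nt(2) by simp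
  then have "C1_approximable ell_index (\<lambda>(n, t). eig_grad n t) (interior \<Omega>) (\<lambda>z. c *\<^sub>R eig_grad n t z + g z)"
    by (rule C1_approximable_add[OF _ g(2)])
  moreover have "((\<lambda>z. ((\<lambda>u. c * x u) + y) (chart z)) has_derivative (\<lambda>h. (c *\<^sub>R eig_grad n t z + g z) \<bullet> h)) (at z)" for z
    unfolding plus_fun_apply nt(1) by (intro has_gradient_add has_gradient_cmult eig_grad_gradient t g(1))
  ultimately show "\<exists>g. (\<forall>z. ((\<lambda>z. ((\<lambda>u. c * x u) + y) (chart z)) has_derivative (\<lambda>h. g z \<bullet> h)) (at z)) \<and>
     C1_approximable ell_index (\<lambda>(n, t). eig_grad n t) (interior \<Omega>) g" 
    by - (rule exI[of _ "\<lambda>z. c *\<^sub>R eig_grad n t z + g z"], blast)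
qed

lemma ellipse_dense:
  assumes t: "test_fun (interior \<Omega>) \<phi> d\<phi>"
  shows "C1_approximable ell_index (\<lambda>(n, t). eig_grad n t) (interior \<Omega>) d\<phi>"
proof (rule C1_approximable_limit)
  fix \<epsilon> :: real assume e: "\<epsilon> > 0"
  have bi: "bounded (interior \<Omega>)" by (rule bounded_interior[OF compact_imp_bounded[OF ellipse_topology(5)]])
  obtain q dq where q: "real_polynomial_function q" "\<And>x. (q has_derivative (\<lambda>h. dq x \<bullet> h)) (at x)"
    "\<And>x. x \<in> interior \<Omega> \<Longrightarrow> norm (d\<phi> x - (chart_rho x *\<^sub>R dq x + q x *\<^sub>R chart_drho x)) \<le> \<epsilon>"
    using test_fun_C1_approx_with_factor[OF t open_interior bi chart_rho_has_gradient continuous_on_chart_drho chart_rho_props(1) e] by blast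
  \<comment> \<open>In disk coordinates \<open>q\<close> is again a polynomial, since the change of
    coordinates is affine.\<close>
  have "polynomial_function (\<lambda>x. A *v x + v)"
    by (intro polynomial_function_add polynomial_function_const polynomial_function_bounded_linear) simp
  from real_polynomial_function_in_polys[OF real_polynomial_function_compose[OF this q(1)]]
  obtain k where "q \<circ> (\<lambda>x. A *v x + v) \<in> polys k" by blast
  from disk_span_approximable[OF disk_rho_polys_span[OF this]]
  obtain g where g: "\<And>y. ((\<lambda>y. disk_rho (chart y) * (q \<circ> (\<lambda>x. A *v x + v)) (chart y)) has_derivative (\<lambda>h. g y \<bullet> h)) (at y)"
     "C1_approximable ell_index (\<lambda>(n, t). eig_grad n t) (interior \<Omega>) g" by blast
  have g1: "((\<lambda>y. chart_rho y * q y) has_derivative (\<lambda>h. g y \<bullet> h)) (at y)" for y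
    using g(1)[of y] unfolding o_def chart_inverse chart_rho_def .
  have "chart_rho x *\<^sub>R dq x + q x *\<^sub>R chart_drho x = g x" for x
    by (rule gradient_unique[OF has_gradient_mult[OF chart_rho_has_gradient q(2)] g1])
  then show "\<exists>w. C1_approximable ell_index (\<lambda>(n, t). eig_grad n t) (interior \<Omega>) w \<and> (\<forall>x\<in>interior \<Omega>. norm (d\<phi> x - w x) \<le> \<epsilon>)"
    using q(3) g(2) by auto
qed

lemma ellipse_spectrum_oriented:
  "P_pure_point \<Omega> \<and>
         closure (P_eigenvalues \<Omega>) = {0..1} \<and> P_eigenvalues \<Omega> \<subseteq> {0..1} \<and>
         P_eigenvalues \<Omega> = {l\<^sup>2 | l. 0 < l \<and> l < 1 \<and> rotation_number \<Omega> l \<in> \<rat>}"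
proof -
  define T where "T = {t. 0 < t \<and> angle t / pi \<in> \<rat>}"
  have *: "P_pure_point \<Omega> \<and> P_eigenvalues \<Omega> = (\<lambda>i. 1 / (1 + (snd i)\<^sup>2)) ` ell_index"
  proof (rule complete_eigenvector_family_uniform[OF compact_imp_bounded[OF ellipse_topology(5)],
        where u="\<lambda>(n, t) y. disk_fun n t (chart y)" and du="\<lambda>(n, t). eig_grad n t"])
    fix i assume i: "i \<in> ell_index"
    obtain n t where nt: "i = (n, t)" by (cases i)
    show "P_eigvec \<Omega> (1 / (1 + (snd i)\<^sup>2)) (\<lambda>x. if x \<in> interior \<Omega> then (case i of (n, t) \<Rightarrow> \<lambda>y. disk_fun n t (chart y)) x else 0)
        (\<lambda>x. if x \<in> interior \<Omega> then (case i of (n, t) \<Rightarrow> eig_grad n t) x else 0)"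
      using ellipse_P_eigvec[OF i[unfolded nt]] unfolding nt prod.case snd_conv .
  next
    fix \<phi> d\<phi> and \<epsilon> :: real assume "test_fun (interior \<Omega>) \<phi> d\<phi>" "\<epsilon> > 0"
    then show "\<exists>F c. finite F \<and> F \<subseteq> ell_index \<and> (\<forall>x\<in>interior \<Omega>. norm (d\<phi> x - (\<Sum>i\<in>F. c i *\<^sub>R (case i of (n, t) \<Rightarrow> eig_grad n t) x)) \<le> \<epsilon>)"
      using ellipse_dense unfolding C1_approximable_def by blast
  qed
  have sT: "snd ` ell_index = T"
  proof (rule set_eqI, rule iffI)
    fix t assume "t \<in> snd ` ell_index"
    then obtain n where n: "2 \<le> n" "0 < t" "sin (real n * angle t) = 0" by (auto simp: ell_index_def)
    then obtain k :: int where "real n * angle t = of_int k * pi" by (auto simp: sin_zero_iff_int2)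
    then have "angle t / pi = of_int k / real n" using n(1) by (simp add: field_simps)
    then show "t \<in> T" using n(2) by (simp add: T_def)
  next
    fix t assume t: "t \<in> T"
    then obtain m n :: nat where mn: "n \<noteq> 0" "\<bar>angle t / pi\<bar> = real m / real n" unfolding T_def by (auto elim: Rats_abs_nat_div_natE)
    have "angle t / pi = real m / real n" using mn(2) angle_range[of t] by simp
    \<comment> \<open>The doubled index \<open>2 * n\<close> is at least 2 for every nonzero
      \<open>n\<close>, as \<open>ell_index\<close> requires.\<close>
    then have "real (2 * n) * angle t = pi * real (2 * m)" using mn(1) by (simp add: field_simps)
    then have "sin (real (2 * n) * angle t) = 0" by (simp only: sin_npi2)
    then have "(2 * n, t) \<in> ell_index" using t mn(1) by (simp add: ell_index_def T_def)
    then show "t \<in> snd ` ell_index" by force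
  qed
  have ev: "P_eigenvalues \<Omega> = (\<lambda>t. 1 / (1 + t\<^sup>2)) ` T" unfolding conjunct2[OF *] sT[symmetric] image_image ..
  show ?thesis
  proof (rule spectrum_from_slopes[OF conjunct1[OF *] ev])
    show "T \<subseteq> {0<..}" by (auto simp: T_def)
    fix x y :: real assume xy: "0 < x" "x < y"
    have "angle x / pi < angle y / pi" using angle_strict_mono[OF xy] by (simp add: divide_strict_right_mono)
    \<comment> \<open>A rational multiple of \<open>pi\<close> between the two angles; surjectivity
      and monotonicity of \<open>angle\<close> bring it back to a slope between \<open>x\<close> and
      \<open>y\<close>.\<close>
    then obtain r where r: "r \<in> \<rat>" "angle x / pi < r" "r < angle y / pi" using Rats_dense_in_real by blast
    have b: "angle x < pi * r" "pi * r < angle y" using r by (auto simp: field_simps)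
    then have "0 < pi * r" "pi * r < pi" using angle_range[of x] angle_range[of y] by linarith+
    then obtain t where t: "t > 0" "angle t = pi * r" by (rule angle_surj)
    have "x < t" using angle_strict_mono[of t x] t b(1) by (cases t x rule: linorder_cases) auto
    moreover have "t < y" using angle_strict_mono[of y t] t b(2) xy by (cases y t rule: linorder_cases) auto
    moreover have "t \<in> T" using t r(1) by (simp add: T_def)
    ultimately show "\<exists>t\<in>T. x < t \<and> t < y" by blast
  next
    fix l :: real assume l: "0 < l" "l < 1"
    show "rotation_number \<Omega> l \<in> \<rat> \<longleftrightarrow> sqrt (1 - l\<^sup>2) / l \<in> T"
      unfolding ellipse_rotation_number[OF l] T_def using slope_of_parameter(1)[OF l] by simp
  qed
qed

end

theorem ellipse_spectrum:
  assumes "is_ellipse \<Omega>"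
  shows "P_pure_point \<Omega> \<and>
         closure (P_eigenvalues \<Omega>) = {0..1} \<and> P_eigenvalues \<Omega> \<subseteq> {0..1} \<and>
         P_eigenvalues \<Omega> = {l\<^sup>2 | l. 0 < l \<and> l < 1 \<and> rotation_number \<Omega> l \<in> \<rat>}"
proof -
  obtain A :: "real^2^2" and v where A: "det A \<noteq> 0" "\<Omega> = (\<lambda>x. A *v x + v) ` cball 0 1"
    using assms by (auto simp: is_ellipse_def)
  show ?thesis
  proof (cases "det A > 0")
    case True
    then show ?thesis by (rule ellipse_spectrum_oriented[OF _ A(2)])
  next
    case False
    \<comment> \<open>A reflection maps the disk to itself and reverses the sign of the determinant,
      so the ellipse also has a representation with positive determinant.\<close>
    define R :: "real^2^2" where "R = vector [vector [1, 0], vector [0, -1]]"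
    have Rx: "R *v x = vector [x $ 1, - x $ 2]" for x
      by (simp add: vec_eq_iff forall_2 R_def matrix_vector_mult_def sum_2)
    have "norm (R *v x) = norm x" for x
      by (rule power2_eq_imp_eq) (simp_all only: norm_vec2_sq Rx vector_2 power2_minus norm_ge_zero)
    moreover have "R *v (R *v x) = x" for x unfolding Rx by (simp add: vec_eq_iff forall_2)
    ultimately have im: "(*v) R ` cball 0 1 = cball 0 1"
      by (intro equalityI subsetI) (auto intro!: image_eqI[where x="R *v _"])
    have "det (A ** R) = - det A" by (simp add: det_mul) (simp add: det_2 R_def)
    then have "det (A ** R) > 0" using A(1) False by simp
    moreover have "\<Omega> = (\<lambda>x. (A ** R) *v x + v) ` cball 0 1"
    proof -
      have "(\<lambda>x. (A ** R) *v x + v) ` cball 0 1 = (\<lambda>x. A *v x + v) ` ((*v) R ` cball 0 1)"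
        by (simp add: image_image matrix_vector_mul_assoc)
      then show ?thesis unfolding im A(2) by simp
    qed
    ultimately show ?thesis by (rule ellipse_spectrum_oriented)
  qed
qed

theorem theorem2:
  fixes \<Omega> :: "(real^2) set"
  assumes "is_ellipse \<Omega> \<or> is_axis_rectangle \<Omega>"
  shows "P_pure_point \<Omega> \<and>
         closure (P_eigenvalues \<Omega>) = {0..1} \<and> P_eigenvalues \<Omega> \<subseteq> {0..1} \<and>
         P_eigenvalues \<Omega> = {l\<^sup>2 | l. 0 < l \<and> l < 1 \<and> rotation_number \<Omega> l \<in> \<rat>}"
  using assms ellipse_spectrum rectangle_spectrum by blast

end
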